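(* Let $G$ be a group, $R=\bigoplus_{g\in G}R_g$ a $G$-graded ring, and $H$ a normal subgroup of $G$. Suppose that $G$ is a locally finite $p$-group, where $p$ is a prime that is nilpotent in $R$. If $R$ is graded NR-clean as a $G/H$-graded ring, then $R[H]$ is graded NR-clean as a $G/H$-graded ring.
   Context: All rings are associative with unity (not necessarily commutative). For a group $\Gamma$, a ring $S$ is $\Gamma$-graded if $S=\bigoplus_{\gamma\in \Gamma}S_\gamma$ with $S_\gamma$ additive subgroups and $S_\gamma S_\delta\subseteq S_{\gamma\delta}$ for all $\gamma,\delta\in \Gamma$. The elements of $h(S)=\bigcup_{\gamma}S_\gamma$ are called homogeneous. A homogeneous element $r$ is graded-regular if $r=rar$ for some $a\in h(S)$; $gr(S)$ is the set of graded-regular elements and $N(S)$ is the set of nilpotent elements of $S$. A $\Gamma$-graded ring $S$ is ($\Gamma$-)graded NR-clean if every $x\in h(S)$ can be written $x=r+n$ with $r\in gr(S)$ and $n\in N(S)\cap h(S)$. For a $G$-graded ring $R$ and a normal subgroup $H$ of $G$: $R$ is viewed as a $G/H$-graded ring via $R=\bigoplus_{C\in G/H}R_C$, $R_C=\bigoplus_{x\in C}R_x$. The group ring $R[H]$ is the free left $R$-module on $H$ with multiplication determined by $(r_g g')(r_h h')=r_gr_h\,(h^{-1}g'h\,h')$ for $g,h\in G$, $g',h'\in H$, $r_g\in R_g$, $r_h\in R_h$. It is $G$-graded with $g$-component $(R[H])_g=\bigoplus_{h\in H}R_{gh^{-1}}h$, and is viewed as a $G/H$-graded ring with components $(R[H])_C=\bigoplus_{x\in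 C}(R[H])_x$ for $C\in G/H$. *)

theory Defs
  imports "HOL-Algebra.Algebra" "HOL-Computational_Algebra.Primes"
begin

section \<open>Graded rings\<close>

text \<open>A family \<open>d\<close> is a decomposition of \<open>x\<close> if its members lie in the given
  components, almost all of them vanish, and they add up to \<open>x\<close>. Families are extensional on
  \<open>carrier \<Gamma>\<close>, so that uniqueness of the decomposition is meaningful.\<close>

definition graded_support ::
  "('g, 'm) monoid_scheme \<Rightarrow> ('a, 'n) ring_scheme \<Rightarrow> ('g \<Rightarrow> 'a) \<Rightarrow> 'g set"
  where "graded_support \<Gamma> S d = {\<gamma> \<in> carrier \<Gamma>. d \<gamma> \<noteq> \<zero>\<^bsub>S\<^esub>}"

definition is_decomposition ::
  "('g, 'm) monoid_scheme \<Rightarrow> ('a, 'n) ring_scheme \<Rightarrow> ('g \<Rightarrow> 'a set) \<Rightarrow> 'a \<Rightarrow> ('g \<Rightarrow> 'a) \<Rightarrow> bool"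
  where "is_decomposition \<Gamma> S grd x d \<longleftrightarrow>
    d \<in> (\<Pi>\<^sub>E \<gamma>\<in>carrier \<Gamma>. grd \<gamma>) \<and>
    finite (graded_support \<Gamma> S d) \<and>
    x = (\<Oplus>\<^bsub>S\<^esub>\<gamma>\<in>graded_support \<Gamma> S d. d \<gamma>)"

locale graded_ring = grp: group \<Gamma> + rng: ring S
  for \<Gamma> :: "('g, 'm) monoid_scheme" and S :: "('a, 'n) ring_scheme" +
  fixes grd :: "'g \<Rightarrow> 'a set"
  assumes comp_additive_subgroup: "\<gamma> \<in> carrier \<Gamma> \<Longrightarrow> additive_subgroup (grd \<gamma>) S"
    and comp_mult:
      "\<lbrakk>\<gamma> \<in> carrier \<Gamma>; \<delta> \<in> carrier \<Gamma>; x \<in> grd \<gamma>; y \<in> grd \<delta>\<rbrakk>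
        \<Longrightarrow> x \<otimes>\<^bsub>S\<^esub> y \<in> grd (\<gamma> \<otimes>\<^bsub>\<Gamma>\<^esub> \<delta>)"
    and direct_sum: "x \<in> carrier S \<Longrightarrow> \<exists>!d. is_decomposition \<Gamma> S grd x d"

definition hcomponent ::
  "('g, 'm) monoid_scheme \<Rightarrow> ('a, 'n) ring_scheme \<Rightarrow> ('g \<Rightarrow> 'a set) \<Rightarrow> 'a \<Rightarrow> 'g \<Rightarrow> 'a"
  where "hcomponent \<Gamma> S grd x = (THE d. is_decomposition \<Gamma> S grd x d)"

definition homogeneous_elements ::
  "('g, 'm) monoid_scheme \<Rightarrow> ('g \<Rightarrow> 'a set) \<Rightarrow> 'a set"
  where "homogeneous_elements \<Gamma> grd = (\<Union>\<gamma>\<in>carrier \<Gamma>. grd \<gamma>)"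

definition graded_regular_elements ::
  "('g, 'm) monoid_scheme \<Rightarrow> ('a, 'n) ring_scheme \<Rightarrow> ('g \<Rightarrow> 'a set) \<Rightarrow> 'a set"
  where "graded_regular_elements \<Gamma> S grd =
    {r \<in> homogeneous_elements \<Gamma> grd.
      \<exists>a\<in>homogeneous_elements \<Gamma> grd. r = r \<otimes>\<^bsub>S\<^esub> a \<otimes>\<^bsub>S\<^esub> r}"

definition nilpotent_elements :: "('a, 'n) ring_scheme \<Rightarrow> 'a set"
  where "nilpotent_elements S = {x \<in> carrier S. \<exists>n::nat. x [^]\<^bsub>S\<^esub> n = \<zero>\<^bsub>S\<^esub>}"

definition graded_NR_clean ::
  "('g, 'm) monoid_scheme \<Rightarrow> ('a, 'n) ring_scheme \<Rightarrow> ('g \<Rightarrow> 'a set) \<Rightarrow> bool"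
  where "graded_NR_clean \<Gamma> S grd \<longleftrightarrow>
    graded_ring \<Gamma> S grd \<and>
    (\<forall>x\<in>homogeneous_elements \<Gamma> grd.
      \<exists>r\<in>graded_regular_elements \<Gamma> S grd.
      \<exists>n\<in>nilpotent_elements S \<inter> homogeneous_elements \<Gamma> grd.
        x = r \<oplus>\<^bsub>S\<^esub> n)"

text \<open>The component at a coset \<open>C\<close> of the quotient grading is the internal sum of the components
  indexed by the elements of \<open>C\<close>, i.e. the set of all finite sums of their elements.\<close>

definition quotient_comp ::
  "('a, 'n) ring_scheme \<Rightarrow> ('g \<Rightarrow> 'a set) \<Rightarrow> 'g set \<Rightarrow> 'a set"
  where "quotient_comp S grd C =
    {(\<Oplus>\<^bsub>S\<^esub>x\<in>F. r x) | F r. finite F \<and> F \<subseteq> C \<and> r \<in> (\<Pi> x\<in>F. grd x)}"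

section \<open>The group ring \<open>R[H]\<close>\<close>

text \<open>Elements are finitely supported functions \<open>f\<close> from \<open>H\<close> to \<open>R\<close>, standing for the sum of the
  \<open>f(a) a\<close> over \<open>a\<close> in \<open>H\<close>. The multiplication is the biadditive extension of
  \<open>(r a)(s b) = r s (h\<^sup>-\<^sup>1 a h b)\<close> for \<open>s\<close> in \<open>R\<^sub>h\<close>: the right-hand coefficients are split into their
  homogeneous components, and the coefficient of the product at \<open>k\<close> collects all triples \<open>(a, b, h)\<close>
  with \<open>h\<^sup>-\<^sup>1 a h b = k\<close>. Only the degree of the right-hand
  coefficient enters the rule, so the left-hand ones need not be split.\<close>

definition group_ring_carrier :: "('a, 'n) ring_scheme \<Rightarrow> 'g set \<Rightarrow> ('g \<Rightarrow> 'a) set"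
  where "group_ring_carrier R H =
    {f \<in> H \<rightarrow>\<^sub>E carrier R. finite {a \<in> H. f a \<noteq> \<zero>\<^bsub>R\<^esub>}}"

definition group_ring_mult ::
  "('g, 'm) monoid_scheme \<Rightarrow> ('a, 'n) ring_scheme \<Rightarrow> ('g \<Rightarrow> 'a set) \<Rightarrow> 'g set
    \<Rightarrow> ('g \<Rightarrow> 'a) \<Rightarrow> ('g \<Rightarrow> 'a) \<Rightarrow> ('g \<Rightarrow> 'a)"
  where "group_ring_mult G R grd H f f' =
    (\<lambda>k\<in>H.
      \<Oplus>\<^bsub>R\<^esub>a\<in>{a \<in> H. f a \<noteq> \<zero>\<^bsub>R\<^esub>}.
      \<Oplus>\<^bsub>R\<^esub>b\<in>{b \<in> H. f' b \<noteq> \<zero>\<^bsub>R\<^esub>}.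
      \<Oplus>\<^bsub>R\<^esub>h\<in>{h \<in> graded_support G R (hcomponent G R grd (f' b)).
             inv\<^bsub>G\<^esub> h \<otimes>\<^bsub>G\<^esub> a \<otimes>\<^bsub>G\<^esub> h \<otimes>\<^bsub>G\<^esub> b = k}.
        f a \<otimes>\<^bsub>R\<^esub> hcomponent G R grd (f' b) h)"

definition group_ring ::
  "('g, 'm) monoid_scheme \<Rightarrow> ('a, 'n) ring_scheme \<Rightarrow> ('g \<Rightarrow> 'a set) \<Rightarrow> 'g set \<Rightarrow> ('g \<Rightarrow> 'a) ring"
  where "group_ring G R grd H =
    \<lparr>carrier = group_ring_carrier R H,
     monoid.mult = group_ring_mult G R grd H,
     monoid.one = (\<lambda>a\<in>H. if a = \<one>\<^bsub>G\<^esub> then \<one>\<^bsub>R\<^esub> else \<zero>\<^bsub>R\<^esub>),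
     ring.zero = (\<lambda>a\<in>H. \<zero>\<^bsub>R\<^esub>),
     ring.add = (\<lambda>f f'. \<lambda>a\<in>H. f a \<oplus>\<^bsub>R\<^esub> f' a)\<rparr>"

definition group_ring_comp ::
  "('g, 'm) monoid_scheme \<Rightarrow> ('a, 'n) ring_scheme \<Rightarrow> ('g \<Rightarrow> 'a set) \<Rightarrow> 'g set
    \<Rightarrow> 'g \<Rightarrow> ('g \<Rightarrow> 'a) set"
  where "group_ring_comp G R grd H g =
    {f \<in> group_ring_carrier R H. \<forall>h\<in>H. f h \<in> grd (g \<otimes>\<^bsub>G\<^esub> inv\<^bsub>G\<^esub> h)}"

section \<open>Locally finite \<open>p\<close>-groups\<close>

definition locally_finite_group :: "('g, 'm) monoid_scheme \<Rightarrow> bool"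
  where "locally_finite_group G \<longleftrightarrow>
    group G \<and> (\<forall>A. finite A \<and> A \<subseteq> carrier G \<longrightarrow> finite (generate G A))"

text \<open>\<^const>\<open>group.ord\<close> is 0 on elements of infinite order, so these are excluded here.\<close>

definition p_group :: "nat \<Rightarrow> ('g, 'm) monoid_scheme \<Rightarrow> bool"
  where "p_group p G \<longleftrightarrow>
    group G \<and> (\<forall>x\<in>carrier G. \<exists>k::nat. group.ord G x = p ^ k)"

end

theory Submission
  imports Defs
begin

text \<open>The augmentation \<open>\<Sum> r\<^sub>h h \<mapsto> \<Sum> r\<^sub>h\<close> is a graded ring homomorphism from \<open>R[H]\<close> to \<open>R\<close>, split by
  \<open>r \<mapsto> r 1\<close>. If the augmentation of a homogeneous \<open>x\<close> is \<open>r + n\<close> with \<open>r\<close> graded-regular and \<open>n\<close>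
  nilpotent, then \<open>x = r 1 + (x - r 1)\<close>, where \<open>r 1\<close> is again graded-regular and \<open>x - r 1\<close> has
  nilpotent augmentation, so it remains to see that the augmentation ideal is nil.

  Sending \<open>r a\<close>, for \<open>r\<close> in \<open>R\<^sub>h\<close>, to \<open>r (h a)\<close> embeds \<open>R[H]\<close> into the ordinary group ring \<open>RG\<close>. An
  element of augmentation 0 thus lies in the augmentation ideal of \<open>RK\<close> for a finite \<open>p\<close>-subgroup \<open>K\<close>
  of \<open>G\<close>. That ideal is nilpotent because \<open>p\<close> is nilpotent in \<open>R\<close>: a nonzero finite \<open>p\<close>-primary
  \<open>K\<close>-module has a nonzero fixed point, so the ascending fixed-point series of functions from \<open>K\<close> to
  the integers mod \<open>p\<^sup>k\<close> reaches the top.\<close>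

section \<open>Finite \<open>p\<close>-groups\<close>

text \<open>Passing to \<open>G/H\<close> is what makes the augmentation graded: dropping
  \<open>h\<close> changes the \<open>G\<close>-degree of \<open>r h\<close>, but not its coset. The
  group \<open>K\<close> need not lie in \<open>H\<close>, because it is generated by products
  \<open>h a\<close> in which \<open>h\<close> is a degree, an arbitrary element of
  \<open>G\<close>; this is why finiteness and \<open>p\<close>-power orders are wanted in
  \<open>G\<close>. The ring \<open>RG\<close> is present only through its action on functions from
  \<open>G\<close> to \<open>R\<close>: products become composites, and injectivity is tested on the
  function that is 1 at the identity and 0 elsewhere. Fixed points are found by counting, which is
  impossible in \<open>R\<close> itself, as \<open>R\<close> may be infinite. The counting is
  therefore done with functions from \<open>K\<close> to the integers mod \<open>p ^ k\<close>,
  whose number is finite whatever \<open>R\<close> is. Such functions serve as weights for values in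
  \<open>R\<close>, and integer multiples commute with all coefficients, so every factor of
  augmentation zero uses up one level of the series even if \<open>R\<close> is not
  commutative.\<close>

lemma (in group) order_eq_prime_power:
  assumes p: "Factorial_Ring.prime (p::nat)" and fin: "finite (carrier G)"
    and pow: "\<And>x. x \<in> carrier G \<Longrightarrow> \<exists>k::nat. x [^] (p ^ k) = \<one>"
  shows "\<exists>n. order G = p ^ n"
proof -
  have "order G \<noteq> 0"
    using fin by (simp add: order_gt_0_iff_finite)
  then obtain m where m: "order G = p ^ multiplicity p (order G) * m" "\<not> p dvd m"
    using multiplicity_decompose'[of "order G" p] p by (metis not_prime_unit)
  have "m = 1"
  proof (rule ccontr)
    assume "m \<noteq> 1"
    then obtain r where r: "Factorial_Ring.prime r" "r dvd m"
      using prime_factor_nat by blast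
    have "coprime r p"
      using r p m(2) primes_coprime by blast
    \<comment> \<open>Sylow's theorem with exponent 1 serves as Cauchy's theorem: it gives a
      subgroup of order \<open>r\<close>, and the order of its elements divides both
      \<open>r\<close> and a power of \<open>p\<close>.\<close>
    from r m obtain m' where "order G = r ^ 1 * m'"
      by (metis dvd_def mult.left_commute power_one_right)
    then obtain P where P: "subgroup P G" "card P = r ^ 1"
      using Sylow.sylow_thm[OF r(1) is_group _ fin] by blast
    then have "card P \<noteq> 1"
      using r(1) by auto
    have "\<one> \<in> P"
      using P(1) subgroup.one_closed by blast
    obtain x where x: "x \<in> P" "x \<noteq> \<one>"
    proof -
      have "P \<noteq> {\<one>}"
        using \<open>card P \<noteq> 1\<close> by auto
      then show ?thesis
        using that \<open>\<one> \<in> P\<close> by blast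
    qed
    have xG: "x \<in> carrier G"
      using P(1) x(1) subgroup.mem_carrier by metis
    have grpP: "group (G\<lparr>carrier := P\<rparr>)"
      using P(1) subgroup.subgroup_is_group is_group by blast
    have "x [^]\<^bsub>G\<lparr>carrier := P\<rparr>\<^esub> order (G\<lparr>carrier := P\<rparr>) = \<one>\<^bsub>G\<lparr>carrier := P\<rparr>\<^esub>"
      using group.pow_order_eq_1[OF grpP, of x] x(1) by simp
    then have "x [^] r = \<one>"
      using P(2) by (simp add: order_def flip: nat_pow_consistent)
    then have "ord x dvd r"
      using pow_eq_id xG by blast
    moreover obtain k where "x [^] (p ^ k) = \<one>"
      using pow xG by blast
    then have "ord x dvd p ^ k"
      using pow_eq_id xG by blast
    ultimately have "ord x = 1"
      using \<open>coprime r p\<close> by (metis coprime_common_divisor_nat coprime_power_right_iff)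
    then show False
      using x(2) xG ord_eq_1 by blast
  qed
  then show ?thesis
    using m(1) by auto
qed

text \<open>Orbit counting: an orbit that is not a singleton has a size dividing
  \<open>p ^ n\<close> and different from 1, hence divisible by \<open>p\<close>, and these orbits
  partition the complement of the fixed points.\<close>

lemma (in group_action) prime_dvd_card_fixed_points:
  assumes p: "Factorial_Ring.prime (p::nat)" and ord: "order G = p ^ n"
    and fin: "finite E" and dvd: "p dvd card E"
  shows "p dvd card {x \<in> E. \<forall>g\<in>carrier G. \<phi> g x = x}"
proof -
  interpret G: group G
    using group_hom group_hom.axioms(1) by blast
  define Fix where "Fix = {x \<in> E. \<forall>g\<in>carrier G. \<phi> g x = x}"
  define C where "C = {Y \<in> orbits G E \<phi>. card Y \<noteq> 1}"
  note part = partition.partition_coverture[OF orbit_partition]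
    partition.disjoint_union[OF orbit_partition]
  have subE: "Y \<subseteq> E" if "Y \<in> orbits G E \<phi>" for Y
    using that part by blast
  have "p dvd card (\<Union>C)"
  proof (rule dvd_partition)
    show "finite (\<Union>C)"
      using subE fin by (metis (no_types, lifting) C_def Sup_le_iff finite_subset mem_Collect_eq)
    show "\<forall>c\<in>C. p dvd card c"
    proof
      fix c assume "c \<in> C"
      then obtain x where x: "x \<in> E" "c = orbit G \<phi> x" "card c \<noteq> 1"
        by (auto simp: C_def orbits_def)
      then have "card c dvd p ^ n"
        using orbit_stabilizer_theorem[OF x(1)] ord by (metis dvd_triv_left)
      then obtain i where "card c = p ^ i"
        using p divides_primepow_nat by blast
      with x(3) show "p dvd card c"
        by (cases i) auto
    qed
    show "\<forall>c1\<in>C. \<forall>c2\<in>C. c1 \<noteq> c2 \<longrightarrow> c1 \<inter> c2 = {}"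
      using part by (metis (no_types, lifting) C_def mem_Collect_eq)
  qed
  moreover have "\<Union>C = E - Fix"
  proof (intro equalityI subsetI)
    fix x assume "x \<in> \<Union>C"
    then obtain Y where Y: "Y \<in> orbits G E \<phi>" "card Y \<noteq> 1" "x \<in> Y"
      by (auto simp: C_def)
    then have xE: "x \<in> E" using subE by blast
    have "Y = orbit G \<phi> x"
    proof -
      have "orbit G \<phi> x \<in> orbits G E \<phi>" "x \<in> orbit G \<phi> x"
        using xE orbit_refl[OF xE] by (auto simp: orbits_def)
      then show ?thesis
        using part(2)[of Y "orbit G \<phi> x"] Y by blast
    qed
    moreover have "orbit G \<phi> x = {x}" if "x \<in> Fix"
      using that xE G.one_closed by (auto simp: orbit_def Fix_def intro!: exI[of _ "\<one>\<^bsub>G\<^esub>"])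
    ultimately show "x \<in> E - Fix"
      using Y(2) xE by auto
  next
    fix x assume x: "x \<in> E - Fix"
    then obtain g where g: "g \<in> carrier G" "\<phi> g x \<noteq> x"
      by (auto simp: Fix_def)
    have "x \<in> orbit G \<phi> x" using x orbit_refl by blast
    moreover have "\<phi> g x \<in> orbit G \<phi> x" using g by (auto simp: orbit_def)
    ultimately have "card (orbit G \<phi> x) \<noteq> 1"
      using g(2) by (metis card_1_singletonE singletonD)
    then show "x \<in> \<Union>C"
      using x \<open>x \<in> orbit G \<phi> x\<close> by (auto simp: C_def orbits_def)
  qed
  ultimately have "p dvd card (E - Fix)" by simp
  moreover have "card E = card (E - Fix) + card Fix"
    using fin by (metis (no_types, lifting) Fix_def add.commute card_Diff_subset card_mono finite_subset le_add_diff_inverse mem_Collect_eq subsetI)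
  ultimately show ?thesis
    using dvd by (simp add: dvd_add_right_iff flip: Fix_def)
qed

text \<open>The cosets of \<open>W\<close> form a nontrivial finite group of elements of
  \<open>p\<close>-power order, so \<open>p\<close> divides their number and hence the number of
  cosets fixed by \<open>K\<close>. As \<open>W\<close> itself is fixed, there is a second fixed
  coset, and the conclusion states this for a representative. Finiteness is asked of the quotient
  because \<open>A\<close> will be the infinite group of all integer-valued functions.\<close>

lemma fixed_coset_of_p_group:
  assumes p: "Factorial_Ring.prime (p::nat)" and "group K" and ord: "order K = p ^ n"
    and "comm_group A" and W: "subgroup W A" and fin: "finite (rcosets\<^bsub>A\<^esub> W)"
    and proper: "W \<noteq> carrier A"
    and hom: "\<And>g. g \<in> carrier K \<Longrightarrow> \<sigma> g \<in> hom A A"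
    and one: "\<And>a. a \<in> carrier A \<Longrightarrow> \<sigma> \<one>\<^bsub>K\<^esub> a = a"
    and mult: "\<And>g h a. \<lbrakk>g \<in> carrier K; h \<in> carrier K; a \<in> carrier A\<rbrakk>
      \<Longrightarrow> \<sigma> (g \<otimes>\<^bsub>K\<^esub> h) a = \<sigma> g (\<sigma> h a)"
    and inv: "\<And>g a. \<lbrakk>g \<in> carrier K; a \<in> W\<rbrakk> \<Longrightarrow> \<sigma> g a \<in> W"
    and pow: "\<And>a. a \<in> carrier A \<Longrightarrow> \<exists>k::nat. a [^]\<^bsub>A\<^esub> (p ^ k) \<in> W"
  shows "\<exists>a\<in>carrier A - W. \<forall>g\<in>carrier K. \<sigma> g a \<otimes>\<^bsub>A\<^esub> inv\<^bsub>A\<^esub> a \<in> W"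
proof -
  interpret K: group K by fact
  interpret A: comm_group A by fact
  interpret W: subgroup W A by fact
  interpret N: normal W A
    using A.normal_iff_subgroup W by blast
  interpret Q: group "A Mod W" by (rule N.factorgroup_is_group)
  define E where "E = rcosets\<^bsub>A\<^esub> W"
  have carQ: "carrier (A Mod W) = E"
    by (simp add: FactGroup_def E_def)
  have Q_pow: "(W #>\<^bsub>A\<^esub> a) [^]\<^bsub>A Mod W\<^esub> (k::nat) = W #>\<^bsub>A\<^esub> (a [^]\<^bsub>A\<^esub> k)" if "a \<in> carrier A" for a k
  proof (induction k)
    case 0
    then show ?case by (simp add: A.coset_mult_one W.subset)
  next
    case (Suc k)
    then show ?case using that by (simp add: N.rcos_sum)
  qed
  have E_cases: "\<exists>a\<in>carrier A. C = W #>\<^bsub>A\<^esub> a" if "C \<in> E" for C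
    using that by (auto simp: E_def RCOSETS_def)
  have E_I: "W #>\<^bsub>A\<^esub> a \<in> E" if "a \<in> carrier A" for a
    using that by (auto simp: E_def RCOSETS_def)
  have "\<exists>i. order (A Mod W) = p ^ i"
  proof (rule Q.order_eq_prime_power[OF p])
    show "finite (carrier (A Mod W))" using fin by (simp add: carQ E_def)
    fix C assume "C \<in> carrier (A Mod W)"
    then obtain a where a: "a \<in> carrier A" "C = W #>\<^bsub>A\<^esub> a"
      using E_cases carQ by blast
    obtain k where "a [^]\<^bsub>A\<^esub> (p ^ k) \<in> W" using pow a(1) by blast
    then have "C [^]\<^bsub>A Mod W\<^esub> (p ^ k) = \<one>\<^bsub>A Mod W\<^esub>"
      using a A.coset_join2 W by (simp add: Q_pow)
    then show "\<exists>k. C [^]\<^bsub>A Mod W\<^esub> (p ^ k) = \<one>\<^bsub>A Mod W\<^esub>" by blast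
  qed
  then obtain i where i: "card E = p ^ i" by (auto simp: order_def carQ)
  have "card E \<noteq> 1"
  proof
    assume "card E = 1"
    then obtain Y where "E = {Y}" by (rule card_1_singletonE)
    then have "W #>\<^bsub>A\<^esub> a = W" if "a \<in> carrier A" for a
      using E_I[OF that] E_I[OF A.one_closed] W.subset by (simp add: A.coset_mult_one)
    then show False
      using proper W.subset A.coset_join1[OF _ _ W] by blast
  qed
  then have dvd: "p dvd card E" using i by (cases i) auto

  have img: "\<sigma> g ` (W #>\<^bsub>A\<^esub> a) = W #>\<^bsub>A\<^esub> \<sigma> g a" if g: "g \<in> carrier K" and a: "a \<in> carrier A" for g a
  proof -
    have h: "\<sigma> g (w \<otimes>\<^bsub>A\<^esub> a) = \<sigma> g w \<otimes>\<^bsub>A\<^esub> \<sigma> g a" if "w \<in> W" for w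
      using hom[OF g] that a by (auto simp: hom_def)
    \<comment> \<open>Invariance of \<open>W\<close> under \<open>inv g\<close> yields the inclusion
      opposite to the assumed one, so \<open>g\<close> permutes \<open>W\<close> and maps cosets
      onto cosets.\<close>
    have "w \<in> \<sigma> g ` W" if "w \<in> W" for w
      using that g inv[of "inv\<^bsub>K\<^esub> g" w] mult[of g "inv\<^bsub>K\<^esub> g" w] one[of w]
      by (metis K.inv_closed K.r_inv W.mem_carrier image_eqI)
    then have "\<sigma> g ` W = W" using inv g by blast
    have "\<sigma> g ` (W #>\<^bsub>A\<^esub> a) = (\<lambda>w. \<sigma> g w \<otimes>\<^bsub>A\<^esub> \<sigma> g a) ` W"
      using h by (force simp: r_coset_def)
    also have "\<dots> = (\<lambda>w. w \<otimes>\<^bsub>A\<^esub> \<sigma> g a) ` W"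
      by (subst (2) \<open>\<sigma> g ` W = W\<close>[symmetric]) (simp add: image_image)
    finally show ?thesis by (auto simp: r_coset_def)
  qed
  have closed: "\<sigma> g a \<in> carrier A" if "g \<in> carrier K" "a \<in> carrier A" for g a
    using hom[OF that(1)] that(2) by (auto simp: hom_def)
  \<comment> \<open>The restriction to \<open>E\<close> is there because the elements of
    \<open>BijGroup E\<close> are extensional.\<close>
  define \<phi> where "\<phi> g = (\<lambda>C\<in>E. \<sigma> g ` C)" for g
  have \<phi>: "\<phi> g (W #>\<^bsub>A\<^esub> a) = W #>\<^bsub>A\<^esub> \<sigma> g a" if "g \<in> carrier K" "a \<in> carrier A" for g a
    using that by (simp add: \<phi>_def E_I img)
  have \<phi>_comp: "\<phi> (g \<otimes>\<^bsub>K\<^esub> h) C = \<phi> g (\<phi> h C)" if "g \<in> carrier K" "h \<in> carrier K" "C \<in> E" for g h C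
    using that E_cases[of C] by (auto simp: \<phi> mult closed)
  have \<phi>_one: "\<phi> \<one>\<^bsub>K\<^esub> C = C" if "C \<in> E" for C
    using that E_cases[of C] by (auto simp: \<phi> one)
  have \<phi>_closed: "\<phi> g C \<in> E" if "g \<in> carrier K" "C \<in> E" for g C
    using that E_cases[of C] by (auto simp: \<phi> closed E_I)
  have \<phi>_Bij: "\<phi> g \<in> Bij E" if g: "g \<in> carrier K" for g
  proof -
    have "bij_betw (\<phi> g) E E"
      using \<phi>_comp[of g "inv\<^bsub>K\<^esub> g"] \<phi>_comp[of "inv\<^bsub>K\<^esub> g" g] \<phi>_one g
      by (intro bij_betw_byWitness[of _ "\<phi> (inv\<^bsub>K\<^esub> g)"]) (auto simp: \<phi>_closed)
    then show ?thesis by (simp add: Bij_def \<phi>_def)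
  qed
  interpret act: group_action K E \<phi>
  proof (unfold group_action_def group_hom_def group_hom_axioms_def, intro conjI)
    show "\<phi> \<in> hom K (BijGroup E)"
    proof (rule homI)
      fix g h assume gh: "g \<in> carrier K" "h \<in> carrier K"
      show "\<phi> g \<in> carrier (BijGroup E)" using \<phi>_Bij gh by (simp add: BijGroup_def)
      show "\<phi> (g \<otimes>\<^bsub>K\<^esub> h) = \<phi> g \<otimes>\<^bsub>BijGroup E\<^esub> \<phi> h"
      proof (rule extensionalityI[of _ E])
        show "\<phi> (g \<otimes>\<^bsub>K\<^esub> h) \<in> extensional E" by (simp add: \<phi>_def)
        show "\<phi> g \<otimes>\<^bsub>BijGroup E\<^esub> \<phi> h \<in> extensional E"
          using \<phi>_Bij gh by (simp add: BijGroup_def compose_def)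
        show "\<phi> (g \<otimes>\<^bsub>K\<^esub> h) C = (\<phi> g \<otimes>\<^bsub>BijGroup E\<^esub> \<phi> h) C" if "C \<in> E" for C
          using \<phi>_Bij gh that by (simp add: BijGroup_def compose_def \<phi>_comp)
      qed
    qed
  qed (use group_BijGroup in \<open>auto intro: K.is_group\<close>)
  define Fix where "Fix = {C \<in> E. \<forall>g\<in>carrier K. \<phi> g C = C}"
  have "p dvd card Fix"
    unfolding Fix_def using act.prime_dvd_card_fixed_points[OF p ord _ dvd] fin by (simp add: E_def)
  moreover have W_Fix: "W \<in> Fix"
  proof -
    have W1: "W #>\<^bsub>A\<^esub> \<one>\<^bsub>A\<^esub> = W" using W.subset by (simp add: A.coset_mult_one)
    have "\<phi> g W = W" if "g \<in> carrier K" for g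
      using \<phi>[OF that A.one_closed] hom_one[OF hom[OF that] A.is_group A.is_group] W1 by simp
    moreover have "W \<in> E" using E_I[OF A.one_closed] W1 by simp
    ultimately show ?thesis by (simp add: Fix_def)
  qed
  have "Fix \<noteq> {W}"
  proof
    assume "Fix = {W}"
    then have "p dvd 1" using \<open>p dvd card Fix\<close> by simp
    then show False using p by auto
  qed
  then obtain C where C: "C \<in> Fix" "C \<noteq> W" using W_Fix by blast
  then have "C \<in> E" by (simp add: Fix_def)
  then obtain a where a: "a \<in> carrier A" "C = W #>\<^bsub>A\<^esub> a"
    using E_cases by blast
  have "a \<notin> W"
    using C(2) a A.coset_join2[OF a(1) W] by blast
  moreover have "\<sigma> g a \<otimes>\<^bsub>A\<^esub> inv\<^bsub>A\<^esub> a \<in> W" if g: "g \<in> carrier K" for g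
  proof -
    have "W #>\<^bsub>A\<^esub> \<sigma> g a = W #>\<^bsub>A\<^esub> a"
      using C(1) a \<phi>[OF g a(1)] g by (auto simp: Fix_def)
    then have "\<sigma> g a \<in> W #>\<^bsub>A\<^esub> a"
      using A.rcos_self[OF closed[OF g a(1)] W] by simp
    then show ?thesis
      using W.rcos_module_imp[OF A.is_group a(1)] by blast
  qed
  ultimately show ?thesis using a(1) by blast
qed

section \<open>Nilpotency of the augmentation ideal\<close>

text \<open>Values off the carrier are kept, so that the laws of a group action hold as equations
  between total functions.\<close>

definition translate :: "('g, 'm) monoid_scheme \<Rightarrow> 'g \<Rightarrow> ('g \<Rightarrow> 'b) \<Rightarrow> 'g \<Rightarrow> 'b"
  where "translate G g w = (\<lambda>k. if k \<in> carrier G then w (inv\<^bsub>G\<^esub> g \<otimes>\<^bsub>G\<^esub> k) else w k)"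

text \<open>Levels of the ascending fixed-point series of the \<open>G\<close>-module of functions from \<open>G\<close> to the
  integers mod \<open>q\<close>, pulled back to integer-valued functions.\<close>

primrec fixed_level :: "('g, 'm) monoid_scheme \<Rightarrow> int \<Rightarrow> nat \<Rightarrow> ('g \<Rightarrow> int) set" where
  "fixed_level G q 0 = {w. \<forall>k\<in>carrier G. q dvd w k}"
| "fixed_level G q (Suc j) =
    {w. \<forall>g\<in>carrier G. (\<lambda>k. translate G g w k - w k) \<in> fixed_level G q j}"

section \<open>Invariance and growth of the fixed-point series\<close>

context group
begin

lemma translate_one: "translate G \<one> w = w"
  by (auto simp: translate_def fun_eq_iff)

lemma translate_mult:
  "\<lbrakk>g \<in> carrier G; h \<in> carrier G\<rbrakk> \<Longrightarrow> translate G (g \<otimes> h) w = translate G g (translate G h w)"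
  by (auto simp: translate_def fun_eq_iff inv_mult_group m_assoc)

lemma fixed_level_zero: "(\<lambda>k. 0) \<in> fixed_level G q j"
  by (induction j) (simp_all add: translate_def)

lemma fixed_level_diff:
  "\<lbrakk>u \<in> fixed_level G q j; v \<in> fixed_level G q j\<rbrakk> \<Longrightarrow> (\<lambda>k. u k - v k) \<in> fixed_level G q j"
proof (induction j arbitrary: u v)
  case 0
  then show ?case by simp
next
  case (Suc j)
  have "(\<lambda>k. translate G g (\<lambda>k. u k - v k) k - (u k - v k)) =
      (\<lambda>k. (translate G g u k - u k) - (translate G g v k - v k))" for g
    by (auto simp: translate_def fun_eq_iff)
  with Suc show ?case by simp
qed

lemma fixed_level_uminus: "u \<in> fixed_level G q j \<Longrightarrow> (\<lambda>k. - u k) \<in> fixed_level G q j"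
  using fixed_level_diff[OF fixed_level_zero] by fastforce

lemma fixed_level_add:
  "\<lbrakk>u \<in> fixed_level G q j; v \<in> fixed_level G q j\<rbrakk> \<Longrightarrow> (\<lambda>k. u k + v k) \<in> fixed_level G q j"
  using fixed_level_diff[OF _ fixed_level_uminus] by fastforce

text \<open>Since \<open>g h = h (h^-1 g h)\<close>, the difference along \<open>g\<close> of the
  translate by \<open>h\<close> is the translate by \<open>h\<close> of a difference along a
  conjugate of \<open>g\<close>; the condition on a level ranges over all of \<open>G\<close> and so
  absorbs conjugation.\<close>

lemma fixed_level_translate:
  "\<lbrakk>h \<in> carrier G; w \<in> fixed_level G q j\<rbrakk> \<Longrightarrow> translate G h w \<in> fixed_level G q j"
proof (induction j arbitrary: w)
  case 0
  then show ?case by (simp add: translate_def)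
next
  case (Suc j)
  show ?case
  proof (simp, intro ballI)
    fix g assume g: "g \<in> carrier G"
    define g' where "g' = inv h \<otimes> g \<otimes> h"
    have g': "g' \<in> carrier G" "h \<otimes> g' = g \<otimes> h"
      using g Suc.prems by (auto simp: g'_def m_assoc[symmetric])
    have "translate G g (translate G h w) = translate G h (translate G g' w)"
      using translate_mult g g' Suc.prems(1) by metis
    then have "(\<lambda>k. translate G g (translate G h w) k - translate G h w k) =
        translate G h (\<lambda>k. translate G g' w k - w k)"
      by (auto simp: translate_def[of G h] fun_eq_iff)
    then show "(\<lambda>k. translate G g (translate G h w) k - translate G h w k) \<in> fixed_level G q j"
      using Suc g' by simp
  qed
qed

text \<open>Each level is a translation-invariant subgroup, so \<open>translate G g w - w\<close>
  stays in the level of \<open>w\<close>.\<close>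

lemma fixed_level_mono: "j \<le> i \<Longrightarrow> fixed_level G q j \<subseteq> fixed_level G q i"
  by (rule lift_Suc_mono_le[of "fixed_level G q"])
     (use fixed_level_diff fixed_level_translate in auto)

text \<open>A fixed coset modulo level \<open>j\<close> other than level \<open>j\<close> itself is
  the same as a function in level \<open>j + 1\<close> but not in level \<open>j\<close>. The
  witness is moreover found in a finite box that does not depend on \<open>j\<close>, so that the
  levels can be compared by counting.\<close>

lemma fixed_level_strict:
  assumes p: "Factorial_Ring.prime (p::nat)" and ord: "order G = p ^ n"
    and proper: "fixed_level G (int (p ^ k)) j \<noteq> UNIV"
  shows "\<exists>w. w \<in> fixed_level G (int (p ^ k)) (Suc j) - fixed_level G (int (p ^ k)) j
    \<and> w \<in> carrier G \<rightarrow>\<^sub>E {0..<int (p ^ k)}"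
proof -
  define q where "q = int (p ^ k)"
  have q: "q > 0" using p by (simp add: q_def prime_gt_0_nat)
  have finG: "finite (carrier G)"
    using ord p by (metis card.infinite order_def power_not_zero not_prime_0)
  define W where "W = fixed_level G q j"
  \<comment> \<open>The additive group of integer-valued functions in multiplicative dress: powers
    in \<open>A\<close> are integer multiples.\<close>
  define A where "A = \<lparr>carrier = UNIV :: ('a \<Rightarrow> int) set, monoid.mult = (\<lambda>(u :: 'a \<Rightarrow> int) v k. u k + v k), one = (\<lambda>k. 0)\<rparr>"
  \<comment> \<open>Level 0 does not look at values off the carrier, so taking residues there and
    \<open>undefined\<close> elsewhere changes \<open>w\<close> only by an element of level 0. The
    reduced functions represent all cosets of \<open>W\<close>, and there are finitely many of
    them.\<close>
  define red where "red w = (\<lambda>i\<in>carrier G. w i mod q)" for w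
  have red: "red w \<in> carrier G \<rightarrow>\<^sub>E {0..<q}" for w
    using q by (auto simp: red_def)
  have red_W: "(\<lambda>i. w i - red w i) \<in> W" for w
  proof -
    have "(\<lambda>i. w i - red w i) \<in> fixed_level G q 0"
      by (simp add: red_def)
    then show ?thesis using fixed_level_mono[of 0 j q] by (auto simp: W_def simp del: fixed_level.simps)
  qed
  have A: "comm_group A"
  proof (rule comm_groupI)
    show "\<exists>y\<in>carrier A. y \<otimes>\<^bsub>A\<^esub> x = \<one>\<^bsub>A\<^esub>" for x
      by (rule bexI[of _ "\<lambda>k. - x k"]) (auto simp: A_def)
  qed (auto simp: A_def)
  interpret A: comm_group A by fact
  have A_inv: "inv\<^bsub>A\<^esub> w = (\<lambda>k. - w k)" for w
    by (rule A.inv_equality) (auto simp: A_def)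
  have A_pow: "w [^]\<^bsub>A\<^esub> (m::nat) = (\<lambda>k. int m * w k)" for w m
    by (induction m) (auto simp: A_def algebra_simps)
  have W: "subgroup W A"
    by (rule A.subgroupI)
       (use fixed_level_zero fixed_level_uminus fixed_level_add in
         \<open>auto simp: A_inv W_def, auto simp: A_def\<close>)
  have coset: "W #>\<^bsub>A\<^esub> w = W #>\<^bsub>A\<^esub> red w" for w
  proof (rule A.repr_independence[OF _ _ W])
    show "red w \<in> W #>\<^bsub>A\<^esub> w"
      unfolding r_coset_def
      using fixed_level_uminus[OF red_W[of w, unfolded W_def]]
      by (auto simp: A_def W_def intro!: bexI[of _ "\<lambda>i. red w i - w i"])
    show "w \<in> carrier A" by (simp add: A_def)
  qed
  have "\<exists>w\<in>carrier A - W. \<forall>g\<in>carrier G. translate G g w \<otimes>\<^bsub>A\<^esub> inv\<^bsub>A\<^esub> w \<in> W"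
  proof (rule fixed_coset_of_p_group[OF p is_group ord A W])
    show "finite (rcosets\<^bsub>A\<^esub> W)"
    proof (rule finite_subset)
      show "rcosets\<^bsub>A\<^esub> W \<subseteq> (\<lambda>w. W #>\<^bsub>A\<^esub> w) ` (carrier G \<rightarrow>\<^sub>E {0..<q})"
        unfolding RCOSETS_def using coset red by blast
      show "finite ((\<lambda>w. W #>\<^bsub>A\<^esub> w) ` (carrier G \<rightarrow>\<^sub>E {0..<q}))"
        using finG by (intro finite_imageI finite_PiE) auto
    qed
    show "W \<noteq> carrier A" using proper by (simp add: W_def A_def q_def)
    show "translate G g \<in> hom A A" for g
      by (rule homI) (auto simp: A_def translate_def)
    show "translate G g w \<in> W" if "g \<in> carrier G" "w \<in> W" for g w
      using fixed_level_translate that by (simp add: W_def)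
    show "\<exists>k. w [^]\<^bsub>A\<^esub> (p ^ k) \<in> W" for w
    \<comment> \<open>The same exponent \<open>k\<close> works for all \<open>w\<close>, because
      every multiple of \<open>q = p ^ k\<close> is already in level 0.\<close>
    proof (rule exI[of _ k])
      have "w [^]\<^bsub>A\<^esub> (p ^ k) \<in> fixed_level G q 0" by (simp add: A_pow q_def)
      then show "w [^]\<^bsub>A\<^esub> (p ^ k) \<in> W" using fixed_level_mono[of 0 j q] by (auto simp: W_def simp del: fixed_level.simps)
    qed
  qed (auto simp: translate_one translate_mult)
  then obtain w where w: "w \<notin> W" "\<And>g. g \<in> carrier G \<Longrightarrow> (\<lambda>k. translate G g w k - w k) \<in> W"
    by (auto simp: A_inv) (auto simp: A_def)
  have "w \<in> fixed_level G q (Suc j)" using w(2) by (simp add: W_def)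
  moreover have "(\<lambda>i. w i - red w i) \<in> fixed_level G q (Suc j)"
    using red_W[of w] fixed_level_mono[of j "Suc j"] by (auto simp: W_def simp del: fixed_level.simps)
  ultimately have "red w \<in> fixed_level G q (Suc j)"
    using fixed_level_diff[of w q "Suc j" "\<lambda>i. w i - red w i"] by simp
  moreover have "red w \<notin> fixed_level G q j"
    using w(1) fixed_level_add[OF _ red_W[of w, unfolded W_def], of "red w"] by (auto simp: W_def)
  ultimately show ?thesis
    using red by (auto simp: q_def)
qed

text \<open>If no level were everything, the number of level-\<open>j\<close> functions with values
  in \<open>{0..<p ^ k}\<close> would grow strictly with \<open>j\<close>, although it is bounded by
  the number of all such functions.\<close>

lemma fixed_level_eq_UNIV:
  assumes p: "Factorial_Ring.prime (p::nat)" and ord: "order G = p ^ n"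
  shows "\<exists>m. fixed_level G (int (p ^ k)) m = UNIV"
proof (rule ccontr)
  assume contra: "\<nexists>m. fixed_level G (int (p ^ k)) m = UNIV"
  define Y where "Y = carrier G \<rightarrow>\<^sub>E {0..<int (p ^ k)}"
  define c where "c j = card (fixed_level G (int (p ^ k)) j \<inter> Y)" for j
  have "finite (carrier G)"
    using ord p by (metis card.infinite order_def power_not_zero not_prime_0)
  then have fin: "finite Y" by (auto simp: Y_def intro!: finite_PiE)
  have "c j < c (Suc j)" for j
    unfolding c_def
  proof (rule psubset_card_mono)
    show "finite (fixed_level G (int (p ^ k)) (Suc j) \<inter> Y)" using fin by blast
    show "fixed_level G (int (p ^ k)) j \<inter> Y \<subset> fixed_level G (int (p ^ k)) (Suc j) \<inter> Y"
    proof -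
      have "fixed_level G (int (p ^ k)) j \<noteq> UNIV" using contra by blast
      from fixed_level_strict[OF p ord this] obtain w
        where "w \<in> fixed_level G (int (p ^ k)) (Suc j)" "w \<notin> fixed_level G (int (p ^ k)) j" "w \<in> Y"
        unfolding Y_def by blast
      moreover have "fixed_level G (int (p ^ k)) j \<subseteq> fixed_level G (int (p ^ k)) (Suc j)"
        by (rule fixed_level_mono) simp
      ultimately show ?thesis by (metis IntE IntI Int_mono order_refl psubsetI)
    qed
  qed
  then have "j \<le> c j" for j
    by (induction j) (auto simp: Suc_le_eq intro: le_less_trans)
  moreover have "c j \<le> card Y" for j
    unfolding c_def using fin by (intro card_mono) auto
  ultimately show False
    by (meson not_less_eq_eq order_trans)
qed

end

section \<open>Weighted sums and powers of an element of augmentation zero\<close>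

lemma (in abelian_monoid) finsum_swap:
  assumes "finite A" "finite B" "\<And>a b. \<lbrakk>a \<in> A; b \<in> B\<rbrakk> \<Longrightarrow> f a b \<in> carrier G"
  shows "(\<Oplus>a\<in>A. \<Oplus>b\<in>B. f a b) = (\<Oplus>b\<in>B. \<Oplus>a\<in>A. f a b)"
  using assms(1,3)
proof (induction A)
  case empty
  then show ?case by (simp add: finsum_zero)
next
  case (insert x A)
  have "(\<Oplus>a\<in>insert x A. \<Oplus>b\<in>B. f a b) = (\<Oplus>b\<in>B. f x b) \<oplus> (\<Oplus>b\<in>B. \<Oplus>a\<in>A. f a b)"
    using insert by (simp add: Pi_def)
  also have "\<dots> = (\<Oplus>b\<in>B. f x b \<oplus> (\<Oplus>a\<in>A. f a b))"
    using insert by (simp add: Pi_def finsum_addf)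
  also have "\<dots> = (\<Oplus>b\<in>B. \<Oplus>a\<in>insert x A. f a b)"
    using insert by (intro finsum_cong') (auto simp: Pi_def)
  finally show ?case .
qed

text \<open>\<open>T\<close> is the action of the element \<open>\<Sum>i\<in>I. c i \<gamma> i\<close> of the ordinary group ring \<open>RK\<close> on functions
  by translation. The functionals \<open>F \<mapsto> \<Sum>k\<in>K. w k F (k x)\<close> with \<open>w\<close> in the \<open>j\<close>-th level vanish
  on the image of the \<open>j\<close>-th power of an element of augmentation zero.\<close>

lemma augmentation_zero_nilpotent:
  fixes G :: "('g, 'm) monoid_scheme" (structure) and R :: "('a, 'n) ring_scheme"
  assumes "group G" and "ring R" and K: "subgroup K G"
    and p: "Factorial_Ring.prime (p::nat)" and card: "card K = p ^ n"
    and char: "\<And>r. r \<in> carrier R \<Longrightarrow> [(p ^ k)] \<cdot>\<^bsub>R\<^esub> r = \<zero>\<^bsub>R\<^esub>"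
    and I: "finite I" and c: "c \<in> I \<rightarrow> carrier R" and \<gamma>: "\<gamma> \<in> I \<rightarrow> K"
    and aug: "(\<Oplus>\<^bsub>R\<^esub>i\<in>I. c i) = \<zero>\<^bsub>R\<^esub>"
    and T: "\<And>F x. \<lbrakk>F \<in> carrier G \<rightarrow> carrier R; x \<in> carrier G\<rbrakk>
      \<Longrightarrow> T F x = (\<Oplus>\<^bsub>R\<^esub>i\<in>I. c i \<otimes>\<^bsub>R\<^esub> F (inv\<^bsub>G\<^esub> \<gamma> i \<otimes>\<^bsub>G\<^esub> x))"
  shows "\<exists>m. \<forall>F\<in>carrier G \<rightarrow> carrier R. \<forall>x\<in>carrier G. (T ^^ m) F x = \<zero>\<^bsub>R\<^esub>"
proof -
  interpret group G by fact
  interpret R: ring R by fact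
  interpret K: subgroup K G by fact
  define KK where "KK = G\<lparr>carrier := K\<rparr>"
  interpret KK: group KK
    unfolding KK_def using K is_group by (rule subgroup.subgroup_is_group)
  have finK: "finite K"
    using card p by (metis card.infinite power_not_zero not_prime_0)
  have KK: "carrier KK = K" "monoid.mult KK = monoid.mult G" "one KK = one G"
    by (simp_all add: KK_def)
  have inv_KK: "inv\<^bsub>KK\<^esub> g = inv\<^bsub>G\<^esub> g" if "g \<in> K" for g
    unfolding KK_def by (rule m_inv_consistent[OF K that])
  obtain m where m: "fixed_level KK (int (p ^ k)) m = UNIV"
    using KK.fixed_level_eq_UNIV[OF p, of n k] card by (auto simp: order_def KK)
  \<comment> \<open>The weights live on the finite group \<open>K\<close>, whereas \<open>F\<close>
    lives on \<open>G\<close>; the point \<open>x\<close> selects the coset \<open>K x\<close> on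
    which \<open>F\<close> is tested.\<close>
  define pair where "pair w F x = (\<Oplus>\<^bsub>R\<^esub>g\<in>K. [w g] \<cdot>\<^bsub>R\<^esub> F (g \<otimes>\<^bsub>G\<^esub> x))" for w :: "'g \<Rightarrow> int" and F x
  have T_closed: "T F \<in> carrier G \<rightarrow> carrier R" if "F \<in> carrier G \<rightarrow> carrier R" for F
    using that c \<gamma> by (auto simp: T Pi_iff intro!: R.finsum_closed)
  have T_pow_closed: "(T ^^ j) F \<in> carrier G \<rightarrow> carrier R" if "F \<in> carrier G \<rightarrow> carrier R" for F j
    using that by (induction j) (simp_all add: T_closed)
  have pair_closed: "pair w F x \<in> carrier R" if "F \<in> carrier G \<rightarrow> carrier R" "x \<in> carrier G" for w F x
    using that unfolding pair_def by (auto intro!: R.finsum_closed)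
  have pair_add: "pair (\<lambda>g. u g + v g) F x = pair u F x \<oplus>\<^bsub>R\<^esub> pair v F x"
    if "F \<in> carrier G \<rightarrow> carrier R" "x \<in> carrier G" for u v F x
  proof -
    have "[(u g + v g)] \<cdot>\<^bsub>R\<^esub> F (g \<otimes> x) = [u g] \<cdot>\<^bsub>R\<^esub> F (g \<otimes> x) \<oplus>\<^bsub>R\<^esub> [v g] \<cdot>\<^bsub>R\<^esub> F (g \<otimes> x)"
      if "g \<in> K" for g
      using R.add.int_pow_mult[of "F (g \<otimes> x)" "u g" "v g"] that \<open>F \<in> _\<close> \<open>x \<in> _\<close>
      by (simp add: Pi_iff)
    then have "pair (\<lambda>g. u g + v g) F x =
        (\<Oplus>\<^bsub>R\<^esub>g\<in>K. [u g] \<cdot>\<^bsub>R\<^esub> F (g \<otimes> x) \<oplus>\<^bsub>R\<^esub> [v g] \<cdot>\<^bsub>R\<^esub> F (g \<otimes> x))"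
      unfolding pair_def using that by (intro R.finsum_cong') (auto simp: Pi_iff)
    then show ?thesis
      unfolding pair_def using that by (subst (asm) R.finsum_addf) (auto simp: Pi_iff)
  qed
  have pair_T: "pair w (T F) x =
      (\<Oplus>\<^bsub>R\<^esub>i\<in>I. c i \<otimes>\<^bsub>R\<^esub> pair (translate KK (inv\<^bsub>G\<^esub> \<gamma> i) w) F x)"
    if F: "F \<in> carrier G \<rightarrow> carrier R" and x: "x \<in> carrier G" for w F x
  proof -
    have Fc: "F y \<in> carrier R" if "y \<in> carrier G" for y using F that by auto
    have ci: "c i \<in> carrier R" "\<gamma> i \<in> K" if "i \<in> I" for i using c \<gamma> that by auto
    \<comment> \<open>An integer multiple is multiplication by the multiple of \<open>1\<close>,
      which is central, so it can be moved past \<open>c i\<close>.\<close>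
    have scal: "[w g] \<cdot>\<^bsub>R\<^esub> T F (g \<otimes> x) =
        (\<Oplus>\<^bsub>R\<^esub>i\<in>I. c i \<otimes>\<^bsub>R\<^esub> ([w g] \<cdot>\<^bsub>R\<^esub> F (inv \<gamma> i \<otimes> (g \<otimes> x))))" if g: "g \<in> K" for g
    proof -
      have tc: "c i \<otimes>\<^bsub>R\<^esub> F (inv \<gamma> i \<otimes> (g \<otimes> x)) \<in> carrier R" if "i \<in> I" for i
        using that g x ci Fc by simp
      have "[w g] \<cdot>\<^bsub>R\<^esub> T F (g \<otimes> x) = ([w g] \<cdot>\<^bsub>R\<^esub> \<one>\<^bsub>R\<^esub>) \<otimes>\<^bsub>R\<^esub> (\<Oplus>\<^bsub>R\<^esub>i\<in>I. c i \<otimes>\<^bsub>R\<^esub> F (inv \<gamma> i \<otimes> (g \<otimes> x)))"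
        using g x F tc by (simp add: T R.add_pow_ldistr_int R.finsum_closed Pi_def)
      also have "\<dots> = (\<Oplus>\<^bsub>R\<^esub>i\<in>I. ([w g] \<cdot>\<^bsub>R\<^esub> \<one>\<^bsub>R\<^esub>) \<otimes>\<^bsub>R\<^esub> (c i \<otimes>\<^bsub>R\<^esub> F (inv \<gamma> i \<otimes> (g \<otimes> x))))"
        using tc I by (intro R.finsum_rdistr) auto
      also have "\<dots> = (\<Oplus>\<^bsub>R\<^esub>i\<in>I. c i \<otimes>\<^bsub>R\<^esub> ([w g] \<cdot>\<^bsub>R\<^esub> F (inv \<gamma> i \<otimes> (g \<otimes> x))))"
        using tc ci Fc g x
        by (intro R.finsum_cong') (auto simp: R.add_pow_ldistr_int R.add_pow_rdistr_int)
      finally show ?thesis .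
    qed
    have tc: "[w g] \<cdot>\<^bsub>R\<^esub> F (inv \<gamma> i \<otimes> (g \<otimes> x)) \<in> carrier R" if "i \<in> I" "g \<in> K" for i g
      using that x ci Fc by simp
    have "pair w (T F) x = (\<Oplus>\<^bsub>R\<^esub>g\<in>K. \<Oplus>\<^bsub>R\<^esub>i\<in>I. c i \<otimes>\<^bsub>R\<^esub> ([w g] \<cdot>\<^bsub>R\<^esub> F (inv \<gamma> i \<otimes> (g \<otimes> x))))"
      unfolding pair_def using scal tc ci
      by (intro R.finsum_cong') (auto intro!: R.finsum_closed)
    also have "\<dots> = (\<Oplus>\<^bsub>R\<^esub>i\<in>I. \<Oplus>\<^bsub>R\<^esub>g\<in>K. c i \<otimes>\<^bsub>R\<^esub> ([w g] \<cdot>\<^bsub>R\<^esub> F (inv \<gamma> i \<otimes> (g \<otimes> x))))"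
      using tc ci finK I by (intro R.finsum_swap) auto
    also have "\<dots> = (\<Oplus>\<^bsub>R\<^esub>i\<in>I. c i \<otimes>\<^bsub>R\<^esub> pair (translate KK (inv\<^bsub>G\<^esub> \<gamma> i) w) F x)"
    proof (rule R.finsum_cong')
      fix i assume i: "i \<in> I"
      \<comment> \<open>Substituting \<open>\<gamma> i g\<close> for \<open>g\<close> moves the
        translation from \<open>F\<close> to the weight, where it becomes translation by the
        inverse.\<close>
      have "bij_betw (\<lambda>g. \<gamma> i \<otimes> g) K K"
        using ci(2)[OF i]
        by (intro bij_betw_byWitness[of _ "\<lambda>g. inv \<gamma> i \<otimes> g"]) (auto simp: m_assoc[symmetric])
      then have bij: "inj_on (\<lambda>g. \<gamma> i \<otimes> g) K" "(\<lambda>g. \<gamma> i \<otimes> g) ` K = K"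
        by (auto simp: bij_betw_def)
      have "(\<Oplus>\<^bsub>R\<^esub>g\<in>(\<lambda>g. \<gamma> i \<otimes> g) ` K. [w g] \<cdot>\<^bsub>R\<^esub> F (inv \<gamma> i \<otimes> (g \<otimes> x))) =
          (\<Oplus>\<^bsub>R\<^esub>g\<in>K. [w (\<gamma> i \<otimes> g)] \<cdot>\<^bsub>R\<^esub> F (inv \<gamma> i \<otimes> ((\<gamma> i \<otimes> g) \<otimes> x)))"
        using bij tc i by (intro R.finsum_reindex) auto
      also have "\<dots> = pair (translate KK (inv\<^bsub>G\<^esub> \<gamma> i) w) F x"
        unfolding pair_def using ci(2)[OF i] x Fc
        by (intro R.finsum_cong')
           (auto simp: translate_def KK inv_KK m_assoc[symmetric])
      finally have "(\<Oplus>\<^bsub>R\<^esub>g\<in>K. [w g] \<cdot>\<^bsub>R\<^esub> F (inv \<gamma> i \<otimes> (g \<otimes> x))) =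
          pair (translate KK (inv\<^bsub>G\<^esub> \<gamma> i) w) F x"
        by (simp add: bij)
      moreover have "(\<Oplus>\<^bsub>R\<^esub>g\<in>K. c i \<otimes>\<^bsub>R\<^esub> ([w g] \<cdot>\<^bsub>R\<^esub> F (inv \<gamma> i \<otimes> (g \<otimes> x)))) =
          c i \<otimes>\<^bsub>R\<^esub> (\<Oplus>\<^bsub>R\<^esub>g\<in>K. [w g] \<cdot>\<^bsub>R\<^esub> F (inv \<gamma> i \<otimes> (g \<otimes> x)))"
        using finK ci(1)[OF i] tc i by (intro R.finsum_rdistr[symmetric]) auto
      ultimately show "(\<Oplus>\<^bsub>R\<^esub>g\<in>K. c i \<otimes>\<^bsub>R\<^esub> ([w g] \<cdot>\<^bsub>R\<^esub> F (inv \<gamma> i \<otimes> (g \<otimes> x)))) =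
          c i \<otimes>\<^bsub>R\<^esub> pair (translate KK (inv\<^bsub>G\<^esub> \<gamma> i) w) F x" by simp
    qed (use ci pair_closed F x in auto)
    finally show ?thesis .
  qed
  have main: "pair w ((T ^^ j) F) x = \<zero>\<^bsub>R\<^esub>"
    if "w \<in> fixed_level KK (int (p ^ k)) j" "F \<in> carrier G \<rightarrow> carrier R" "x \<in> carrier G" for w j F x
    using that(1)
  proof (induction j arbitrary: w)
    case 0
    have "[w g] \<cdot>\<^bsub>R\<^esub> F (g \<otimes> x) = \<zero>\<^bsub>R\<^esub>" if "g \<in> K" for g
    proof -
      from 0 that obtain d where d: "w g = int (p ^ k) * d" by (auto simp: KK)
      have Fg: "F (g \<otimes> x) \<in> carrier R" using that \<open>F \<in> _\<close> \<open>x \<in> _\<close> by (simp add: Pi_iff)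
      have "[w g] \<cdot>\<^bsub>R\<^esub> F (g \<otimes> x) = [d] \<cdot>\<^bsub>R\<^esub> ([int (p ^ k)] \<cdot>\<^bsub>R\<^esub> F (g \<otimes> x))"
        unfolding d using R.add.int_pow_pow[OF Fg, of d "int (p ^ k)"] by (simp add: mult.commute)
      also have "[int (p ^ k)] \<cdot>\<^bsub>R\<^esub> F (g \<otimes> x) = \<zero>\<^bsub>R\<^esub>"
        using char[OF Fg] by (metis add_pow_int_ge nat_int of_nat_0_le_iff)
      finally show ?thesis by simp
    qed
    then show ?case by (simp add: pair_def R.add.finprod_one_eqI)
  next
    case (Suc j)
    define F' where "F' = (T ^^ j) F"
    have F': "F' \<in> carrier G \<rightarrow> carrier R" using T_pow_closed that(2) by (simp add: F'_def)
    \<comment> \<open>Translating a weight of level \<open>j + 1\<close> changes it by one of level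
      \<open>j\<close>, which already pairs to zero with \<open>F'\<close>. The factor
      \<open>pair w F' x\<close> thus becomes independent of \<open>i\<close>, and what remains is
      the sum of the \<open>c i\<close>.\<close>
    have "pair (translate KK (inv\<^bsub>G\<^esub> \<gamma> i) w) F' x = pair w F' x" if i: "i \<in> I" for i
    proof -
      have "inv\<^bsub>G\<^esub> \<gamma> i \<in> carrier KK" using \<gamma> i by (auto simp: KK)
      then have "pair (\<lambda>g. translate KK (inv\<^bsub>G\<^esub> \<gamma> i) w g - w g) F' x = \<zero>\<^bsub>R\<^esub>"
        using Suc by (simp add: F'_def)
      then show ?thesis
        using pair_add[OF F' \<open>x \<in> carrier G\<close>, of "\<lambda>g. translate KK (inv\<^bsub>G\<^esub> \<gamma> i) w g - w g" w]
          pair_closed[OF F' \<open>x \<in> carrier G\<close>] by simp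
    qed
    then have "pair w (T F') x = (\<Oplus>\<^bsub>R\<^esub>i\<in>I. c i \<otimes>\<^bsub>R\<^esub> pair w F' x)"
      unfolding pair_T[OF F' that(3)] using c pair_closed[OF F' that(3)]
      by (intro R.finsum_cong') auto
    also have "\<dots> = (\<Oplus>\<^bsub>R\<^esub>i\<in>I. c i) \<otimes>\<^bsub>R\<^esub> pair w F' x"
      using c pair_closed[OF F' that(3)] I by (intro R.finsum_ldistr[symmetric]) auto
    also have "\<dots> = \<zero>\<^bsub>R\<^esub>" using aug pair_closed[OF F' that(3)] by simp
    finally show ?case by (simp add: F'_def)
  qed
  show ?thesis
  proof (intro exI ballI)
    fix F x assume F: "F \<in> carrier G \<rightarrow> carrier R" and x: "x \<in> carrier G"
    \<comment> \<open>With this weight the pairing is evaluation at \<open>x\<close>. It may be used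
      since level \<open>m\<close> contains every function.\<close>
    define w where "w g = (if g = \<one>\<^bsub>G\<^esub> then 1 else 0 :: int)" for g
    have Tm: "(T ^^ m) F g \<in> carrier R" if "g \<in> carrier G" for g
      using T_pow_closed[OF F, of m] that by auto
    have "\<zero>\<^bsub>R\<^esub> = pair w ((T ^^ m) F) x"
      using main[of w m F x] m F x by simp
    also have "\<dots> = (\<Oplus>\<^bsub>R\<^esub>g\<in>K. if \<one>\<^bsub>G\<^esub> = g then (T ^^ m) F (g \<otimes> x) else \<zero>\<^bsub>R\<^esub>)"
      unfolding pair_def using x Tm
      by (intro R.finsum_cong') (auto simp: w_def add_pow_int_ge)
    also have "\<dots> = (T ^^ m) F x"
      using R.finsum_singleton[OF K.one_closed finK, of "\<lambda>g. (T ^^ m) F (g \<otimes> x)"] x Tm by auto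
    finally show "(T ^^ m) F x = \<zero>\<^bsub>R\<^esub>" by simp
  qed
qed

section \<open>Graded rings\<close>

lemma (in abelian_group) additive_subgroup_finsum_closed:
  assumes A: "additive_subgroup A G" and f: "f \<in> F \<rightarrow> A"
  shows "(\<Oplus>i\<in>F. f i) \<in> A"
proof -
  interpret A: additive_subgroup A G by fact
  show ?thesis
    using f
  proof (induction F rule: infinite_finite_induct)
    case (insert x F)
    have "f i \<in> carrier G" if "i \<in> insert x F" for i
      using insert.prems that A.a_Hcarr by blast
    then show ?case
      using insert by (simp add: Pi_iff)
  qed simp_all
qed

lemma (in abelian_monoid) finsum_mono_neutral:
  assumes "finite B" "A \<subseteq> B" "\<And>i. i \<in> B - A \<Longrightarrow> f i = \<zero>" "\<And>i. i \<in> A \<Longrightarrow> f i \<in> carrier G"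
  shows "(\<Oplus>i\<in>A. f i) = (\<Oplus>i\<in>B. f i)"
proof (rule add.finprod_mono_neutral_cong_left)
  show "f \<in> B \<rightarrow> carrier G"
    using assms(3,4) by (metis DiffI Pi_I zero_closed)
qed (use assms in auto)

lemma (in abelian_monoid) finsum_delta:
  assumes "finite B" "a \<in> B" "\<And>i. i \<in> B \<Longrightarrow> i \<noteq> a \<Longrightarrow> f i = \<zero>" "f a \<in> carrier G"
  shows "(\<Oplus>i\<in>B. f i) = f a"
proof -
  have "(\<Oplus>i\<in>{a}. f i) = (\<Oplus>i\<in>B. f i)"
    using assms by (intro finsum_mono_neutral) auto
  then show ?thesis using assms(4) by simp
qed

text \<open>Projections in place of decompositions: additivity and the Kronecker rule
  \<open>homog\<close> determine \<open>\<pi>\<close> on every finite sum of homogeneous elements,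
  so the members of any decomposition of \<open>x\<close> can be read off from
  \<open>\<pi> x\<close>, which gives uniqueness.\<close>

lemma graded_ringI:
  fixes \<Gamma> :: "('g, 'm) monoid_scheme" and S :: "('a, 'n) ring_scheme"
  assumes "group \<Gamma>" and "ring S"
    and sub: "\<And>\<gamma>. \<gamma> \<in> carrier \<Gamma> \<Longrightarrow> additive_subgroup (grd \<gamma>) S"
    and mult: "\<And>\<gamma> \<delta> x y. \<lbrakk>\<gamma> \<in> carrier \<Gamma>; \<delta> \<in> carrier \<Gamma>; x \<in> grd \<gamma>; y \<in> grd \<delta>\<rbrakk>
      \<Longrightarrow> x \<otimes>\<^bsub>S\<^esub> y \<in> grd (\<gamma> \<otimes>\<^bsub>\<Gamma>\<^esub> \<delta>)"
    and mem: "\<And>x \<gamma>. \<lbrakk>x \<in> carrier S; \<gamma> \<in> carrier \<Gamma>\<rbrakk> \<Longrightarrow> \<pi> x \<gamma> \<in> grd \<gamma>"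
    and fin: "\<And>x. x \<in> carrier S \<Longrightarrow> finite {\<gamma> \<in> carrier \<Gamma>. \<pi> x \<gamma> \<noteq> \<zero>\<^bsub>S\<^esub>}"
    and sum: "\<And>x. x \<in> carrier S
      \<Longrightarrow> x = (\<Oplus>\<^bsub>S\<^esub>\<gamma>\<in>{\<gamma> \<in> carrier \<Gamma>. \<pi> x \<gamma> \<noteq> \<zero>\<^bsub>S\<^esub>}. \<pi> x \<gamma>)"
    and add: "\<And>x y \<gamma>. \<lbrakk>x \<in> carrier S; y \<in> carrier S; \<gamma> \<in> carrier \<Gamma>\<rbrakk>
      \<Longrightarrow> \<pi> (x \<oplus>\<^bsub>S\<^esub> y) \<gamma> = \<pi> x \<gamma> \<oplus>\<^bsub>S\<^esub> \<pi> y \<gamma>"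
    and homog: "\<And>x \<gamma> \<delta>. \<lbrakk>\<gamma> \<in> carrier \<Gamma>; \<delta> \<in> carrier \<Gamma>; x \<in> grd \<delta>\<rbrakk>
      \<Longrightarrow> \<pi> x \<gamma> = (if \<gamma> = \<delta> then x else \<zero>\<^bsub>S\<^esub>)"
  shows "graded_ring \<Gamma> S grd"
proof -
  interpret grp: group \<Gamma> by fact
  interpret rng: ring S by fact
  have closed: "x \<in> carrier S" if "\<gamma> \<in> carrier \<Gamma>" "x \<in> grd \<gamma>" for \<gamma> x
    using additive_subgroup.a_Hcarr[OF sub] that by blast
  have zero: "\<pi> \<zero>\<^bsub>S\<^esub> \<gamma> = \<zero>\<^bsub>S\<^esub>" if "\<gamma> \<in> carrier \<Gamma>" for \<gamma>
    using homog[OF that that additive_subgroup.zero_closed[OF sub[OF that]]] by simp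
  have \<pi>_sum: "\<pi> (\<Oplus>\<^bsub>S\<^esub>\<delta>\<in>F. d \<delta>) \<gamma> = (if \<gamma> \<in> F then d \<gamma> else \<zero>\<^bsub>S\<^esub>)"
    if "finite F" "F \<subseteq> carrier \<Gamma>" "d \<in> Pi F grd" "\<gamma> \<in> carrier \<Gamma>" for F d \<gamma>
    using that
  proof (induction F)
    case empty
    then show ?case by (simp add: zero)
  next
    case (insert \<delta> F)
    then have d: "d \<epsilon> \<in> carrier S" if "\<epsilon> \<in> insert \<delta> F" for \<epsilon>
      using closed that by blast
    have "\<pi> (\<Oplus>\<^bsub>S\<^esub>\<delta>\<in>insert \<delta> F. d \<delta>) \<gamma> = \<pi> (d \<delta>) \<gamma> \<oplus>\<^bsub>S\<^esub> (if \<gamma> \<in> F then d \<gamma> else \<zero>\<^bsub>S\<^esub>)"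
      using insert d by (simp add: add rng.finsum_closed Pi_iff)
    then show ?case
      using insert d homog[of \<gamma> \<delta> "d \<delta>"] by auto
  qed
  show ?thesis
  proof (intro graded_ring.intro graded_ring_axioms.intro assms(1,2))
    fix x assume x: "x \<in> carrier S"
    show "\<exists>!d. is_decomposition \<Gamma> S grd x d"
    proof
      have supp: "graded_support \<Gamma> S (restrict (\<pi> x) (carrier \<Gamma>)) = {\<gamma> \<in> carrier \<Gamma>. \<pi> x \<gamma> \<noteq> \<zero>\<^bsub>S\<^esub>}"
        by (auto simp: graded_support_def)
      have "finsum S (restrict (\<pi> x) (carrier \<Gamma>)) {\<gamma> \<in> carrier \<Gamma>. \<pi> x \<gamma> \<noteq> \<zero>\<^bsub>S\<^esub>} =
          (\<Oplus>\<^bsub>S\<^esub>\<gamma>\<in>{\<gamma> \<in> carrier \<Gamma>. \<pi> x \<gamma> \<noteq> \<zero>\<^bsub>S\<^esub>}. \<pi> x \<gamma>)"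
        using closed mem x by (intro rng.finsum_cong') auto
      then show "is_decomposition \<Gamma> S grd x (restrict (\<pi> x) (carrier \<Gamma>))"
        unfolding is_decomposition_def supp using fin[OF x] sum[OF x] mem[OF x]
        by auto
    next
      fix d assume "is_decomposition \<Gamma> S grd x d"
      then have d: "d \<in> (\<Pi>\<^sub>E \<gamma>\<in>carrier \<Gamma>. grd \<gamma>)" "finite (graded_support \<Gamma> S d)"
        "x = (\<Oplus>\<^bsub>S\<^esub>\<gamma>\<in>graded_support \<Gamma> S d. d \<gamma>)"
        by (auto simp: is_decomposition_def)
      show "d = restrict (\<pi> x) (carrier \<Gamma>)"
      proof (rule extensionalityI[of _ "carrier \<Gamma>"])
        fix \<gamma> assume \<gamma>: "\<gamma> \<in> carrier \<Gamma>"
        have "d \<in> Pi (graded_support \<Gamma> S d) grd"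
          using d(1) by (auto simp: graded_support_def)
        then have "\<pi> x \<gamma> = (if \<gamma> \<in> graded_support \<Gamma> S d then d \<gamma> else \<zero>\<^bsub>S\<^esub>)"
          using d(2) \<gamma> by (subst d(3), intro \<pi>_sum) (auto simp: graded_support_def)
        then show "d \<gamma> = restrict (\<pi> x) (carrier \<Gamma>) \<gamma>"
          using \<gamma> by (auto simp: graded_support_def)
      qed (use d(1) in \<open>auto simp: PiE_def\<close>)
    qed
  qed (use sub mult in blast)+
qed

context graded_ring
begin

abbreviation (input) hc where "hc \<equiv> hcomponent \<Gamma> S grd"

lemma comp_closed: "\<lbrakk>\<gamma> \<in> carrier \<Gamma>; x \<in> grd \<gamma>\<rbrakk> \<Longrightarrow> x \<in> carrier S"
  using additive_subgroup.a_Hcarr[OF comp_additive_subgroup] by blast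

lemma comp_zero: "\<gamma> \<in> carrier \<Gamma> \<Longrightarrow> \<zero>\<^bsub>S\<^esub> \<in> grd \<gamma>"
  using additive_subgroup.zero_closed[OF comp_additive_subgroup] by blast

lemma hcomponent_decomposition:
  "x \<in> carrier S \<Longrightarrow> is_decomposition \<Gamma> S grd x (hc x)"
  unfolding hcomponent_def by (rule theI'[OF direct_sum])

lemma hcomponent_mem: "\<lbrakk>x \<in> carrier S; \<gamma> \<in> carrier \<Gamma>\<rbrakk> \<Longrightarrow> hc x \<gamma> \<in> grd \<gamma>"
  using hcomponent_decomposition[of x] by (auto simp: is_decomposition_def)

lemma hcomponent_closed: "\<lbrakk>x \<in> carrier S; \<gamma> \<in> carrier \<Gamma>\<rbrakk> \<Longrightarrow> hc x \<gamma> \<in> carrier S"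
  using hcomponent_mem comp_closed by blast

lemma finite_graded_support: "x \<in> carrier S \<Longrightarrow> finite (graded_support \<Gamma> S (hc x))"
  using hcomponent_decomposition[of x] by (auto simp: is_decomposition_def)

lemma finsum_hcomponent:
  assumes x: "x \<in> carrier S" and F: "finite F" "F \<subseteq> carrier \<Gamma>" "graded_support \<Gamma> S (hc x) \<subseteq> F"
  shows "(\<Oplus>\<^bsub>S\<^esub>\<gamma>\<in>F. hc x \<gamma>) = x"
proof -
  have "x = (\<Oplus>\<^bsub>S\<^esub>\<gamma>\<in>graded_support \<Gamma> S (hc x). hc x \<gamma>)"
    using hcomponent_decomposition[OF x] by (simp add: is_decomposition_def)
  also have "\<dots> = (\<Oplus>\<^bsub>S\<^esub>\<gamma>\<in>F. hc x \<gamma>)"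
    using F hcomponent_closed[OF x]
    by (intro rng.finsum_mono_neutral) (auto simp: graded_support_def)
  finally show ?thesis by simp
qed

text \<open>Padded with zeros outside \<open>F\<close>, the family \<open>d\<close> is a
  decomposition of its sum, and decompositions are unique.\<close>

lemma hcomponent_finsum:
  assumes F: "finite F" "F \<subseteq> carrier \<Gamma>" and d: "d \<in> Pi F grd" and \<gamma>: "\<gamma> \<in> carrier \<Gamma>"
  shows "hc (\<Oplus>\<^bsub>S\<^esub>\<delta>\<in>F. d \<delta>) \<gamma> = (if \<gamma> \<in> F then d \<gamma> else \<zero>\<^bsub>S\<^esub>)"
proof -
  define d' where "d' = (\<lambda>\<gamma>\<in>carrier \<Gamma>. if \<gamma> \<in> F then d \<gamma> else \<zero>\<^bsub>S\<^esub>)"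
  define x where "x = (\<Oplus>\<^bsub>S\<^esub>\<delta>\<in>F. d \<delta>)"
  have dc: "d \<delta> \<in> carrier S" if "\<delta> \<in> F" for \<delta>
    using that d F(2) comp_closed by blast
  have supp: "graded_support \<Gamma> S d' \<subseteq> F"
    by (auto simp: graded_support_def d'_def split: if_splits)
  have "x = (\<Oplus>\<^bsub>S\<^esub>\<delta>\<in>F. d' \<delta>)"
    unfolding x_def using dc F(2) by (intro rng.finsum_cong') (auto simp: d'_def)
  also have "\<dots> = (\<Oplus>\<^bsub>S\<^esub>\<delta>\<in>graded_support \<Gamma> S d'. d' \<delta>)"
    using F supp dc
    by (intro rng.finsum_mono_neutral[symmetric]) (auto simp: graded_support_def d'_def)
  finally have "is_decomposition \<Gamma> S grd x d'"
    using supp F d comp_zero finite_subset[OF supp F(1)]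
    by (auto simp: is_decomposition_def d'_def)
  moreover have "x \<in> carrier S"
    unfolding x_def using dc by (intro rng.finsum_closed) auto
  ultimately have "hc x = d'"
    using direct_sum hcomponent_decomposition by blast
  then show ?thesis using \<gamma> by (simp add: x_def d'_def)
qed

lemma hcomponent_homogeneous:
  assumes "\<gamma> \<in> carrier \<Gamma>" "x \<in> grd \<gamma>" "\<delta> \<in> carrier \<Gamma>"
  shows "hc x \<delta> = (if \<delta> = \<gamma> then x else \<zero>\<^bsub>S\<^esub>)"
  using hcomponent_finsum[of "{\<gamma>}" "\<lambda>_. x" \<delta>] assms comp_closed[of \<gamma> x] by auto

lemma hcomponent_zero: "\<gamma> \<in> carrier \<Gamma> \<Longrightarrow> hc \<zero>\<^bsub>S\<^esub> \<gamma> = \<zero>\<^bsub>S\<^esub>"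
  using hcomponent_homogeneous[of \<gamma> "\<zero>\<^bsub>S\<^esub>" \<gamma>] comp_zero by simp

lemma hcomponent_add:
  assumes x: "x \<in> carrier S" and y: "y \<in> carrier S" and \<gamma>: "\<gamma> \<in> carrier \<Gamma>"
  shows "hc (x \<oplus>\<^bsub>S\<^esub> y) \<gamma> = hc x \<gamma> \<oplus>\<^bsub>S\<^esub> hc y \<gamma>"
proof -
  define F where "F = graded_support \<Gamma> S (hc x) \<union> graded_support \<Gamma> S (hc y)"
  have F: "finite F" "F \<subseteq> carrier \<Gamma>" "graded_support \<Gamma> S (hc x) \<subseteq> F" "graded_support \<Gamma> S (hc y) \<subseteq> F"
    using finite_graded_support x y by (auto simp: F_def graded_support_def)
  have "x \<oplus>\<^bsub>S\<^esub> y = (\<Oplus>\<^bsub>S\<^esub>\<delta>\<in>F. hc x \<delta>) \<oplus>\<^bsub>S\<^esub> (\<Oplus>\<^bsub>S\<^esub>\<delta>\<in>F. hc y \<delta>)"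
    using finsum_hcomponent[OF x F(1-3)] finsum_hcomponent[OF y F(1,2,4)] by simp
  also have "\<dots> = (\<Oplus>\<^bsub>S\<^esub>\<delta>\<in>F. hc x \<delta> \<oplus>\<^bsub>S\<^esub> hc y \<delta>)"
    using F x y hcomponent_closed by (intro rng.finsum_addf[symmetric]) auto
  also have "hc \<dots> \<gamma> = (if \<gamma> \<in> F then hc x \<gamma> \<oplus>\<^bsub>S\<^esub> hc y \<gamma> else \<zero>\<^bsub>S\<^esub>)"
    using F x y \<gamma> hcomponent_mem additive_subgroup.a_closed[OF comp_additive_subgroup]
    by (intro hcomponent_finsum) auto
  also have "\<dots> = hc x \<gamma> \<oplus>\<^bsub>S\<^esub> hc y \<gamma>"
    using \<gamma> by (auto simp: F_def graded_support_def)
  finally show ?thesis .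
qed

lemma eq_zero_if_hcomponent_zero:
  assumes "x \<in> carrier S" "\<And>\<gamma>. \<gamma> \<in> carrier \<Gamma> \<Longrightarrow> hc x \<gamma> = \<zero>\<^bsub>S\<^esub>"
  shows "x = \<zero>\<^bsub>S\<^esub>"
  using finsum_hcomponent[OF assms(1), of "{}"] assms(2) by (auto simp: graded_support_def)

lemma homogeneous_induct [consumes 1, case_names zero homogeneous add]:
  assumes x: "x \<in> carrier S" and "P \<zero>\<^bsub>S\<^esub>"
    and "\<And>\<gamma> y. \<lbrakk>\<gamma> \<in> carrier \<Gamma>; y \<in> grd \<gamma>\<rbrakk> \<Longrightarrow> P y"
    and "\<And>y z. \<lbrakk>y \<in> carrier S; z \<in> carrier S; P y; P z\<rbrakk> \<Longrightarrow> P (y \<oplus>\<^bsub>S\<^esub> z)"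
  shows "P x"
proof -
  have "P (\<Oplus>\<^bsub>S\<^esub>\<gamma>\<in>F. hc x \<gamma>)" if "finite F" "F \<subseteq> carrier \<Gamma>" for F
    using that
  proof (induction F)
    case empty
    then show ?case using assms(2) by simp
  next
    case (insert \<gamma> F)
    then have c: "hc x \<delta> \<in> carrier S" if "\<delta> \<in> insert \<gamma> F" for \<delta>
      using hcomponent_closed[OF x] that by blast
    then show ?case
      using insert assms(3)[of \<gamma> "hc x \<gamma>"] hcomponent_mem[OF x]
      by (simp add: Pi_iff assms(4))
  qed
  then show ?thesis
    using finsum_hcomponent[OF x finite_graded_support[OF x]]
    by (metis (no_types, lifting) finite_graded_support graded_support_def mem_Collect_eq order_refl subsetI x)
qed

text \<open>If \<open>e\<close> is the component of \<open>1\<close> at the identity, comparing components in \<open>s = s 1\<close> for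
  homogeneous \<open>s\<close> gives \<open>s = s e\<close>; by additivity this holds for \<open>s = 1\<close>.\<close>

lemma one_mem_comp: "\<one>\<^bsub>S\<^esub> \<in> grd \<one>\<^bsub>\<Gamma>\<^esub>"
proof -
  \<comment> \<open>The identity is put in by hand, since it is not yet known that \<open>1\<close>
    has a nonzero component there.\<close>
  define F where "F = insert \<one>\<^bsub>\<Gamma>\<^esub> (graded_support \<Gamma> S (hc \<one>\<^bsub>S\<^esub>))"
  have F: "finite F" "F \<subseteq> carrier \<Gamma>" "graded_support \<Gamma> S (hc \<one>\<^bsub>S\<^esub>) \<subseteq> F" "\<one>\<^bsub>\<Gamma>\<^esub> \<in> F"
    using finite_graded_support by (auto simp: F_def graded_support_def)
  define e where "e = hc \<one>\<^bsub>S\<^esub>"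
  have e: "e \<gamma> \<in> grd \<gamma>" "e \<gamma> \<in> carrier S" if "\<gamma> \<in> carrier \<Gamma>" for \<gamma>
    using that by (auto simp: e_def hcomponent_mem hcomponent_closed)
  have "x = x \<otimes>\<^bsub>S\<^esub> e \<one>\<^bsub>\<Gamma>\<^esub>" if "x \<in> carrier S" for x
    using that
  proof (induction rule: homogeneous_induct)
    case (homogeneous \<gamma> y)
    have y: "y \<in> carrier S" using homogeneous comp_closed by blast
    have inj: "inj_on (\<lambda>\<delta>. \<gamma> \<otimes>\<^bsub>\<Gamma>\<^esub> \<delta>) F"
      using F(2) homogeneous(1) by (intro inj_onI) (simp add: subset_iff)
    \<comment> \<open>The products of \<open>y\<close> with the components of \<open>1\<close>,
      indexed by their own degrees; the one of degree \<open>\<gamma>\<close> involves the identity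
      component.\<close>
    define d where "d \<delta> = y \<otimes>\<^bsub>S\<^esub> e (inv\<^bsub>\<Gamma>\<^esub> \<gamma> \<otimes>\<^bsub>\<Gamma>\<^esub> \<delta>)" for \<delta>
    have d: "d (\<gamma> \<otimes>\<^bsub>\<Gamma>\<^esub> \<delta>) = y \<otimes>\<^bsub>S\<^esub> e \<delta>" if "\<delta> \<in> F" for \<delta>
      using that F(2) homogeneous by (auto simp: d_def grp.m_assoc[symmetric])
    have dm: "d \<epsilon> \<in> grd \<epsilon>" if "\<epsilon> \<in> (\<lambda>\<delta>. \<gamma> \<otimes>\<^bsub>\<Gamma>\<^esub> \<delta>) ` F" for \<epsilon>
      using that d F(2) homogeneous comp_mult e by auto
    have "y = y \<otimes>\<^bsub>S\<^esub> (\<Oplus>\<^bsub>S\<^esub>\<delta>\<in>F. e \<delta>)"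
      using finsum_hcomponent[OF rng.one_closed F(1-3)] y by (simp add: e_def)
    also have "\<dots> = (\<Oplus>\<^bsub>S\<^esub>\<delta>\<in>F. d (\<gamma> \<otimes>\<^bsub>\<Gamma>\<^esub> \<delta>))"
      using F y e d by (subst rng.finsum_rdistr) (auto intro!: rng.finsum_cong')
    also have "\<dots> = (\<Oplus>\<^bsub>S\<^esub>\<epsilon>\<in>(\<lambda>\<delta>. \<gamma> \<otimes>\<^bsub>\<Gamma>\<^esub> \<delta>) ` F. d \<epsilon>)"
      using inj d F(2) y e by (intro rng.finsum_reindex[symmetric]) auto
    finally have y_eq: "y = (\<Oplus>\<^bsub>S\<^esub>\<epsilon>\<in>(\<lambda>\<delta>. \<gamma> \<otimes>\<^bsub>\<Gamma>\<^esub> \<delta>) ` F. d \<epsilon>)" .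
    have "(\<lambda>\<delta>. \<gamma> \<otimes>\<^bsub>\<Gamma>\<^esub> \<delta>) ` F \<subseteq> carrier \<Gamma>"
      using F(2) homogeneous(1) by (auto simp: subset_iff)
    from hcomponent_finsum[OF finite_imageI[OF F(1)] this Pi_I homogeneous(1), of d] dm
    have "hc y \<gamma> = (if \<gamma> \<in> (\<lambda>\<delta>. \<gamma> \<otimes>\<^bsub>\<Gamma>\<^esub> \<delta>) ` F then d \<gamma> else \<zero>\<^bsub>S\<^esub>)"
      unfolding y_eq by blast
    moreover have "\<gamma> = \<gamma> \<otimes>\<^bsub>\<Gamma>\<^esub> \<one>\<^bsub>\<Gamma>\<^esub>" using homogeneous by simp
    then have "\<gamma> \<in> (\<lambda>\<delta>. \<gamma> \<otimes>\<^bsub>\<Gamma>\<^esub> \<delta>) ` F" using F(4) by blast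
    ultimately show ?case
      using hcomponent_homogeneous[of \<gamma> y \<gamma>] homogeneous by (simp add: d_def)
  next
    case (add y z)
    then show ?case using e by (simp add: rng.l_distr)
  qed (use e in auto)
  from this[of "\<one>\<^bsub>S\<^esub>"] show ?thesis using e by (metis grp.one_closed rng.l_one rng.one_closed)
qed

end

lemma (in graded_ring) comp_subset_quotient_comp:
  assumes "C \<subseteq> carrier \<Gamma>" "\<gamma> \<in> C"
  shows "grd \<gamma> \<subseteq> quotient_comp S grd C"
proof
  fix r assume "r \<in> grd \<gamma>"
  moreover have "r = (\<Oplus>\<^bsub>S\<^esub>\<delta>\<in>{\<gamma>}. r)"
    using comp_closed calculation assms by auto
  ultimately show "r \<in> quotient_comp S grd C"
    unfolding quotient_comp_def using assms(2)
    by (intro CollectI exI[of _ "{\<gamma>}"] exI[of _ "\<lambda>_. r"]) auto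
qed

lemma (in graded_ring) hcomponent_quotient_comp:
  assumes "C \<subseteq> carrier \<Gamma>" "r \<in> quotient_comp S grd C" "\<gamma> \<in> carrier \<Gamma>" "\<gamma> \<notin> C"
  shows "hc r \<gamma> = \<zero>\<^bsub>S\<^esub>"
proof -
  obtain F d where "finite F" "F \<subseteq> C" "d \<in> Pi F grd" "r = (\<Oplus>\<^bsub>S\<^esub>\<delta>\<in>F. d \<delta>)"
    using assms(2) by (auto simp: quotient_comp_def)
  then show ?thesis
    using hcomponent_finsum[of F d \<gamma>] assms by auto
qed

section \<open>The twisted group ring\<close>

locale twisted_group_ring = graded_ring G R grd + normal H G
  for G :: "('g, 'm) monoid_scheme" and R :: "('a, 'n) ring_scheme"
    and grd :: "'g \<Rightarrow> 'a set" and H :: "'g set"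
begin

section \<open>Additive structure of \<open>R[H]\<close> and decomposition into monomials\<close>

abbreviation RH where "RH \<equiv> group_ring G R grd H"

definition single :: "'a \<Rightarrow> 'g \<Rightarrow> 'g \<Rightarrow> 'a"
  where "single r a = (\<lambda>b\<in>H. if b = a then r else \<zero>\<^bsub>R\<^esub>)"

lemma Rmem_carrier_iff:
  "f \<in> carrier RH \<longleftrightarrow> f \<in> H \<rightarrow>\<^sub>E carrier R \<and> finite {a \<in> H. f a \<noteq> \<zero>\<^bsub>R\<^esub>}"
  by (simp add: group_ring_def group_ring_carrier_def)

lemma RH_closed: "\<lbrakk>f \<in> carrier RH; a \<in> H\<rbrakk> \<Longrightarrow> f a \<in> carrier R"
  by (auto simp: Rmem_carrier_iff)

lemma RH_finite: "f \<in> carrier RH \<Longrightarrow> finite {a \<in> H. f a \<noteq> \<zero>\<^bsub>R\<^esub>}"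
  by (simp add: Rmem_carrier_iff)

lemma RH_extensional: "f \<in> carrier RH \<Longrightarrow> f \<in> extensional H"
  by (auto simp: Rmem_carrier_iff PiE_def)

lemma RH_add: "a \<in> H \<Longrightarrow> (f \<oplus>\<^bsub>RH\<^esub> f') a = f a \<oplus>\<^bsub>R\<^esub> f' a"
  by (simp add: group_ring_def)

lemma RH_zero: "a \<in> H \<Longrightarrow> \<zero>\<^bsub>RH\<^esub> a = \<zero>\<^bsub>R\<^esub>"
  by (simp add: group_ring_def)

lemma RH_one: "\<one>\<^bsub>RH\<^esub> = single \<one>\<^bsub>R\<^esub> \<one>\<^bsub>G\<^esub>"
  by (simp add: group_ring_def single_def)

lemma RH_add_closed:
  assumes "f \<in> carrier RH" "f' \<in> carrier RH"
  shows "f \<oplus>\<^bsub>RH\<^esub> f' \<in> carrier RH"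
  unfolding Rmem_carrier_iff
proof
  show "f \<oplus>\<^bsub>RH\<^esub> f' \<in> H \<rightarrow>\<^sub>E carrier R"
    using assms RH_closed by (auto simp: group_ring_def)
  show "finite {a \<in> H. (f \<oplus>\<^bsub>RH\<^esub> f') a \<noteq> \<zero>\<^bsub>R\<^esub>}"
    by (rule finite_subset[rotated, OF finite_UnI[OF RH_finite[OF assms(1)] RH_finite[OF assms(2)]]])
       (auto simp: RH_add RH_closed[OF assms(1)] RH_closed[OF assms(2)])
qed

lemma RH_abelian_group: "abelian_group RH"
proof (rule abelian_groupI)
  fix f assume f: "f \<in> carrier RH"
  have "(\<lambda>a\<in>H. \<ominus>\<^bsub>R\<^esub> f a) \<in> carrier RH"
    using RH_closed[OF f] RH_finite[OF f]
    by (auto simp: Rmem_carrier_iff elim!: finite_subset[rotated])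
  moreover have "(\<lambda>a\<in>H. \<ominus>\<^bsub>R\<^esub> f a) \<oplus>\<^bsub>RH\<^esub> f = \<zero>\<^bsub>RH\<^esub>"
    using RH_closed[OF f] by (auto simp: group_ring_def rng.l_neg)
  ultimately show "\<exists>f'\<in>carrier RH. f' \<oplus>\<^bsub>RH\<^esub> f = \<zero>\<^bsub>RH\<^esub>" by blast
  show "\<zero>\<^bsub>RH\<^esub> \<oplus>\<^bsub>RH\<^esub> f = f"
    using RH_closed[OF f] RH_extensional[OF f]
    by (intro extensionalityI[of _ H]) (auto simp: group_ring_def)
next
  show "\<zero>\<^bsub>RH\<^esub> \<in> carrier RH"
    by (auto simp: Rmem_carrier_iff RH_zero) (auto simp: group_ring_def)
next
  fix f f' f'' assume f: "f \<in> carrier RH" "f' \<in> carrier RH" "f'' \<in> carrier RH"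
  show "f \<oplus>\<^bsub>RH\<^esub> f' \<in> carrier RH" using f by (simp add: RH_add_closed)
  show "f \<oplus>\<^bsub>RH\<^esub> f' = f' \<oplus>\<^bsub>RH\<^esub> f"
    using f RH_closed by (auto simp: group_ring_def rng.a_comm)
  show "f \<oplus>\<^bsub>RH\<^esub> f' \<oplus>\<^bsub>RH\<^esub> f'' = f \<oplus>\<^bsub>RH\<^esub> (f' \<oplus>\<^bsub>RH\<^esub> f'')"
    using f RH_closed by (auto simp: group_ring_def rng.a_assoc)
qed

sublocale RHa: abelian_group RH
  by (rule RH_abelian_group)

lemma RH_finsum_apply:
  assumes "f \<in> F \<rightarrow> carrier RH" "a \<in> H"
  shows "(\<Oplus>\<^bsub>RH\<^esub>i\<in>F. f i) a = (\<Oplus>\<^bsub>R\<^esub>i\<in>F. f i a)"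
  using assms(1)
proof (induction F rule: infinite_finite_induct)
  case (infinite F)
  then show ?case using assms(2) by (simp add: RH_zero)
next
  case empty
  then show ?case using assms(2) by (simp add: RH_zero)
next
  case (insert x F)
  then show ?case
    using assms(2) RH_closed by (simp add: RH_add Pi_iff)
qed

lemma single_apply: "b \<in> H \<Longrightarrow> single r a b = (if b = a then r else \<zero>\<^bsub>R\<^esub>)"
  by (simp add: single_def)

lemma single_closed: "r \<in> carrier R \<Longrightarrow> single r a \<in> carrier RH"
  by (auto simp: Rmem_carrier_iff single_def intro: finite_subset[of _ "{a}"])

lemma single_add:
  "\<lbrakk>r \<in> carrier R; s \<in> carrier R\<rbrakk> \<Longrightarrow> single (r \<oplus>\<^bsub>R\<^esub> s) a = single r a \<oplus>\<^bsub>RH\<^esub> single s a"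
  by (auto simp: single_def group_ring_def)

lemma single_zero: "single \<zero>\<^bsub>R\<^esub> a = \<zero>\<^bsub>RH\<^esub>"
  by (auto simp: single_def group_ring_def)

text \<open>An element is a finite sum of monomials, and each coefficient a finite sum of
  homogeneous ones. On monomials with homogeneous coefficients the product is given by the bare
  rule, so biadditive identities need checking only there.\<close>

lemma group_ring_induct [consumes 1, case_names zero single add]:
  assumes f: "f \<in> carrier RH" and zero: "P \<zero>\<^bsub>RH\<^esub>"
    and single: "\<And>g r a. \<lbrakk>g \<in> carrier G; r \<in> grd g; r \<in> carrier R; a \<in> H\<rbrakk> \<Longrightarrow> P (single r a)"
    and add: "\<And>f f'. \<lbrakk>f \<in> carrier RH; f' \<in> carrier RH; P f; P f'\<rbrakk> \<Longrightarrow> P (f \<oplus>\<^bsub>RH\<^esub> f')"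
  shows "P f"
proof -
  have P_single: "P (single r a)" if "r \<in> carrier R" "a \<in> H" for r a
    using that(1)
  proof (induction rule: homogeneous_induct)
    case zero
    then show ?case by (simp add: single_zero assms(2))
  next
    case (homogeneous \<gamma> y)
    then show ?case using single comp_closed that(2) by blast
  next
    case (add y z)
    then show ?case by (simp add: single_add single_closed assms(4))
  qed
  have sum: "P (\<Oplus>\<^bsub>RH\<^esub>a\<in>F. single (f a) a)" if "finite F" "F \<subseteq> H" for F
    using that
  proof (induction F)
    case empty
    then show ?case by (simp add: zero)
  next
    case (insert a F)
    then have "single (f b) b \<in> carrier RH" if "b \<in> insert a F" for b
      using that RH_closed[OF f] single_closed by blast
    then show ?case
      using insert RH_closed[OF f] P_single by (simp add: Pi_iff add)
  qed
  define F where "F = {a \<in> H. f a \<noteq> \<zero>\<^bsub>R\<^esub>}"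
  have F: "finite F" "F \<subseteq> H" using RH_finite[OF f] by (auto simp: F_def)
  have cl: "(\<lambda>a. single (f a) a) \<in> F \<rightarrow> carrier RH"
    using F RH_closed[OF f] single_closed by blast
  have "(\<Oplus>\<^bsub>RH\<^esub>a\<in>F. single (f a) a) = f"
  proof (rule extensionalityI[of _ H])
    show "(\<Oplus>\<^bsub>RH\<^esub>a\<in>F. single (f a) a) \<in> extensional H"
      using cl by (intro RH_extensional RHa.finsum_closed)
    fix b assume b: "b \<in> H"
    have "(\<Oplus>\<^bsub>RH\<^esub>a\<in>F. single (f a) a) b = (\<Oplus>\<^bsub>R\<^esub>a\<in>F. single (f a) a b)"
      using cl b by (rule RH_finsum_apply)
    also have "\<dots> = f b"
    proof (cases "b \<in> F")
      case True
      then show ?thesis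
        using F b RH_closed[OF f] by (subst rng.finsum_delta[of F b]) (auto simp: single_apply)
    next
      case False
      then have "single (f a) a b = \<zero>\<^bsub>R\<^esub>" if "a \<in> F" for a
        using that b by (auto simp: single_apply)
      then have "(\<Oplus>\<^bsub>R\<^esub>a\<in>F. single (f a) a b) = \<zero>\<^bsub>R\<^esub>"
        by (rule rng.add.finprod_one_eqI)
      then show ?thesis using False b by (simp add: F_def)
    qed
    finally show "(\<Oplus>\<^bsub>RH\<^esub>a\<in>F. single (f a) a) b = f b" .
  qed (rule RH_extensional[OF f])
  then show ?thesis using sum[OF F] by simp
qed

section \<open>Product formula and ring axioms\<close>

text \<open>The index sets in the definition depend on the factors, which blocks termwise comparison
  of different products. Here they are replaced by arbitrary larger finite sets, the condition on
  \<open>k\<close> moving into the summand; all new terms vanish.\<close>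

lemma RH_mult:
  assumes f: "f \<in> carrier RH" and f': "f' \<in> carrier RH" and k: "k \<in> H"
    and A: "finite A" "A \<subseteq> H" "{a \<in> H. f a \<noteq> \<zero>\<^bsub>R\<^esub>} \<subseteq> A"
    and B: "finite B" "B \<subseteq> H" "{b \<in> H. f' b \<noteq> \<zero>\<^bsub>R\<^esub>} \<subseteq> B"
    and D: "finite D" "D \<subseteq> carrier G" "\<And>b. b \<in> B \<Longrightarrow> graded_support G R (hc (f' b)) \<subseteq> D"
  shows "(f \<otimes>\<^bsub>RH\<^esub> f') k = (\<Oplus>\<^bsub>R\<^esub>a\<in>A. \<Oplus>\<^bsub>R\<^esub>b\<in>B. \<Oplus>\<^bsub>R\<^esub>h\<in>D.
    if inv\<^bsub>G\<^esub> h \<otimes>\<^bsub>G\<^esub> a \<otimes>\<^bsub>G\<^esub> h \<otimes>\<^bsub>G\<^esub> b = k then f a \<otimes>\<^bsub>R\<^esub> hc (f' b) h else \<zero>\<^bsub>R\<^esub>)"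
    (is "_ = (\<Oplus>\<^bsub>R\<^esub>a\<in>A. \<Oplus>\<^bsub>R\<^esub>b\<in>B. \<Oplus>\<^bsub>R\<^esub>h\<in>D. ?t a b h)")
proof -
  define A' where "A' = {a \<in> H. f a \<noteq> \<zero>\<^bsub>R\<^esub>}"
  define B' where "B' = {b \<in> H. f' b \<noteq> \<zero>\<^bsub>R\<^esub>}"
  define D' where "D' a b = {h \<in> graded_support G R (hc (f' b)).
    inv\<^bsub>G\<^esub> h \<otimes>\<^bsub>G\<^esub> a \<otimes>\<^bsub>G\<^esub> h \<otimes>\<^bsub>G\<^esub> b = k}" for a b
  have hcc: "hc (f' b) h \<in> carrier R" if "b \<in> H" "h \<in> carrier G" for b h
    using hcomponent_closed RH_closed[OF f'] that by blast
  have fc: "f a \<in> carrier R" if "a \<in> H" for a using RH_closed[OF f] that .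
  have tc: "?t a b h \<in> carrier R" if "a \<in> A" "b \<in> B" "h \<in> D" for a b h
  proof -
    have "a \<in> H" "b \<in> H" "h \<in> carrier G" using that A(2) B(2) D(2) by auto
    then show ?thesis using hcc fc by simp
  qed
  have inner: "(\<Oplus>\<^bsub>R\<^esub>h\<in>D' a b. f a \<otimes>\<^bsub>R\<^esub> hc (f' b) h) = (\<Oplus>\<^bsub>R\<^esub>h\<in>D. ?t a b h)"
    if a: "a \<in> A" and b: "b \<in> B" for a b
  proof -
    have ab: "a \<in> H" "b \<in> H" using a b A B by auto
    have sub: "D' a b \<subseteq> D" using D(3)[OF b] by (auto simp: D'_def)
    have D'c: "h \<in> carrier G" if "h \<in> D' a b" for h using that sub D(2) by blast
    have "(\<Oplus>\<^bsub>R\<^esub>h\<in>D' a b. f a \<otimes>\<^bsub>R\<^esub> hc (f' b) h) = (\<Oplus>\<^bsub>R\<^esub>h\<in>D' a b. ?t a b h)"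
      using ab hcc fc D'c by (intro rng.finsum_cong') (auto simp: D'_def)
    also have "\<dots> = (\<Oplus>\<^bsub>R\<^esub>h\<in>D. ?t a b h)"
    proof (rule rng.finsum_mono_neutral[OF D(1) sub])
      fix h assume "h \<in> D - D' a b"
      then show "?t a b h = \<zero>\<^bsub>R\<^esub>"
        using D(2) fc[OF ab(1)] by (auto simp: D'_def graded_support_def)
    qed (use sub tc a b in blast)
    finally show ?thesis .
  qed
  define s where "s a b = (\<Oplus>\<^bsub>R\<^esub>h\<in>D. ?t a b h)" for a b
  have s: "s a b \<in> carrier R" if "a \<in> A" "b \<in> B" for a b
    unfolding s_def using tc that by (intro rng.finsum_closed) blast
  have sub: "A' \<subseteq> A" "B' \<subseteq> B" using A(3) B(3) by (simp_all add: A'_def B'_def)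
  have "(f \<otimes>\<^bsub>RH\<^esub> f') k = (\<Oplus>\<^bsub>R\<^esub>a\<in>A'. \<Oplus>\<^bsub>R\<^esub>b\<in>B'. \<Oplus>\<^bsub>R\<^esub>h\<in>D' a b. f a \<otimes>\<^bsub>R\<^esub> hc (f' b) h)"
    using k by (simp add: group_ring_def group_ring_mult_def A'_def B'_def D'_def)
  also have "\<dots> = (\<Oplus>\<^bsub>R\<^esub>a\<in>A'. \<Oplus>\<^bsub>R\<^esub>b\<in>B'. s a b)"
    using sub s inner by (intro rng.finsum_cong' refl Pi_I rng.finsum_closed) (simp_all only: s_def subset_iff)
  also have "\<dots> = (\<Oplus>\<^bsub>R\<^esub>a\<in>A'. \<Oplus>\<^bsub>R\<^esub>b\<in>B. s a b)"
  proof (rule rng.finsum_cong')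
    fix a assume "a \<in> A'"
    then have a: "a \<in> A" "a \<in> H" using sub A by auto
    show "(\<Oplus>\<^bsub>R\<^esub>b\<in>B'. s a b) = (\<Oplus>\<^bsub>R\<^esub>b\<in>B. s a b)"
    proof (rule rng.finsum_mono_neutral[OF B(1) sub(2)])
      fix b assume "b \<in> B - B'"
      then have "f' b = \<zero>\<^bsub>R\<^esub>" using B(2) by (auto simp: B'_def)
      then show "s a b = \<zero>\<^bsub>R\<^esub>"
        unfolding s_def using D(2) fc[OF a(2)]
        by (intro rng.add.finprod_one_eqI) (auto simp: hcomponent_zero subset_iff)
    qed (use sub a s in blast)
  qed (use sub s in \<open>auto intro!: rng.finsum_closed simp: subset_iff\<close>)
  also have "\<dots> = (\<Oplus>\<^bsub>R\<^esub>a\<in>A. \<Oplus>\<^bsub>R\<^esub>b\<in>B. s a b)"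
  proof (rule rng.finsum_mono_neutral[OF A(1) sub(1)])
    fix a assume "a \<in> A - A'"
    then have "f a = \<zero>\<^bsub>R\<^esub>" using A(2) by (auto simp: A'_def)
    then have "s a b = \<zero>\<^bsub>R\<^esub>" if "b \<in> B" for b
      unfolding s_def using D(2) B(2) hcc that
      by (intro rng.add.finprod_one_eqI) (auto simp: subset_iff)
    then show "(\<Oplus>\<^bsub>R\<^esub>b\<in>B. s a b) = \<zero>\<^bsub>R\<^esub>"
      by (rule rng.add.finprod_one_eqI)
  next
    fix a assume "a \<in> A'"
    then show "(\<Oplus>\<^bsub>R\<^esub>b\<in>B. s a b) \<in> carrier R"
      using sub s by (intro rng.finsum_closed) blast
  qed
  finally show ?thesis by (simp only: s_def)
qed

lemma RH_mult_closed:
  assumes f: "f \<in> carrier RH" and f': "f' \<in> carrier RH"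
  shows "f \<otimes>\<^bsub>RH\<^esub> f' \<in> carrier RH"
  unfolding Rmem_carrier_iff
proof
  define A where "A = {a \<in> H. f a \<noteq> \<zero>\<^bsub>R\<^esub>}"
  define B where "B = {b \<in> H. f' b \<noteq> \<zero>\<^bsub>R\<^esub>}"
  define D where "D = (\<Union>b\<in>B. graded_support G R (hc (f' b)))"
  have A: "finite A" "A \<subseteq> H" "{a \<in> H. f a \<noteq> \<zero>\<^bsub>R\<^esub>} \<subseteq> A"
    using RH_finite[OF f] by (auto simp: A_def)
  have B: "finite B" "B \<subseteq> H" "{b \<in> H. f' b \<noteq> \<zero>\<^bsub>R\<^esub>} \<subseteq> B"
    using RH_finite[OF f'] by (auto simp: B_def)
  have D: "finite D" "D \<subseteq> carrier G" "\<And>b. b \<in> B \<Longrightarrow> graded_support G R (hc (f' b)) \<subseteq> D"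
    using B finite_graded_support RH_closed[OF f'] by (auto simp: D_def graded_support_def)
  have c: "f a \<otimes>\<^bsub>R\<^esub> hc (f' b) h \<in> carrier R" if "a \<in> A" "b \<in> B" "h \<in> D" for a b h
  proof -
    have "a \<in> H" "b \<in> H" "h \<in> carrier G" using that A(2) B(2) D(2) by auto
    then show ?thesis using hcomponent_closed RH_closed f f' by simp
  qed
  have val: "(f \<otimes>\<^bsub>RH\<^esub> f') k \<in> carrier R" if "k \<in> H" for k
    by (subst RH_mult[OF f f' that A B D]) (use c in \<open>auto intro!: rng.finsum_closed\<close>)
  have "f \<otimes>\<^bsub>RH\<^esub> f' \<in> extensional H"
    by (simp add: group_ring_def group_ring_mult_def)
  then show "f \<otimes>\<^bsub>RH\<^esub> f' \<in> H \<rightarrow>\<^sub>E carrier R"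
    using val by (simp add: PiE_iff)
  \<comment> \<open>All group elements that a product of monomials of the two factors can
    produce.\<close>
  let ?K = "(\<lambda>(a, b, h). inv\<^bsub>G\<^esub> h \<otimes>\<^bsub>G\<^esub> a \<otimes>\<^bsub>G\<^esub> h \<otimes>\<^bsub>G\<^esub> b) ` (A \<times> B \<times> D)"
  have "(f \<otimes>\<^bsub>RH\<^esub> f') k = \<zero>\<^bsub>R\<^esub>" if k: "k \<in> H" "k \<notin> ?K" for k
  proof -
    have "inv\<^bsub>G\<^esub> h \<otimes>\<^bsub>G\<^esub> a \<otimes>\<^bsub>G\<^esub> h \<otimes>\<^bsub>G\<^esub> b \<noteq> k" if "a \<in> A" "b \<in> B" "h \<in> D" for a b h
      using k(2) that by force
    then show ?thesis
      by (subst RH_mult[OF f f' k(1) A B D]) (auto intro!: rng.add.finprod_one_eqI)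
  qed
  then have "{k \<in> H. (f \<otimes>\<^bsub>RH\<^esub> f') k \<noteq> \<zero>\<^bsub>R\<^esub>} \<subseteq> ?K" by blast
  then show "finite {k \<in> H. (f \<otimes>\<^bsub>RH\<^esub> f') k \<noteq> \<zero>\<^bsub>R\<^esub>}"
    using A(1) B(1) D(1) by (auto intro: finite_subset)
qed

lemma RH_l_distr:
  assumes f: "f \<in> carrier RH" and f': "f' \<in> carrier RH" and u: "u \<in> carrier RH"
  shows "(f \<oplus>\<^bsub>RH\<^esub> f') \<otimes>\<^bsub>RH\<^esub> u = f \<otimes>\<^bsub>RH\<^esub> u \<oplus>\<^bsub>RH\<^esub> f' \<otimes>\<^bsub>RH\<^esub> u"
proof (rule extensionalityI[of _ H])
  show "(f \<oplus>\<^bsub>RH\<^esub> f') \<otimes>\<^bsub>RH\<^esub> u \<in> extensional H"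
    "f \<otimes>\<^bsub>RH\<^esub> u \<oplus>\<^bsub>RH\<^esub> f' \<otimes>\<^bsub>RH\<^esub> u \<in> extensional H"
    using assms by (auto intro!: RH_extensional RH_add_closed RH_mult_closed)
  fix k assume k: "k \<in> H"
  \<comment> \<open>Both supports together also contain that of the sum, so all three products
    expand over the same sets and are compared term by term.\<close>
  define A where "A = {a \<in> H. f a \<noteq> \<zero>\<^bsub>R\<^esub>} \<union> {a \<in> H. f' a \<noteq> \<zero>\<^bsub>R\<^esub>}"
  define B where "B = {b \<in> H. u b \<noteq> \<zero>\<^bsub>R\<^esub>}"
  define D where "D = (\<Union>b\<in>B. graded_support G R (hc (u b)))"
  have A: "finite A" "A \<subseteq> H" "{a \<in> H. f a \<noteq> \<zero>\<^bsub>R\<^esub>} \<subseteq> A" "{a \<in> H. f' a \<noteq> \<zero>\<^bsub>R\<^esub>} \<subseteq> A"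
    "{a \<in> H. (f \<oplus>\<^bsub>RH\<^esub> f') a \<noteq> \<zero>\<^bsub>R\<^esub>} \<subseteq> A"
    using RH_finite[OF f] RH_finite[OF f'] RH_closed[OF f] RH_closed[OF f']
    by (auto simp: A_def RH_add)
  have B: "finite B" "B \<subseteq> H" "{b \<in> H. u b \<noteq> \<zero>\<^bsub>R\<^esub>} \<subseteq> B"
    using RH_finite[OF u] by (auto simp: B_def)
  have D: "finite D" "D \<subseteq> carrier G" "\<And>b. b \<in> B \<Longrightarrow> graded_support G R (hc (u b)) \<subseteq> D"
    using B finite_graded_support RH_closed[OF u] by (auto simp: D_def graded_support_def)
  define t where "t g a b h = (if inv\<^bsub>G\<^esub> h \<otimes>\<^bsub>G\<^esub> a \<otimes>\<^bsub>G\<^esub> h \<otimes>\<^bsub>G\<^esub> b = k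
    then g a \<otimes>\<^bsub>R\<^esub> hc (u b) h else \<zero>\<^bsub>R\<^esub>)" for g a b h
  have t: "t g a b h \<in> carrier R" if "g \<in> carrier RH" "a \<in> A" "b \<in> B" "h \<in> D" for g a b h
  proof -
    have "a \<in> H" "b \<in> H" "h \<in> carrier G" using that A(2) B(2) D(2) by auto
    then show ?thesis using hcomponent_closed RH_closed u that(1) by (simp add: t_def)
  qed
  have t_add: "t (f \<oplus>\<^bsub>RH\<^esub> f') a b h = t f a b h \<oplus>\<^bsub>R\<^esub> t f' a b h"
    if "a \<in> A" "b \<in> B" "h \<in> D" for a b h
  proof -
    have "a \<in> H" "b \<in> H" "h \<in> carrier G" using that A(2) B(2) D(2) by auto
    then show ?thesis
      using hcomponent_closed RH_closed f f' u by (simp add: t_def RH_add rng.l_distr)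
  qed
  have eq: "(g \<otimes>\<^bsub>RH\<^esub> u) k = (\<Oplus>\<^bsub>R\<^esub>a\<in>A. \<Oplus>\<^bsub>R\<^esub>b\<in>B. \<Oplus>\<^bsub>R\<^esub>h\<in>D. t g a b h)"
    if "g \<in> carrier RH" "{a \<in> H. g a \<noteq> \<zero>\<^bsub>R\<^esub>} \<subseteq> A" for g
    unfolding t_def by (rule RH_mult[OF that(1) u k A(1,2) that(2) B D])
  have "(\<Oplus>\<^bsub>R\<^esub>a\<in>A. \<Oplus>\<^bsub>R\<^esub>b\<in>B. \<Oplus>\<^bsub>R\<^esub>h\<in>D. t (f \<oplus>\<^bsub>RH\<^esub> f') a b h) =
      (\<Oplus>\<^bsub>R\<^esub>a\<in>A. \<Oplus>\<^bsub>R\<^esub>b\<in>B. \<Oplus>\<^bsub>R\<^esub>h\<in>D. t f a b h \<oplus>\<^bsub>R\<^esub> t f' a b h)"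
    using t f f' by (intro rng.finsum_cong' refl Pi_I rng.finsum_closed) (auto simp: t_add)
  also have "\<dots> = (\<Oplus>\<^bsub>R\<^esub>a\<in>A. \<Oplus>\<^bsub>R\<^esub>b\<in>B. (\<Oplus>\<^bsub>R\<^esub>h\<in>D. t f a b h) \<oplus>\<^bsub>R\<^esub> (\<Oplus>\<^bsub>R\<^esub>h\<in>D. t f' a b h))"
    using t f f'
    by (intro rng.finsum_cong' rng.finsum_addf refl Pi_I rng.finsum_closed rng.a_closed) auto
  also have "\<dots> = (\<Oplus>\<^bsub>R\<^esub>a\<in>A. (\<Oplus>\<^bsub>R\<^esub>b\<in>B. \<Oplus>\<^bsub>R\<^esub>h\<in>D. t f a b h) \<oplus>\<^bsub>R\<^esub> (\<Oplus>\<^bsub>R\<^esub>b\<in>B. \<Oplus>\<^bsub>R\<^esub>h\<in>D. t f' a b h))"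
    using t f f'
    by (intro rng.finsum_cong' rng.finsum_addf refl Pi_I rng.finsum_closed rng.a_closed) auto
  also have "\<dots> = (\<Oplus>\<^bsub>R\<^esub>a\<in>A. \<Oplus>\<^bsub>R\<^esub>b\<in>B. \<Oplus>\<^bsub>R\<^esub>h\<in>D. t f a b h) \<oplus>\<^bsub>R\<^esub> (\<Oplus>\<^bsub>R\<^esub>a\<in>A. \<Oplus>\<^bsub>R\<^esub>b\<in>B. \<Oplus>\<^bsub>R\<^esub>h\<in>D. t f' a b h)"
    using t f f'
    by (intro rng.finsum_addf Pi_I rng.finsum_closed) auto
  finally show "((f \<oplus>\<^bsub>RH\<^esub> f') \<otimes>\<^bsub>RH\<^esub> u) k = (f \<otimes>\<^bsub>RH\<^esub> u \<oplus>\<^bsub>RH\<^esub> f' \<otimes>\<^bsub>RH\<^esub> u) k"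
    using k A(3-5) f f' eq by (simp add: RH_add RH_add_closed)
qed

lemma RH_r_distr:
  assumes f: "f \<in> carrier RH" and f': "f' \<in> carrier RH" and u: "u \<in> carrier RH"
  shows "u \<otimes>\<^bsub>RH\<^esub> (f \<oplus>\<^bsub>RH\<^esub> f') = u \<otimes>\<^bsub>RH\<^esub> f \<oplus>\<^bsub>RH\<^esub> u \<otimes>\<^bsub>RH\<^esub> f'"
proof (rule extensionalityI[of _ H])
  show "u \<otimes>\<^bsub>RH\<^esub> (f \<oplus>\<^bsub>RH\<^esub> f') \<in> extensional H"
    "u \<otimes>\<^bsub>RH\<^esub> f \<oplus>\<^bsub>RH\<^esub> u \<otimes>\<^bsub>RH\<^esub> f' \<in> extensional H"
    using assms by (auto intro!: RH_extensional RH_add_closed RH_mult_closed)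
  fix k assume k: "k \<in> H"
  define A where "A = {a \<in> H. u a \<noteq> \<zero>\<^bsub>R\<^esub>}"
  define B where "B = {b \<in> H. f b \<noteq> \<zero>\<^bsub>R\<^esub>} \<union> {b \<in> H. f' b \<noteq> \<zero>\<^bsub>R\<^esub>}"
  define D where "D = (\<Union>b\<in>B. graded_support G R (hc (f b)) \<union> graded_support G R (hc (f' b))
    \<union> graded_support G R (hc ((f \<oplus>\<^bsub>RH\<^esub> f') b)))"
  have ff': "f \<oplus>\<^bsub>RH\<^esub> f' \<in> carrier RH" using f f' by (rule RH_add_closed)
  have A: "finite A" "A \<subseteq> H" "{a \<in> H. u a \<noteq> \<zero>\<^bsub>R\<^esub>} \<subseteq> A"
    using RH_finite[OF u] by (auto simp: A_def)
  have B: "finite B" "B \<subseteq> H" "{b \<in> H. f b \<noteq> \<zero>\<^bsub>R\<^esub>} \<subseteq> B" "{b \<in> H. f' b \<noteq> \<zero>\<^bsub>R\<^esub>} \<subseteq> B"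
    "{b \<in> H. (f \<oplus>\<^bsub>RH\<^esub> f') b \<noteq> \<zero>\<^bsub>R\<^esub>} \<subseteq> B"
    using RH_finite[OF f] RH_finite[OF f'] RH_closed[OF f] RH_closed[OF f']
    by (auto simp: B_def RH_add)
  have "finite D"
    unfolding D_def using B(1,2) finite_graded_support RH_closed[OF f] RH_closed[OF f'] RH_closed[OF ff']
    by (intro finite_UN_I finite_UnI) auto
  then have D: "finite D" "D \<subseteq> carrier G" "\<And>b. b \<in> B \<Longrightarrow> graded_support G R (hc (f b)) \<subseteq> D"
    "\<And>b. b \<in> B \<Longrightarrow> graded_support G R (hc (f' b)) \<subseteq> D"
    "\<And>b. b \<in> B \<Longrightarrow> graded_support G R (hc ((f \<oplus>\<^bsub>RH\<^esub> f') b)) \<subseteq> D"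
    by (auto simp: D_def graded_support_def)
  define t where "t g a b h = (if inv\<^bsub>G\<^esub> h \<otimes>\<^bsub>G\<^esub> a \<otimes>\<^bsub>G\<^esub> h \<otimes>\<^bsub>G\<^esub> b = k
    then u a \<otimes>\<^bsub>R\<^esub> hc (g b) h else \<zero>\<^bsub>R\<^esub>)" for g a b h
  have t: "t g a b h \<in> carrier R" if "g \<in> carrier RH" "a \<in> A" "b \<in> B" "h \<in> D" for g a b h
  proof -
    have "a \<in> H" "b \<in> H" "h \<in> carrier G" using that A(2) B(2) D(2) by auto
    then show ?thesis using hcomponent_closed RH_closed u that(1) by (simp add: t_def)
  qed
  have t_add: "t (f \<oplus>\<^bsub>RH\<^esub> f') a b h = t f a b h \<oplus>\<^bsub>R\<^esub> t f' a b h"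
    if "a \<in> A" "b \<in> B" "h \<in> D" for a b h
  proof -
    have "a \<in> H" "b \<in> H" "h \<in> carrier G" using that A(2) B(2) D(2) by auto
    then show ?thesis
      using hcomponent_closed RH_closed f f' u
      by (simp add: t_def RH_add hcomponent_add rng.r_distr)
  qed
  have eq: "(u \<otimes>\<^bsub>RH\<^esub> g) k = (\<Oplus>\<^bsub>R\<^esub>a\<in>A. \<Oplus>\<^bsub>R\<^esub>b\<in>B. \<Oplus>\<^bsub>R\<^esub>h\<in>D. t g a b h)"
    if "g \<in> carrier RH" "{b \<in> H. g b \<noteq> \<zero>\<^bsub>R\<^esub>} \<subseteq> B"
      "\<And>b. b \<in> B \<Longrightarrow> graded_support G R (hc (g b)) \<subseteq> D" for g
    unfolding t_def by (rule RH_mult[OF u that(1) k A B(1,2) that(2) D(1,2) that(3)])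
  have "(\<Oplus>\<^bsub>R\<^esub>a\<in>A. \<Oplus>\<^bsub>R\<^esub>b\<in>B. \<Oplus>\<^bsub>R\<^esub>h\<in>D. t (f \<oplus>\<^bsub>RH\<^esub> f') a b h) =
      (\<Oplus>\<^bsub>R\<^esub>a\<in>A. \<Oplus>\<^bsub>R\<^esub>b\<in>B. \<Oplus>\<^bsub>R\<^esub>h\<in>D. t f a b h \<oplus>\<^bsub>R\<^esub> t f' a b h)"
    using t f f' by (intro rng.finsum_cong' refl Pi_I rng.finsum_closed) (auto simp: t_add)
  also have "\<dots> = (\<Oplus>\<^bsub>R\<^esub>a\<in>A. \<Oplus>\<^bsub>R\<^esub>b\<in>B. (\<Oplus>\<^bsub>R\<^esub>h\<in>D. t f a b h) \<oplus>\<^bsub>R\<^esub> (\<Oplus>\<^bsub>R\<^esub>h\<in>D. t f' a b h))"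
    using t f f'
    by (intro rng.finsum_cong' rng.finsum_addf refl Pi_I rng.finsum_closed rng.a_closed) auto
  also have "\<dots> = (\<Oplus>\<^bsub>R\<^esub>a\<in>A. (\<Oplus>\<^bsub>R\<^esub>b\<in>B. \<Oplus>\<^bsub>R\<^esub>h\<in>D. t f a b h) \<oplus>\<^bsub>R\<^esub> (\<Oplus>\<^bsub>R\<^esub>b\<in>B. \<Oplus>\<^bsub>R\<^esub>h\<in>D. t f' a b h))"
    using t f f'
    by (intro rng.finsum_cong' rng.finsum_addf refl Pi_I rng.finsum_closed rng.a_closed) auto
  also have "\<dots> = (\<Oplus>\<^bsub>R\<^esub>a\<in>A. \<Oplus>\<^bsub>R\<^esub>b\<in>B. \<Oplus>\<^bsub>R\<^esub>h\<in>D. t f a b h) \<oplus>\<^bsub>R\<^esub> (\<Oplus>\<^bsub>R\<^esub>a\<in>A. \<Oplus>\<^bsub>R\<^esub>b\<in>B. \<Oplus>\<^bsub>R\<^esub>h\<in>D. t f' a b h)"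
    using t f f'
    by (intro rng.finsum_addf Pi_I rng.finsum_closed) auto
  finally show "(u \<otimes>\<^bsub>RH\<^esub> (f \<oplus>\<^bsub>RH\<^esub> f')) k = (u \<otimes>\<^bsub>RH\<^esub> f \<oplus>\<^bsub>RH\<^esub> u \<otimes>\<^bsub>RH\<^esub> f') k"
    using k B(3-5) D(3-5) f f' ff' eq by (simp add: RH_add)
qed

lemma single_mult:
  assumes r: "r \<in> carrier R" and h: "h \<in> carrier G" and s: "s \<in> grd h" and ab: "a \<in> H" "b \<in> H"
  shows "single r a \<otimes>\<^bsub>RH\<^esub> single s b = single (r \<otimes>\<^bsub>R\<^esub> s) (inv\<^bsub>G\<^esub> h \<otimes>\<^bsub>G\<^esub> a \<otimes>\<^bsub>G\<^esub> h \<otimes>\<^bsub>G\<^esub> b)"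
proof (rule extensionalityI[of _ H])
  have sc: "s \<in> carrier R" using s h comp_closed by blast
  note cl = single_closed[OF r, of a] single_closed[OF sc, of b]
  show "single r a \<otimes>\<^bsub>RH\<^esub> single s b \<in> extensional H"
    using cl by (intro RH_extensional RH_mult_closed)
  show "single (r \<otimes>\<^bsub>R\<^esub> s) (inv\<^bsub>G\<^esub> h \<otimes>\<^bsub>G\<^esub> a \<otimes>\<^bsub>G\<^esub> h \<otimes>\<^bsub>G\<^esub> b) \<in> extensional H"
    by (simp add: single_def)
  fix k assume k: "k \<in> H"
  have "(single r a \<otimes>\<^bsub>RH\<^esub> single s b) k = (\<Oplus>\<^bsub>R\<^esub>a'\<in>{a}. \<Oplus>\<^bsub>R\<^esub>b'\<in>{b}. \<Oplus>\<^bsub>R\<^esub>h'\<in>{h}.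
      if inv\<^bsub>G\<^esub> h' \<otimes>\<^bsub>G\<^esub> a' \<otimes>\<^bsub>G\<^esub> h' \<otimes>\<^bsub>G\<^esub> b' = k then single r a a' \<otimes>\<^bsub>R\<^esub> hc (single s b b') h' else \<zero>\<^bsub>R\<^esub>)"
    using ab h s cl k
    by (intro RH_mult) (auto simp: single_apply graded_support_def hcomponent_homogeneous split: if_splits)
  then show "(single r a \<otimes>\<^bsub>RH\<^esub> single s b) k =
      single (r \<otimes>\<^bsub>R\<^esub> s) (inv\<^bsub>G\<^esub> h \<otimes>\<^bsub>G\<^esub> a \<otimes>\<^bsub>G\<^esub> h \<otimes>\<^bsub>G\<^esub> b) k"
    using ab h s r sc k by (auto simp: single_apply hcomponent_homogeneous)
qed

lemma conj_mem: "\<lbrakk>h \<in> carrier G; a \<in> H\<rbrakk> \<Longrightarrow> inv\<^bsub>G\<^esub> h \<otimes>\<^bsub>G\<^esub> a \<otimes>\<^bsub>G\<^esub> h \<in> H"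
  by (rule inv_op_closed1)

text \<open>On monomials \<open>r a\<close>, \<open>s b\<close>, \<open>t c\<close> with
  \<open>s\<close>, \<open>t\<close> of degrees \<open>h\<close>, \<open>k\<close>, the product
  \<open>s t\<close> has degree \<open>h k\<close>, and associativity amounts to the group identity
  \<open>eq\<close>, in which \<open>k k^-1\<close> cancels between the conjugates of
  \<open>a\<close> and \<open>b\<close>.\<close>

lemma RH_assoc:
  assumes f: "f \<in> carrier RH" and f': "f' \<in> carrier RH" and f'': "f'' \<in> carrier RH"
  shows "f \<otimes>\<^bsub>RH\<^esub> f' \<otimes>\<^bsub>RH\<^esub> f'' = f \<otimes>\<^bsub>RH\<^esub> (f' \<otimes>\<^bsub>RH\<^esub> f'')"
  using f
proof (induction rule: group_ring_induct)
  case zero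
  \<comment> \<open>The ring laws are still being established, so annihilation by zero is drawn from
    distributivity and cancellation.\<close>
  have z: "\<zero>\<^bsub>RH\<^esub> \<otimes>\<^bsub>RH\<^esub> u = \<zero>\<^bsub>RH\<^esub>" if "u \<in> carrier RH" for u
    using RH_l_distr[of "\<zero>\<^bsub>RH\<^esub>" "\<zero>\<^bsub>RH\<^esub>" u] that RH_mult_closed[of "\<zero>\<^bsub>RH\<^esub>" u] by simp
  show ?case using f' f'' RH_mult_closed z by simp
next
  case (add f1 f2)
  then show ?case using f' f'' by (simp add: RH_l_distr RH_mult_closed)
next
  case m1: (single g r a)
  note c1 = single_closed[OF m1(3)]
  have z: "u \<otimes>\<^bsub>RH\<^esub> \<zero>\<^bsub>RH\<^esub> = \<zero>\<^bsub>RH\<^esub>" if "u \<in> carrier RH" for u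
    using RH_r_distr[of "\<zero>\<^bsub>RH\<^esub>" "\<zero>\<^bsub>RH\<^esub>" u] that RH_mult_closed[of u "\<zero>\<^bsub>RH\<^esub>"] by simp
  have z': "\<zero>\<^bsub>RH\<^esub> \<otimes>\<^bsub>RH\<^esub> u = \<zero>\<^bsub>RH\<^esub>" if "u \<in> carrier RH" for u
    using RH_l_distr[of "\<zero>\<^bsub>RH\<^esub>" "\<zero>\<^bsub>RH\<^esub>" u] that RH_mult_closed[of "\<zero>\<^bsub>RH\<^esub>" u] by simp
  show ?case
    using f'
  proof (induction rule: group_ring_induct)
    case zero
    then show ?case using c1 f'' z z' by simp
  next
    case (add f1 f2)
    then show ?case using c1 f'' by (simp add: RH_l_distr RH_r_distr RH_mult_closed)
  next
    case m2: (single h s b)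
    note c2 = single_closed[OF m2(3)]
    show ?case
      using f''
    proof (induction rule: group_ring_induct)
      case zero
      then show ?case using c1 c2 z RH_mult_closed by simp
    next
      case (add f1 f2)
      then show ?case using c1 c2 by (simp add: RH_r_distr RH_mult_closed)
    next
      case m3: (single k t c)
      have st: "s \<otimes>\<^bsub>R\<^esub> t \<in> grd (h \<otimes>\<^bsub>G\<^esub> k)" using comp_mult m2 m3 by blast
      have ab: "inv\<^bsub>G\<^esub> h \<otimes>\<^bsub>G\<^esub> a \<otimes>\<^bsub>G\<^esub> h \<otimes>\<^bsub>G\<^esub> b \<in> H" "inv\<^bsub>G\<^esub> k \<otimes>\<^bsub>G\<^esub> b \<otimes>\<^bsub>G\<^esub> k \<otimes>\<^bsub>G\<^esub> c \<in> H"
        using conj_mem m1 m2 m3 by auto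
      have eq: "inv\<^bsub>G\<^esub> k \<otimes>\<^bsub>G\<^esub> (inv\<^bsub>G\<^esub> h \<otimes>\<^bsub>G\<^esub> a \<otimes>\<^bsub>G\<^esub> h \<otimes>\<^bsub>G\<^esub> b) \<otimes>\<^bsub>G\<^esub> k \<otimes>\<^bsub>G\<^esub> c =
          inv\<^bsub>G\<^esub> (h \<otimes>\<^bsub>G\<^esub> k) \<otimes>\<^bsub>G\<^esub> a \<otimes>\<^bsub>G\<^esub> (h \<otimes>\<^bsub>G\<^esub> k) \<otimes>\<^bsub>G\<^esub> (inv\<^bsub>G\<^esub> k \<otimes>\<^bsub>G\<^esub> b \<otimes>\<^bsub>G\<^esub> k \<otimes>\<^bsub>G\<^esub> c)"
      proof -
        have "a \<in> carrier G" "b \<in> carrier G" "c \<in> carrier G" "h \<in> carrier G" "k \<in> carrier G"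
          using m1 m2 m3 mem_carrier by auto
        then have "k \<otimes>\<^bsub>G\<^esub> (inv\<^bsub>G\<^esub> k \<otimes>\<^bsub>G\<^esub> (b \<otimes>\<^bsub>G\<^esub> (k \<otimes>\<^bsub>G\<^esub> c))) = b \<otimes>\<^bsub>G\<^esub> (k \<otimes>\<^bsub>G\<^esub> c)"
          by (simp add: grp.m_assoc[symmetric])
        then show ?thesis
          using \<open>a \<in> carrier G\<close> \<open>b \<in> carrier G\<close> \<open>c \<in> carrier G\<close> \<open>h \<in> carrier G\<close> \<open>k \<in> carrier G\<close>
          by (simp add: grp.m_assoc grp.inv_mult_group)
      qed
      have "single r a \<otimes>\<^bsub>RH\<^esub> single s b \<otimes>\<^bsub>RH\<^esub> single t c =
          single (r \<otimes>\<^bsub>R\<^esub> s \<otimes>\<^bsub>R\<^esub> t) (inv\<^bsub>G\<^esub> k \<otimes>\<^bsub>G\<^esub> (inv\<^bsub>G\<^esub> h \<otimes>\<^bsub>G\<^esub> a \<otimes>\<^bsub>G\<^esub> h \<otimes>\<^bsub>G\<^esub> b) \<otimes>\<^bsub>G\<^esub> k \<otimes>\<^bsub>G\<^esub> c)"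
        using m1 m2 m3 ab by (simp add: single_mult)
      moreover have "single r a \<otimes>\<^bsub>RH\<^esub> (single s b \<otimes>\<^bsub>RH\<^esub> single t c) =
          single (r \<otimes>\<^bsub>R\<^esub> (s \<otimes>\<^bsub>R\<^esub> t))
            (inv\<^bsub>G\<^esub> (h \<otimes>\<^bsub>G\<^esub> k) \<otimes>\<^bsub>G\<^esub> a \<otimes>\<^bsub>G\<^esub> (h \<otimes>\<^bsub>G\<^esub> k) \<otimes>\<^bsub>G\<^esub> (inv\<^bsub>G\<^esub> k \<otimes>\<^bsub>G\<^esub> b \<otimes>\<^bsub>G\<^esub> k \<otimes>\<^bsub>G\<^esub> c))"
        using m1 m2 m3 ab st by (simp add: single_mult)
      ultimately show ?case
        using eq m1 m2 m3 by (simp add: rng.m_assoc)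
    qed
  qed
qed

lemma RH_one_closed: "\<one>\<^bsub>RH\<^esub> \<in> carrier RH"
  by (simp add: RH_one single_closed)

lemma RH_l_one:
  assumes "f \<in> carrier RH"
  shows "\<one>\<^bsub>RH\<^esub> \<otimes>\<^bsub>RH\<^esub> f = f"
  using assms
proof (induction rule: group_ring_induct)
  case zero
  show ?case
    using RH_r_distr[of "\<zero>\<^bsub>RH\<^esub>" "\<zero>\<^bsub>RH\<^esub>" "\<one>\<^bsub>RH\<^esub>"] RH_mult_closed[OF RH_one_closed, of "\<zero>\<^bsub>RH\<^esub>"] RH_one_closed
    by simp
next
  case (single g r a)
  then show ?case using single_mult[of "\<one>\<^bsub>R\<^esub>" g r "\<one>\<^bsub>G\<^esub>" a] mem_carrier by (simp add: RH_one)
next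
  case (add f f')
  then show ?case by (simp add: RH_r_distr RH_one_closed)
qed

text \<open>Unlike for the left unit, where the conjugated element is trivial, here \<open>a\<close>
  is conjugated by the degree of \<open>1\<close>; \<open>one_mem_comp\<close> makes that degree the
  identity.\<close>

lemma RH_r_one:
  assumes "f \<in> carrier RH"
  shows "f \<otimes>\<^bsub>RH\<^esub> \<one>\<^bsub>RH\<^esub> = f"
  using assms
proof (induction rule: group_ring_induct)
  case zero
  show ?case
    using RH_l_distr[of "\<zero>\<^bsub>RH\<^esub>" "\<zero>\<^bsub>RH\<^esub>" "\<one>\<^bsub>RH\<^esub>"] RH_mult_closed[of "\<zero>\<^bsub>RH\<^esub>", OF _ RH_one_closed] RH_one_closed
    by simp
next
  case (single g r a)
  then show ?case
    using single_mult[of r "\<one>\<^bsub>G\<^esub>" "\<one>\<^bsub>R\<^esub>" a "\<one>\<^bsub>G\<^esub>"] mem_carrier one_mem_comp by (simp add: RH_one)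
next
  case (add f f')
  then show ?case by (simp add: RH_l_distr RH_one_closed)
qed

lemma RH_ring: "ring RH"
proof (rule ringI)
  show "Group.monoid RH"
    by (rule monoidI)
      (simp_all add: RH_mult_closed RH_one_closed RH_assoc RH_l_one RH_r_one)
qed (simp_all add: RH_abelian_group RH_l_distr RH_r_distr)

sublocale RHr: ring RH
  by (rule RH_ring)

section \<open>Faithful action on functions from \<open>G\<close> to \<open>R\<close>\<close>

text \<open>A pair \<open>(a, h)\<close> indexes the homogeneous monomial of degree \<open>h\<close>
  at \<open>a\<close>, which goes to the group element \<open>h a\<close> of \<open>RG\<close>;
  several pairs may go to the same element.\<close>

definition coeff_support :: "('g \<Rightarrow> 'a) \<Rightarrow> ('g \<times> 'g) set"
  where "coeff_support f = {(a, h). a \<in> H \<and> h \<in> carrier G \<and> hc (f a) h \<noteq> \<zero>\<^bsub>R\<^esub>}"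

text \<open>The action of \<open>R[H]\<close> on functions from \<open>G\<close> to \<open>R\<close> through its embedding into \<open>RG\<close>.\<close>

definition act :: "('g \<Rightarrow> 'a) \<Rightarrow> ('g \<Rightarrow> 'a) \<Rightarrow> 'g \<Rightarrow> 'a"
  where "act f F x = (\<Oplus>\<^bsub>R\<^esub>i\<in>coeff_support f.
    hc (f (fst i)) (snd i) \<otimes>\<^bsub>R\<^esub> F (inv\<^bsub>G\<^esub> (snd i \<otimes>\<^bsub>G\<^esub> fst i) \<otimes>\<^bsub>G\<^esub> x))"

lemma finite_coeff_support:
  assumes f: "f \<in> carrier RH"
  shows "finite (coeff_support f)"
proof -
  have "coeff_support f \<subseteq> (SIGMA a : {a \<in> H. f a \<noteq> \<zero>\<^bsub>R\<^esub>}. graded_support G R (hc (f a)))"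
    using hcomponent_zero by (auto simp: coeff_support_def graded_support_def)
  moreover have "finite (SIGMA a : {a \<in> H. f a \<noteq> \<zero>\<^bsub>R\<^esub>}. graded_support G R (hc (f a)))"
    using RH_finite[OF f] RH_closed[OF f] finite_graded_support by (intro finite_SigmaI) auto
  ultimately show ?thesis by (rule finite_subset)
qed

lemma act_eq:
  assumes f: "f \<in> carrier RH" and F: "F \<in> carrier G \<rightarrow> carrier R" and x: "x \<in> carrier G"
    and J: "finite J" "coeff_support f \<subseteq> J" "J \<subseteq> H \<times> carrier G"
  shows "act f F x = (\<Oplus>\<^bsub>R\<^esub>i\<in>J.
    hc (f (fst i)) (snd i) \<otimes>\<^bsub>R\<^esub> F (inv\<^bsub>G\<^esub> (snd i \<otimes>\<^bsub>G\<^esub> fst i) \<otimes>\<^bsub>G\<^esub> x))"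
proof -
  have Fc: "F y \<in> carrier R" if "y \<in> carrier G" for y using F that by auto
  have J': "fst i \<in> H" "fst i \<in> carrier G" "snd i \<in> carrier G" if "i \<in> J" for i
    using J(3) that mem_carrier by auto
  show ?thesis
    unfolding act_def
  proof (rule rng.finsum_mono_neutral[OF J(1,2)])
    fix i assume i: "i \<in> J - coeff_support f"
    then have "hc (f (fst i)) (snd i) = \<zero>\<^bsub>R\<^esub>"
      using J' by (auto simp: coeff_support_def split: prod.splits)
    then show "hc (f (fst i)) (snd i) \<otimes>\<^bsub>R\<^esub> F (inv\<^bsub>G\<^esub> (snd i \<otimes>\<^bsub>G\<^esub> fst i) \<otimes>\<^bsub>G\<^esub> x) = \<zero>\<^bsub>R\<^esub>"
      using i J' Fc x by simp
  next
    fix i assume "i \<in> coeff_support f"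
    then have "i \<in> J" using J(2) by blast
    then show "hc (f (fst i)) (snd i) \<otimes>\<^bsub>R\<^esub> F (inv\<^bsub>G\<^esub> (snd i \<otimes>\<^bsub>G\<^esub> fst i) \<otimes>\<^bsub>G\<^esub> x) \<in> carrier R"
      using J' Fc x hcomponent_closed RH_closed[OF f] by simp
  qed
qed

lemma coeff_support_subset: "coeff_support f \<subseteq> H \<times> carrier G"
  by (auto simp: coeff_support_def)

lemma act_closed:
  assumes f: "f \<in> carrier RH" and F: "F \<in> carrier G \<rightarrow> carrier R"
  shows "act f F \<in> carrier G \<rightarrow> carrier R"
proof
  fix x assume x: "x \<in> carrier G"
  have Fc: "F y \<in> carrier R" if "y \<in> carrier G" for y using F that by auto
  have "fst i \<in> H" "fst i \<in> carrier G" "snd i \<in> carrier G" if "i \<in> coeff_support f" for i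
    using coeff_support_subset that mem_carrier by fastforce+
  then show "act f F x \<in> carrier R"
    unfolding act_def using Fc x hcomponent_closed RH_closed[OF f] by (intro rng.finsum_closed) auto
qed

lemma act_add:
  assumes f: "f \<in> carrier RH" and f': "f' \<in> carrier RH"
    and F: "F \<in> carrier G \<rightarrow> carrier R" and x: "x \<in> carrier G"
  shows "act (f \<oplus>\<^bsub>RH\<^esub> f') F x = act f F x \<oplus>\<^bsub>R\<^esub> act f' F x"
proof -
  have Fc: "F y \<in> carrier R" if "y \<in> carrier G" for y using F that by auto
  define J where "J = coeff_support f \<union> coeff_support f' \<union> coeff_support (f \<oplus>\<^bsub>RH\<^esub> f')"
  have J: "finite J" "J \<subseteq> H \<times> carrier G"
    using finite_coeff_support f f' coeff_support_subset RH_add_closed unfolding J_def by auto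
  have J': "fst i \<in> H" "fst i \<in> carrier G" "snd i \<in> carrier G" if "i \<in> J" for i
    using J(2) that mem_carrier by auto
  have sub: "coeff_support f \<subseteq> J" "coeff_support f' \<subseteq> J" by (auto simp: J_def)
  let ?F = "\<lambda>i. F (inv\<^bsub>G\<^esub> (snd i \<otimes>\<^bsub>G\<^esub> fst i) \<otimes>\<^bsub>G\<^esub> x)"
  have "act (f \<oplus>\<^bsub>RH\<^esub> f') F x = (\<Oplus>\<^bsub>R\<^esub>i\<in>J. hc ((f \<oplus>\<^bsub>RH\<^esub> f') (fst i)) (snd i) \<otimes>\<^bsub>R\<^esub> ?F i)"
    using f f' J F x by (intro act_eq) (auto simp: J_def RH_add_closed)
  also have "\<dots> = (\<Oplus>\<^bsub>R\<^esub>i\<in>J. hc (f (fst i)) (snd i) \<otimes>\<^bsub>R\<^esub> ?F i \<oplus>\<^bsub>R\<^esub> hc (f' (fst i)) (snd i) \<otimes>\<^bsub>R\<^esub> ?F i)"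
    using J' Fc x f f' RH_closed hcomponent_closed
    by (intro rng.finsum_cong') (auto simp: RH_add hcomponent_add rng.l_distr)
  also have "\<dots> = (\<Oplus>\<^bsub>R\<^esub>i\<in>J. hc (f (fst i)) (snd i) \<otimes>\<^bsub>R\<^esub> ?F i) \<oplus>\<^bsub>R\<^esub>
      (\<Oplus>\<^bsub>R\<^esub>i\<in>J. hc (f' (fst i)) (snd i) \<otimes>\<^bsub>R\<^esub> ?F i)"
    using J' Fc x f f' RH_closed hcomponent_closed by (intro rng.finsum_addf) auto
  also have "\<dots> = act f F x \<oplus>\<^bsub>R\<^esub> act f' F x"
    using act_eq[OF f F x J(1) _ J(2)] act_eq[OF f' F x J(1) _ J(2)] sub by simp
  finally show ?thesis .
qed

lemma act_mono:
  assumes g: "g \<in> carrier G" and r: "r \<in> grd g" and a: "a \<in> H"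
    and F: "F \<in> carrier G \<rightarrow> carrier R" and x: "x \<in> carrier G"
  shows "act (single r a) F x = r \<otimes>\<^bsub>R\<^esub> F (inv\<^bsub>G\<^esub> (g \<otimes>\<^bsub>G\<^esub> a) \<otimes>\<^bsub>G\<^esub> x)"
proof -
  have rc: "r \<in> carrier R" using r g comp_closed by blast
  have Fc: "F (inv\<^bsub>G\<^esub> (g \<otimes>\<^bsub>G\<^esub> a) \<otimes>\<^bsub>G\<^esub> x) \<in> carrier R" using F g a x mem_carrier by auto
  have "act (single r a) F x = (\<Oplus>\<^bsub>R\<^esub>i\<in>{(a, g)}.
      hc (single r a (fst i)) (snd i) \<otimes>\<^bsub>R\<^esub> F (inv\<^bsub>G\<^esub> (snd i \<otimes>\<^bsub>G\<^esub> fst i) \<otimes>\<^bsub>G\<^esub> x))"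
  proof (rule act_eq[OF single_closed[OF rc] F x])
    show "coeff_support (single r a) \<subseteq> {(a, g)}"
      using g r
      by (auto simp: coeff_support_def single_apply hcomponent_zero hcomponent_homogeneous split: if_splits)
  qed (use a g in auto)
  then show ?thesis
    using a g r rc Fc by (simp add: single_apply hcomponent_homogeneous)
qed

lemma act_zero:
  assumes "F \<in> carrier G \<rightarrow> carrier R" "x \<in> carrier G"
  shows "act \<zero>\<^bsub>RH\<^esub> F x = \<zero>\<^bsub>R\<^esub>"
  using act_eq[of "\<zero>\<^bsub>RH\<^esub>" F x "{}"] assms
  by (auto simp: coeff_support_def RH_zero hcomponent_zero)

text \<open>The twist is tailored to this: for degrees \<open>g\<close>, \<open>h\<close> one has
  \<open>(g h) (h^-1 a h b) = (g a) (h b)\<close>, so that \<open>r a \<mapsto> r (g a)\<close> is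
  multiplicative. Fixing a monomial on the left turns the claim into one that is additive in
  \<open>f'\<close>.\<close>

lemma act_mult:
  assumes f: "f \<in> carrier RH" and f': "f' \<in> carrier RH"
    and F: "F \<in> carrier G \<rightarrow> carrier R" and x: "x \<in> carrier G"
  shows "act (f \<otimes>\<^bsub>RH\<^esub> f') F x = act f (act f' F) x"
  using f
proof (induction rule: group_ring_induct)
  case zero
  then show ?case using f' F x act_closed by (simp add: act_zero)
next
  case (add f1 f2)
  then show ?case using f' F x act_closed by (simp add: RH_l_distr act_add RH_mult_closed)
next
  case m1: (single g r a)
  define y where "y = inv\<^bsub>G\<^esub> (g \<otimes>\<^bsub>G\<^esub> a) \<otimes>\<^bsub>G\<^esub> x"
  have y: "y \<in> carrier G" using m1 x mem_carrier by (simp add: y_def)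
  have "act (single r a \<otimes>\<^bsub>RH\<^esub> f') F x = r \<otimes>\<^bsub>R\<^esub> act f' F y"
    using f'
  proof (induction rule: group_ring_induct)
    case zero
    then show ?case using m1 F x y by (simp add: act_zero single_closed)
  next
    case (add f1 f2)
    have "act f1 F y \<in> carrier R" "act f2 F y \<in> carrier R"
      using act_closed[OF _ F] add y by auto
    then show ?case
      using add m1 F x y by (simp add: RH_r_distr act_add RH_mult_closed single_closed rng.r_distr)
  next
    case m2: (single h s b)
    have car: "a \<in> carrier G" "b \<in> carrier G" using m1 m2 mem_carrier by auto
    have ab: "inv\<^bsub>G\<^esub> h \<otimes>\<^bsub>G\<^esub> a \<otimes>\<^bsub>G\<^esub> h \<otimes>\<^bsub>G\<^esub> b \<in> H" using conj_mem m1 m2 by auto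
    have rs: "r \<otimes>\<^bsub>R\<^esub> s \<in> grd (g \<otimes>\<^bsub>G\<^esub> h)" using comp_mult m1 m2 by blast
    have "g \<otimes>\<^bsub>G\<^esub> h \<otimes>\<^bsub>G\<^esub> (inv\<^bsub>G\<^esub> h \<otimes>\<^bsub>G\<^esub> a \<otimes>\<^bsub>G\<^esub> h \<otimes>\<^bsub>G\<^esub> b) =
        g \<otimes>\<^bsub>G\<^esub> (h \<otimes>\<^bsub>G\<^esub> inv\<^bsub>G\<^esub> h) \<otimes>\<^bsub>G\<^esub> a \<otimes>\<^bsub>G\<^esub> h \<otimes>\<^bsub>G\<^esub> b"
      using m1(1) m2(1) car by (simp only: grp.m_assoc grp.m_closed grp.inv_closed)
    also have "\<dots> = g \<otimes>\<^bsub>G\<^esub> a \<otimes>\<^bsub>G\<^esub> (h \<otimes>\<^bsub>G\<^esub> b)"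
      using m1(1) m2(1) car by (simp add: grp.m_assoc)
    finally have eq: "inv\<^bsub>G\<^esub> (g \<otimes>\<^bsub>G\<^esub> h \<otimes>\<^bsub>G\<^esub> (inv\<^bsub>G\<^esub> h \<otimes>\<^bsub>G\<^esub> a \<otimes>\<^bsub>G\<^esub> h \<otimes>\<^bsub>G\<^esub> b)) \<otimes>\<^bsub>G\<^esub> x =
        inv\<^bsub>G\<^esub> (h \<otimes>\<^bsub>G\<^esub> b) \<otimes>\<^bsub>G\<^esub> y"
      using m1(1) m2(1) car x by (simp add: y_def grp.inv_mult_group grp.m_assoc)
    have "inv\<^bsub>G\<^esub> (h \<otimes>\<^bsub>G\<^esub> b) \<otimes>\<^bsub>G\<^esub> y \<in> carrier G"
      using m2 car y by simp
    then have Fc: "F (inv\<^bsub>G\<^esub> (h \<otimes>\<^bsub>G\<^esub> b) \<otimes>\<^bsub>G\<^esub> y) \<in> carrier R" using F by blast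
    have "act (single r a \<otimes>\<^bsub>RH\<^esub> single s b) F x =
        (r \<otimes>\<^bsub>R\<^esub> s) \<otimes>\<^bsub>R\<^esub> F (inv\<^bsub>G\<^esub> (h \<otimes>\<^bsub>G\<^esub> b) \<otimes>\<^bsub>G\<^esub> y)"
      using act_mono[OF _ rs ab F x] m1 m2 eq by (simp add: single_mult)
    then show ?case
      using act_mono[OF m2(1,2,4) F y] m1 m2 Fc by (simp add: rng.m_assoc)
  qed
  then show ?case
    using act_mono[OF m1(1,2,4) act_closed[OF f' F] x] by (simp add: y_def)
qed

text \<open>Applied to the delta function at the identity, \<open>f\<close> returns at
  \<open>x\<close> the coefficient of \<open>x\<close> in its image in \<open>RG\<close>, to which
  every \<open>a\<close> contributes the component of \<open>f a\<close> of degree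
  \<open>x a^-1\<close>. These degrees are distinct for distinct \<open>a\<close>, so the grading of
  \<open>R\<close> separates the contributions.\<close>

lemma act_delta:
  assumes f: "f \<in> carrier RH" and x: "x \<in> carrier G" and a: "a \<in> H"
  shows "hc (act f (\<lambda>y. if y = \<one>\<^bsub>G\<^esub> then \<one>\<^bsub>R\<^esub> else \<zero>\<^bsub>R\<^esub>) x) (x \<otimes>\<^bsub>G\<^esub> inv\<^bsub>G\<^esub> a) =
    hc (f a) (x \<otimes>\<^bsub>G\<^esub> inv\<^bsub>G\<^esub> a)"
    (is "hc (act _ ?\<delta> _) _ = _")
  using f
proof (induction rule: group_ring_induct)
  have \<delta>: "?\<delta> \<in> carrier G \<rightarrow> carrier R" by simp
  have ac: "a \<in> carrier G" using a mem_carrier by blast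
  have xa: "x \<otimes>\<^bsub>G\<^esub> inv\<^bsub>G\<^esub> a \<in> carrier G" using x ac by simp
  {
    case zero
    show ?case using x a by (simp add: act_zero RH_zero)
  next
    case (add f1 f2)
    have "act f1 ?\<delta> x \<in> carrier R" "act f2 ?\<delta> x \<in> carrier R"
      using act_closed[OF _ \<delta>] add x by auto
    then show ?case
      using add x a xa \<delta> RH_closed by (simp add: act_add RH_add hcomponent_add)
  next
    case (single g r b)
    have bc: "b \<in> carrier G" using single mem_carrier by blast
    have "inv\<^bsub>G\<^esub> (g \<otimes>\<^bsub>G\<^esub> b) \<otimes>\<^bsub>G\<^esub> x = \<one>\<^bsub>G\<^esub> \<longleftrightarrow> x = g \<otimes>\<^bsub>G\<^esub> b"
      using single bc x by (metis grp.inv_closed grp.inv_equality grp.inv_inv grp.l_inv grp.m_closed)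
    then have "act (single r b) ?\<delta> x = (if x = g \<otimes>\<^bsub>G\<^esub> b then r else \<zero>\<^bsub>R\<^esub>)"
      using act_mono[OF single(1,2,4) \<delta> x] single(3) by simp
    moreover have "x \<otimes>\<^bsub>G\<^esub> inv\<^bsub>G\<^esub> a = g \<longleftrightarrow> x = g \<otimes>\<^bsub>G\<^esub> a"
      using single ac x by (metis grp.inv_solve_right)
    moreover have "g \<otimes>\<^bsub>G\<^esub> b = g \<otimes>\<^bsub>G\<^esub> a \<longleftrightarrow> b = a"
      using single bc ac by simp
    moreover define z where "z = x \<otimes>\<^bsub>G\<^esub> inv\<^bsub>G\<^esub> a"
    ultimately show ?case
      using hcomponent_homogeneous[OF single(1,2) xa] hcomponent_zero[OF xa] a
      unfolding z_def[symmetric] by (cases "b = a") (simp_all add: single_apply)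
  }
qed

lemma act_faithful:
  assumes f: "f \<in> carrier RH"
    and zero: "\<And>F x. \<lbrakk>F \<in> carrier G \<rightarrow> carrier R; x \<in> carrier G\<rbrakk> \<Longrightarrow> act f F x = \<zero>\<^bsub>R\<^esub>"
  shows "f = \<zero>\<^bsub>RH\<^esub>"
proof (rule extensionalityI[of _ H])
  fix a assume a: "a \<in> H"
  then have ac: "a \<in> carrier G" using mem_carrier by blast
  have "hc (f a) h = \<zero>\<^bsub>R\<^esub>" if h: "h \<in> carrier G" for h
    using act_delta[OF f _ a, of "h \<otimes>\<^bsub>G\<^esub> a"] h ac
    by (simp add: zero grp.m_assoc hcomponent_zero)
  from eq_zero_if_hcomponent_zero[OF RH_closed[OF f a] this] have "f a = \<zero>\<^bsub>R\<^esub>" .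
  then show "f a = \<zero>\<^bsub>RH\<^esub> a" using a by (simp add: RH_zero)
qed (use f in \<open>auto intro: RH_extensional\<close>)

section \<open>The augmentation homomorphism\<close>

definition aug :: "('g \<Rightarrow> 'a) \<Rightarrow> 'a"
  where "aug f = (\<Oplus>\<^bsub>R\<^esub>a\<in>{a \<in> H. f a \<noteq> \<zero>\<^bsub>R\<^esub>}. f a)"

lemma aug_eq:
  assumes "f \<in> carrier RH" "finite A" "{a \<in> H. f a \<noteq> \<zero>\<^bsub>R\<^esub>} \<subseteq> A" "A \<subseteq> H"
  shows "aug f = (\<Oplus>\<^bsub>R\<^esub>a\<in>A. f a)"
  unfolding aug_def using assms RH_closed by (intro rng.finsum_mono_neutral) auto

lemma aug_closed: "f \<in> carrier RH \<Longrightarrow> aug f \<in> carrier R"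
  unfolding aug_def using RH_closed by (intro rng.finsum_closed) auto

lemma aug_add:
  assumes f: "f \<in> carrier RH" and f': "f' \<in> carrier RH"
  shows "aug (f \<oplus>\<^bsub>RH\<^esub> f') = aug f \<oplus>\<^bsub>R\<^esub> aug f'"
proof -
  define A where "A = {a \<in> H. f a \<noteq> \<zero>\<^bsub>R\<^esub>} \<union> {a \<in> H. f' a \<noteq> \<zero>\<^bsub>R\<^esub>}"
  have A: "finite A" "A \<subseteq> H" "{a \<in> H. f a \<noteq> \<zero>\<^bsub>R\<^esub>} \<subseteq> A" "{a \<in> H. f' a \<noteq> \<zero>\<^bsub>R\<^esub>} \<subseteq> A"
    "{a \<in> H. (f \<oplus>\<^bsub>RH\<^esub> f') a \<noteq> \<zero>\<^bsub>R\<^esub>} \<subseteq> A"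
    using RH_finite[OF f] RH_finite[OF f'] RH_closed[OF f] RH_closed[OF f']
    by (auto simp: A_def RH_add)
  have "aug (f \<oplus>\<^bsub>RH\<^esub> f') = (\<Oplus>\<^bsub>R\<^esub>a\<in>A. (f \<oplus>\<^bsub>RH\<^esub> f') a)"
    using A f f' by (intro aug_eq) (auto simp: RH_add_closed)
  also have "\<dots> = (\<Oplus>\<^bsub>R\<^esub>a\<in>A. f a \<oplus>\<^bsub>R\<^esub> f' a)"
    using A(2) RH_closed f f' by (intro rng.finsum_cong') (auto simp: RH_add subset_iff)
  also have "\<dots> = (\<Oplus>\<^bsub>R\<^esub>a\<in>A. f a) \<oplus>\<^bsub>R\<^esub> (\<Oplus>\<^bsub>R\<^esub>a\<in>A. f' a)"
    using A(2) RH_closed f f' by (intro rng.finsum_addf) auto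
  finally show ?thesis
    using aug_eq[OF f A(1,3,2)] aug_eq[OF f' A(1,4,2)] by simp
qed

lemma aug_mono:
  assumes "r \<in> carrier R" "a \<in> H"
  shows "aug (single r a) = r"
proof -
  have "{b \<in> H. single r a b \<noteq> \<zero>\<^bsub>R\<^esub>} \<subseteq> {a}" by (auto simp: single_apply split: if_splits)
  then show ?thesis
    using aug_eq[OF single_closed[OF assms(1)], of "{a}" a] assms by (simp add: single_apply)
qed

lemma aug_zero: "aug \<zero>\<^bsub>RH\<^esub> = \<zero>\<^bsub>R\<^esub>"
  using aug_mono[of "\<zero>\<^bsub>R\<^esub>" "\<one>\<^bsub>G\<^esub>"] by (simp add: single_zero)

text \<open>The twist affects only the group element of a product of monomials, which the
  augmentation forgets.\<close>

lemma aug_mult: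
  assumes f: "f \<in> carrier RH" and f': "f' \<in> carrier RH"
  shows "aug (f \<otimes>\<^bsub>RH\<^esub> f') = aug f \<otimes>\<^bsub>R\<^esub> aug f'"
  using f
proof (induction rule: group_ring_induct)
  case zero
  then show ?case using f' by (simp add: aug_zero aug_closed)
next
  case (add f1 f2)
  then show ?case using f' by (simp add: RH_l_distr aug_add RH_mult_closed aug_closed rng.l_distr)
next
  case m1: (single g r a)
  show ?case
    using f'
  proof (induction rule: group_ring_induct)
    case zero
    then show ?case using m1 by (simp add: aug_zero aug_closed single_closed)
  next
    case (add f1 f2)
    then show ?case
      using m1 by (simp add: RH_r_distr aug_add RH_mult_closed aug_closed single_closed rng.r_distr)
  next
    case m2: (single h s b)
    then show ?case
      using m1 conj_mem[OF m2(1) m1(4)] by (simp add: single_mult aug_mono)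
  qed
qed

lemma aug_pow: "f \<in> carrier RH \<Longrightarrow> aug (f [^]\<^bsub>RH\<^esub> (n::nat)) = aug f [^]\<^bsub>R\<^esub> n"
  by (induction n) (simp_all add: aug_mult RH_one aug_mono)

text \<open>Constant functions are invariant under translation. This identifies the augmentation on
  \<open>R[H]\<close> with the sum of the coefficients of the image in \<open>RG\<close>.\<close>

lemma act_one:
  assumes f: "f \<in> carrier RH" and x: "x \<in> carrier G"
  shows "act f (\<lambda>y. \<one>\<^bsub>R\<^esub>) x = aug f"
  using f
proof (induction rule: group_ring_induct)
  case zero
  then show ?case using x by (simp add: act_zero aug_zero)
next
  case (single g r a)
  then show ?case using x by (simp add: act_mono aug_mono)
next
  case (add f f')
  then show ?case using x by (simp add: act_add aug_add)
qed

lemma act_pow: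
  assumes f: "f \<in> carrier RH" and "F \<in> carrier G \<rightarrow> carrier R" and x: "x \<in> carrier G"
  shows "act (f [^]\<^bsub>RH\<^esub> n) F x = (act f ^^ n) F x"
  using assms(2)
proof (induction n arbitrary: F)
  case 0
  then have "F x \<in> carrier R" using x by blast
  then show ?case
    using act_mono[OF grp.one_closed one_mem_comp one_closed 0 x] x by (simp add: RH_one)
next
  case (Suc n)
  then show ?case
    using f x by (simp add: act_mult act_closed funpow_swap1)
qed

end

section \<open>The coset grading\<close>

text \<open>Supplies the exponent of the modulus \<open>p ^ k\<close> in the fixed-point series:
  \<open>(p 1)^k = p^k 1\<close>, and what kills \<open>1\<close> kills \<open>R\<close>.\<close>

lemma (in ring) prime_nilpotent_char:
  assumes "[p] \<cdot> \<one> \<in> nilpotent_elements R"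
  shows "\<exists>k. \<forall>r\<in>carrier R. [((p::nat) ^ k)] \<cdot> r = \<zero>"
proof -
  obtain k :: nat where k: "([p] \<cdot> \<one>) [^] k = \<zero>"
    using assms by (auto simp: nilpotent_elements_def)
  have "([p] \<cdot> \<one>) [^] j = [(p ^ j)] \<cdot> \<one>" for j :: nat
  proof (induction j)
    case (Suc j)
    have "([p] \<cdot> \<one>) [^] Suc j = [(p ^ j)] \<cdot> ([p] \<cdot> \<one>)"
      using Suc by (simp add: add_pow_ldistr)
    also have "\<dots> = [(p * p ^ j)] \<cdot> \<one>"
      by (rule add.nat_pow_pow) simp
    finally show ?case by simp
  qed simp
  then have z: "[(p ^ k)] \<cdot> \<one> = \<zero>" using k by simp
  have "[(p ^ k)] \<cdot> r = \<zero>" if r: "r \<in> carrier R" for r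
  proof -
    have "[(p ^ k)] \<cdot> r = ([(p ^ k)] \<cdot> \<one>) \<otimes> r"
      using r by (simp add: add_pow_ldistr)
    then show ?thesis using z r by simp
  qed
  then show ?thesis by blast
qed

lemma finite_subgroup_of_p_group:
  fixes G (structure)
  assumes p: "Factorial_Ring.prime p" and G: "p_group p G" and K: "subgroup K G" and fin: "finite K"
  shows "\<exists>n. card K = p ^ n"
proof -
  interpret group G using G by (simp add: p_group_def)
  interpret KK: group "G\<lparr>carrier := K\<rparr>"
    using K is_group by (rule subgroup.subgroup_is_group)
  have "\<exists>n. order (G\<lparr>carrier := K\<rparr>) = p ^ n"
  proof (rule KK.order_eq_prime_power[OF p])
    fix x assume "x \<in> carrier (G\<lparr>carrier := K\<rparr>)"
    then have x: "x \<in> carrier G" using K subgroup.mem_carrier by fastforce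
    then obtain k where "ord x = p ^ k" using G by (auto simp: p_group_def)
    then have "x [^] (p ^ k) = \<one>" using pow_ord_eq_1[OF x] by simp
    then show "\<exists>k. x [^]\<^bsub>G\<lparr>carrier := K\<rparr>\<^esub> (p ^ k) = \<one>\<^bsub>G\<lparr>carrier := K\<rparr>\<^esub>"
      by (auto simp flip: nat_pow_consistent)
  qed (use fin in simp)
  then show ?thesis by (simp add: order_def)
qed

context twisted_group_ring
begin

text \<open>Finitely many group elements \<open>h a\<close> occur in the image of \<open>z\<close>
  in \<open>RG\<close>, so they generate a finite group \<open>K\<close> of \<open>p\<close>-power
  order. A power of \<open>act z\<close> then vanishes on all functions, and faithfulness brings
  this back to \<open>z\<close>. The exponent depends on \<open>z\<close> through \<open>K\<close>,
  so the ideal is shown to be nil, not nilpotent.\<close>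

lemma nilpotent_if_aug_zero:
  assumes lf: "locally_finite_group G" and pG: "p_group p G" and p: "Factorial_Ring.prime p"
    and char: "[p] \<cdot>\<^bsub>R\<^esub> \<one>\<^bsub>R\<^esub> \<in> nilpotent_elements R"
    and z: "z \<in> carrier RH" and aug: "aug z = \<zero>\<^bsub>R\<^esub>"
  shows "\<exists>m::nat. z [^]\<^bsub>RH\<^esub> m = \<zero>\<^bsub>RH\<^esub>"
proof -
  define \<gamma> where "\<gamma> i = snd i \<otimes>\<^bsub>G\<^esub> fst i" for i :: "'g \<times> 'g"
  define c where "c i = hc (z (fst i)) (snd i)" for i
  define K where "K = generate G (\<gamma> ` coeff_support z)"
  have supp: "fst i \<in> H" "fst i \<in> carrier G" "snd i \<in> carrier G" if "i \<in> coeff_support z" for i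
    using that mem_carrier by (auto simp: coeff_support_def)
  have sub: "\<gamma> ` coeff_support z \<subseteq> carrier G"
    using supp by (auto simp: \<gamma>_def)
  have K: "subgroup K G" unfolding K_def by (rule grp.generate_is_subgroup[OF sub])
  have "finite K"
    using lf sub finite_coeff_support[OF z] unfolding locally_finite_group_def K_def by blast
  then obtain n where n: "card K = p ^ n"
    using finite_subgroup_of_p_group[OF p pG K] by blast
  obtain k where k: "\<And>r. r \<in> carrier R \<Longrightarrow> [(p ^ k)] \<cdot>\<^bsub>R\<^esub> r = \<zero>\<^bsub>R\<^esub>"
    using rng.prime_nilpotent_char[OF char] by blast
  have c: "c \<in> coeff_support z \<rightarrow> carrier R"
    using supp hcomponent_closed RH_closed[OF z] by (auto simp: c_def)
  have "(\<Oplus>\<^bsub>R\<^esub>i\<in>coeff_support z. c i) = act z (\<lambda>y. \<one>\<^bsub>R\<^esub>) \<one>\<^bsub>G\<^esub>"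
    unfolding act_def c_def[symmetric] using c by (intro rng.finsum_cong') (simp_all add: Pi_iff)
  then have "(\<Oplus>\<^bsub>R\<^esub>i\<in>coeff_support z. c i) = \<zero>\<^bsub>R\<^esub>"
    using act_one[OF z grp.one_closed] aug by simp
  moreover have "\<gamma> \<in> coeff_support z \<rightarrow> K"
    by (auto simp: K_def intro: generate.incl)
  moreover have "act z F x = (\<Oplus>\<^bsub>R\<^esub>i\<in>coeff_support z. c i \<otimes>\<^bsub>R\<^esub> F (inv\<^bsub>G\<^esub> \<gamma> i \<otimes>\<^bsub>G\<^esub> x))" for F x
    by (simp add: act_def c_def \<gamma>_def)
  ultimately have "\<exists>m. \<forall>F\<in>carrier G \<rightarrow> carrier R. \<forall>x\<in>carrier G. (act z ^^ m) F x = \<zero>\<^bsub>R\<^esub>"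
    by (intro augmentation_zero_nilpotent[OF grp.is_group rng.ring_axioms K p n k
          finite_coeff_support[OF z] c])
  then obtain m where m: "\<And>F x. \<lbrakk>F \<in> carrier G \<rightarrow> carrier R; x \<in> carrier G\<rbrakk>
      \<Longrightarrow> (act z ^^ m) F x = \<zero>\<^bsub>R\<^esub>"
    by blast
  have "z [^]\<^bsub>RH\<^esub> m = \<zero>\<^bsub>RH\<^esub>"
    using z m by (intro act_faithful) (simp_all add: act_pow)
  then show ?thesis by blast
qed

section \<open>Coset components of \<open>R[H]\<close>\<close>

text \<open>The members of \<open>G Mod H\<close> are right cosets; normality rewrites them as left
  cosets, which absorb \<open>H\<close> on the right.\<close>

lemma coset_mult_H:
  assumes C: "C \<in> carrier (G Mod H)" and x: "x \<in> C" and h: "h \<in> H"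
  shows "x \<otimes>\<^bsub>G\<^esub> h \<in> C"
proof -
  obtain g where g: "g \<in> carrier G" "C = g <#\<^bsub>G\<^esub> H"
    using C coset_eq by (auto simp: FactGroup_def RCOSETS_def)
  then obtain h' where h': "h' \<in> H" "x = g \<otimes>\<^bsub>G\<^esub> h'"
    using x by (auto simp: l_coset_def)
  then have "x \<otimes>\<^bsub>G\<^esub> h = g \<otimes>\<^bsub>G\<^esub> (h' \<otimes>\<^bsub>G\<^esub> h)"
    using g h mem_carrier by (simp add: grp.m_assoc)
  then show ?thesis using g(2) h' h by (auto simp: l_coset_def)
qed

lemma coset_subset: "C \<in> carrier (G Mod H) \<Longrightarrow> C \<subseteq> carrier G"
  by (auto simp: FactGroup_def RCOSETS_def r_coset_def mem_carrier)

end

text \<open>The coset grading of \<open>R\<close> enters as a locale assumption; in the theorem it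
  is part of \<open>graded_NR_clean\<close>.\<close>

locale coset_graded_group_ring = twisted_group_ring G R grd H +
  quo: graded_ring "G Mod H" R "quotient_comp R grd"
  for G :: "('g, 'm) monoid_scheme" and R :: "('a, 'n) ring_scheme"
    and grd :: "'g \<Rightarrow> 'a set" and H :: "'g set"
begin

abbreviation Q where "Q \<equiv> quotient_comp R grd"

abbreviation RHQ where "RHQ \<equiv> quotient_comp RH (group_ring_comp G R grd H)"

lemma RHQ_pointwise_subgroup:
  assumes C: "C \<in> carrier (G Mod H)"
  shows "additive_subgroup {f \<in> carrier RH. \<forall>h\<in>H. f h \<in> Q C} RH"
proof -
  interpret Q: additive_subgroup "Q C" R by (rule quo.comp_additive_subgroup[OF C])
  show ?thesis
    unfolding additive_subgroup_def
  proof (rule RHa.add.subgroupI)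
    fix f assume "f \<in> {f \<in> carrier RH. \<forall>h\<in>H. f h \<in> Q C}"
    then have f: "f \<in> carrier RH" "\<And>h. h \<in> H \<Longrightarrow> f h \<in> Q C" by auto
    have "(\<ominus>\<^bsub>RH\<^esub> f) h \<in> Q C" if h: "h \<in> H" for h
    proof -
      have "(\<ominus>\<^bsub>RH\<^esub> f) h \<oplus>\<^bsub>R\<^esub> f h = \<zero>\<^bsub>R\<^esub>"
        using RHa.l_neg[OF f(1)] RH_add[OF h, of "\<ominus>\<^bsub>RH\<^esub> f" f] RH_zero[OF h] by simp
      then have "(\<ominus>\<^bsub>RH\<^esub> f) h = \<ominus>\<^bsub>R\<^esub> f h"
        using rng.minus_equality RH_closed[OF _ h] f(1) by (metis RHa.a_inv_closed)
      then show ?thesis using f(2)[OF h] by (simp add: Q.a_inv_closed)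
    qed
    then show "\<ominus>\<^bsub>RH\<^esub> f \<in> {f \<in> carrier RH. \<forall>h\<in>H. f h \<in> Q C}"
      using f(1) by simp
  next
    show "{f \<in> carrier RH. \<forall>h\<in>H. f h \<in> Q C} \<noteq> {}"
      by (auto simp: RH_zero intro!: exI[of _ "\<zero>\<^bsub>RH\<^esub>"])
  qed (auto simp: RH_add)
qed

text \<open>For \<open>x\<close> in \<open>C\<close> and \<open>h\<close> in \<open>H\<close> the
  degree \<open>x h^-1\<close> is again in \<open>C\<close>, so the coset degree of a monomial is
  that of its coefficient. Coset homogeneity thereby becomes a condition on each coefficient
  separately, and this is the form used from here on.\<close>

lemma RHQ_eq:
  assumes C: "C \<in> carrier (G Mod H)"
  shows "RHQ C = {f \<in> carrier RH. \<forall>h\<in>H. f h \<in> Q C}"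
proof (intro equalityI subsetI)
  fix f assume "f \<in> RHQ C"
  then obtain F r where F: "finite F" "F \<subseteq> C" "r \<in> Pi F (group_ring_comp G R grd H)"
    "f = (\<Oplus>\<^bsub>RH\<^esub>x\<in>F. r x)"
    by (auto simp: quotient_comp_def)
  have "r x \<in> {f \<in> carrier RH. \<forall>h\<in>H. f h \<in> Q C}" if "x \<in> F" for x
  proof -
    have "r x \<in> group_ring_comp G R grd H x" using F(3) that by blast
    moreover have "x \<otimes>\<^bsub>G\<^esub> inv\<^bsub>G\<^esub> h \<in> C" if "h \<in> H" for h
      using coset_mult_H[OF C] \<open>x \<in> F\<close> F(2) that by blast
    then have "grd (x \<otimes>\<^bsub>G\<^esub> inv\<^bsub>G\<^esub> h) \<subseteq> Q C" if "h \<in> H" for h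
      using comp_subset_quotient_comp[OF coset_subset[OF C]] that by blast
    ultimately show ?thesis
      by (auto simp: group_ring_comp_def group_ring_def)
  qed
  then show "f \<in> {f \<in> carrier RH. \<forall>h\<in>H. f h \<in> Q C}"
    unfolding F(4) by (intro RHa.additive_subgroup_finsum_closed[OF RHQ_pointwise_subgroup[OF C]]) blast
next
  fix f assume "f \<in> {f \<in> carrier RH. \<forall>h\<in>H. f h \<in> Q C}"
  then have f: "f \<in> carrier RH" and fQ: "\<And>h. h \<in> H \<Longrightarrow> f h \<in> Q C" by auto
  \<comment> \<open>\<open>r g\<close> is the component of \<open>f\<close> of degree
    \<open>g\<close> in the \<open>G\<close>-grading of \<open>R[H]\<close>, and \<open>F\<close>
    collects the degrees \<open>h a\<close> of the monomials of \<open>f\<close>; they lie in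
    \<open>C\<close> because \<open>h\<close> does.\<close>
  define r where "r g = (\<lambda>h\<in>H. hc (f h) (g \<otimes>\<^bsub>G\<^esub> inv\<^bsub>G\<^esub> h))" for g
  define F where "F = (\<lambda>(a, h). h \<otimes>\<^bsub>G\<^esub> a) ` coeff_support f"
  have F: "finite F" unfolding F_def using finite_coeff_support[OF f] by blast
  have support: "h \<in> C" if "a \<in> H" "h \<in> carrier G" "hc (f a) h \<noteq> \<zero>\<^bsub>R\<^esub>" for a h
    using hcomponent_quotient_comp[OF coset_subset[OF C] fQ] that by blast
  have FC: "F \<subseteq> C"
    using support coset_mult_H[OF C] by (auto simp: F_def coeff_support_def)
  have FG: "F \<subseteq> carrier G" using FC coset_subset[OF C] by blast
  have r: "r g \<in> group_ring_comp G R grd H g" "r g \<in> carrier RH" if g: "g \<in> carrier G" for g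
  proof -
    have "g \<otimes>\<^bsub>G\<^esub> inv\<^bsub>G\<^esub> h \<in> carrier G" if "h \<in> H" for h using g that mem_carrier by simp
    then have "r g h \<in> grd (g \<otimes>\<^bsub>G\<^esub> inv\<^bsub>G\<^esub> h)" "r g h \<in> carrier R" "f h = \<zero>\<^bsub>R\<^esub> \<Longrightarrow> r g h = \<zero>\<^bsub>R\<^esub>"
      if "h \<in> H" for h
      using that RH_closed[OF f] by (auto simp: r_def hcomponent_mem hcomponent_closed hcomponent_zero)
    moreover from this(3) have "finite {h \<in> H. r g h \<noteq> \<zero>\<^bsub>R\<^esub>}"
      by (intro finite_subset[OF _ RH_finite[OF f]]) auto
    ultimately show "r g \<in> carrier RH" "r g \<in> group_ring_comp G R grd H g"
      by (auto simp: Rmem_carrier_iff group_ring_comp_def group_ring_carrier_def) (auto simp: r_def)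
  qed
  have rF: "r \<in> F \<rightarrow> carrier RH" using r(2) FG by blast
  have "f = (\<Oplus>\<^bsub>RH\<^esub>g\<in>F. r g)"
  proof (rule extensionalityI[of _ H])
    show "(\<Oplus>\<^bsub>RH\<^esub>g\<in>F. r g) \<in> extensional H"
      using rF by (intro RH_extensional RHa.finsum_closed)
    fix a assume a: "a \<in> H"
    then have ac: "a \<in> carrier G" using mem_carrier by blast
    have inj: "inj_on (\<lambda>g. g \<otimes>\<^bsub>G\<^esub> inv\<^bsub>G\<^esub> a) F"
      using FG ac by (intro inj_onI) (simp add: subset_iff)
    have cl: "hc (f a) h \<in> carrier R" if "h \<in> carrier G" for h
      using RH_closed[OF f a] hcomponent_closed that by blast
    have "(\<Oplus>\<^bsub>RH\<^esub>g\<in>F. r g) a = (\<Oplus>\<^bsub>R\<^esub>g\<in>F. r g a)"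
      using rF a by (rule RH_finsum_apply)
    also have "\<dots> = (\<Oplus>\<^bsub>R\<^esub>g\<in>F. hc (f a) (g \<otimes>\<^bsub>G\<^esub> inv\<^bsub>G\<^esub> a))"
      using a ac FG cl by (intro rng.finsum_cong') (auto simp: r_def)
    also have "\<dots> = (\<Oplus>\<^bsub>R\<^esub>h\<in>(\<lambda>g. g \<otimes>\<^bsub>G\<^esub> inv\<^bsub>G\<^esub> a) ` F. hc (f a) h)"
      using inj ac FG cl by (intro rng.finsum_reindex[symmetric]) auto
    also have "\<dots> = f a"
    proof (rule finsum_hcomponent[OF RH_closed[OF f a]])
      show "graded_support G R (hc (f a)) \<subseteq> (\<lambda>g. g \<otimes>\<^bsub>G\<^esub> inv\<^bsub>G\<^esub> a) ` F"
      proof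
        fix h assume "h \<in> graded_support G R (hc (f a))"
        then have h: "h \<in> carrier G" "(a, h) \<in> coeff_support f"
          using a by (auto simp: graded_support_def coeff_support_def)
        then have "h \<otimes>\<^bsub>G\<^esub> a \<in> F" unfolding F_def by force
        moreover have "h = h \<otimes>\<^bsub>G\<^esub> a \<otimes>\<^bsub>G\<^esub> inv\<^bsub>G\<^esub> a"
          using h ac by (simp add: grp.m_assoc)
        ultimately show "h \<in> (\<lambda>g. g \<otimes>\<^bsub>G\<^esub> inv\<^bsub>G\<^esub> a) ` F" by blast
      qed
    qed (use F FG ac in auto)
    finally show "f a = (\<Oplus>\<^bsub>RH\<^esub>g\<in>F. r g) a" by simp
  qed (rule RH_extensional[OF f])
  then show "f \<in> RHQ C"
    unfolding quotient_comp_def using F FC FG r(1) by blast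
qed

lemma RHQ_mult:
  assumes C: "C \<in> carrier (G Mod H)" and D: "D \<in> carrier (G Mod H)" and f: "f \<in> RHQ C" and f': "f' \<in> RHQ D"
  shows "f \<otimes>\<^bsub>RH\<^esub> f' \<in> RHQ (C \<otimes>\<^bsub>G Mod H\<^esub> D)"
proof -
  define CD where "CD = C \<otimes>\<^bsub>G Mod H\<^esub> D"
  have CD: "CD \<in> carrier (G Mod H)" unfolding CD_def using C D by (rule quo.grp.m_closed)
  note S = quo.comp_additive_subgroup[OF CD]
  have fc: "f \<in> carrier RH" "\<And>h. h \<in> H \<Longrightarrow> f h \<in> Q C" using f RHQ_eq[OF C] by auto
  have fc': "f' \<in> carrier RH" "\<And>h. h \<in> H \<Longrightarrow> f' h \<in> Q D" using f' RHQ_eq[OF D] by auto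
  \<comment> \<open>The product splits the right coefficients into \<open>G\<close>-components, so
    these too must lie in \<open>Q D\<close>: either \<open>h\<close> is in \<open>D\<close> or the
    component is zero.\<close>
  have "hc (f' b) h \<in> Q D" if "b \<in> H" "h \<in> carrier G" for b h
  proof (cases "h \<in> D")
    case True
    then have "grd h \<subseteq> Q D" by (rule comp_subset_quotient_comp[OF coset_subset[OF D]])
    then show ?thesis using hcomponent_mem RH_closed[OF fc'(1)] that by blast
  next
    case False
    then show ?thesis
      using hcomponent_quotient_comp[OF coset_subset[OF D] fc'(2)[OF that(1)] that(2)]
        quo.comp_zero[OF D] by simp
  qed
  then have "f a \<otimes>\<^bsub>R\<^esub> hc (f' b) h \<in> Q CD"
    if "a \<in> H" "b \<in> H" "h \<in> graded_support G R (hc (f' b))" for a b h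
    using that quo.comp_mult[OF C D, folded CD_def] fc(2) by (simp add: graded_support_def)
  then have "(f \<otimes>\<^bsub>RH\<^esub> f') k \<in> Q CD" if "k \<in> H" for k
    using that unfolding group_ring_def group_ring_mult_def
    by (auto intro!: rng.additive_subgroup_finsum_closed[OF S])
  then show ?thesis
    unfolding CD_def[symmetric] RHQ_eq[OF CD] using RH_mult_closed fc(1) fc'(1) by blast
qed

text \<open>By \<open>RHQ_eq\<close> the projections of \<open>R\<close> applied to each coefficient
  are the projections of \<open>R[H]\<close>. Only finitely many are nonzero, because an element has
  finitely many nonzero coefficients.\<close>

lemma RH_coset_graded: "graded_ring (G Mod H) RH RHQ"
proof -
  let ?\<pi> = "\<lambda>f C. \<lambda>h\<in>H. hcomponent (G Mod H) R Q (f h) C"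
  have \<pi>: "?\<pi> f C \<in> RHQ C" if f: "f \<in> carrier RH" and C: "C \<in> carrier (G Mod H)" for f C
  proof -
    have "finite {h \<in> H. ?\<pi> f C h \<noteq> \<zero>\<^bsub>R\<^esub>}"
      using quo.hcomponent_zero[OF C] by (intro finite_subset[OF _ RH_finite[OF f]]) auto
    then show ?thesis
      unfolding RHQ_eq[OF C] Rmem_carrier_iff
      using RH_closed[OF f] quo.hcomponent_mem[OF _ C] quo.hcomponent_closed[OF _ C] by auto
  qed
  have RHQ_closed: "f \<in> carrier RH" if "C \<in> carrier (G Mod H)" "f \<in> RHQ C" for f C
    using that RHQ_eq by auto
  have nonzero: "{C \<in> carrier (G Mod H). ?\<pi> f C \<noteq> \<zero>\<^bsub>RH\<^esub>} =
      (\<Union>a\<in>{a \<in> H. f a \<noteq> \<zero>\<^bsub>R\<^esub>}. graded_support (G Mod H) R (hcomponent (G Mod H) R Q (f a)))"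
    if f: "f \<in> carrier RH" for f
  proof -
    have "?\<pi> f C = \<zero>\<^bsub>RH\<^esub> \<longleftrightarrow> (\<forall>a\<in>H. hcomponent (G Mod H) R Q (f a) C = \<zero>\<^bsub>R\<^esub>)" for C
      by (auto simp: group_ring_def fun_eq_iff restrict_def)
    then show ?thesis
      using quo.hcomponent_zero by (auto simp: graded_support_def)
  qed
  show ?thesis
  proof (rule graded_ringI[where \<pi> = ?\<pi>])
    show "group (G Mod H)" by (rule quo.grp.is_group)
    show "ring RH" by (rule RH_ring)
    show "additive_subgroup (RHQ C) RH" if "C \<in> carrier (G Mod H)" for C
      unfolding RHQ_eq[OF that] by (rule RHQ_pointwise_subgroup[OF that])
    show "f \<otimes>\<^bsub>RH\<^esub> f' \<in> RHQ (C \<otimes>\<^bsub>G Mod H\<^esub> D)"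
      if "C \<in> carrier (G Mod H)" "D \<in> carrier (G Mod H)" "f \<in> RHQ C" "f' \<in> RHQ D" for C D f f'
      using that by (rule RHQ_mult)
  next
    fix f C assume f: "f \<in> carrier RH" and C: "C \<in> carrier (G Mod H)"
    show "?\<pi> f C \<in> RHQ C" using f C by (rule \<pi>)
  next
    fix f assume f: "f \<in> carrier RH"
    show fin: "finite {C \<in> carrier (G Mod H). ?\<pi> f C \<noteq> \<zero>\<^bsub>RH\<^esub>}"
      unfolding nonzero[OF f] using RH_finite[OF f] RH_closed[OF f] quo.finite_graded_support by blast
    have \<pi>c: "?\<pi> f \<in> {C \<in> carrier (G Mod H). ?\<pi> f C \<noteq> \<zero>\<^bsub>RH\<^esub>} \<rightarrow> carrier RH"
      using \<pi>[OF f] RHQ_closed by blast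
    show "f = (\<Oplus>\<^bsub>RH\<^esub>C\<in>{C \<in> carrier (G Mod H). ?\<pi> f C \<noteq> \<zero>\<^bsub>RH\<^esub>}. ?\<pi> f C)"
    proof (rule extensionalityI[of _ H])
      show "(\<Oplus>\<^bsub>RH\<^esub>C\<in>{C \<in> carrier (G Mod H). ?\<pi> f C \<noteq> \<zero>\<^bsub>RH\<^esub>}. ?\<pi> f C) \<in> extensional H"
        using \<pi>c by (intro RH_extensional RHa.finsum_closed)
      fix a assume a: "a \<in> H"
      have "(\<Oplus>\<^bsub>RH\<^esub>C\<in>{C \<in> carrier (G Mod H). ?\<pi> f C \<noteq> \<zero>\<^bsub>RH\<^esub>}. ?\<pi> f C) a =
          (\<Oplus>\<^bsub>R\<^esub>C\<in>{C \<in> carrier (G Mod H). ?\<pi> f C \<noteq> \<zero>\<^bsub>RH\<^esub>}. ?\<pi> f C a)"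
        using \<pi>c a by (rule RH_finsum_apply)
      also have "\<dots> = (\<Oplus>\<^bsub>R\<^esub>C\<in>{C \<in> carrier (G Mod H). ?\<pi> f C \<noteq> \<zero>\<^bsub>RH\<^esub>}. hcomponent (G Mod H) R Q (f a) C)"
        using a RH_closed[OF f a] quo.hcomponent_closed by (intro rng.finsum_cong') auto
      also have "\<dots> = f a"
      proof (rule quo.finsum_hcomponent[OF RH_closed[OF f a] fin])
        show "graded_support (G Mod H) R (hcomponent (G Mod H) R Q (f a))
            \<subseteq> {C \<in> carrier (G Mod H). ?\<pi> f C \<noteq> \<zero>\<^bsub>RH\<^esub>}"
          unfolding nonzero[OF f] using a quo.hcomponent_zero
          by (cases "f a = \<zero>\<^bsub>R\<^esub>") (auto simp: graded_support_def)
      qed blast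
      finally show "f a = (\<Oplus>\<^bsub>RH\<^esub>C\<in>{C \<in> carrier (G Mod H). ?\<pi> f C \<noteq> \<zero>\<^bsub>RH\<^esub>}. ?\<pi> f C) a"
        by simp
    qed (rule RH_extensional[OF f])
  next
    fix f f' C assume "f \<in> carrier RH" "f' \<in> carrier RH" "C \<in> carrier (G Mod H)"
    then show "?\<pi> (f \<oplus>\<^bsub>RH\<^esub> f') C = ?\<pi> f C \<oplus>\<^bsub>RH\<^esub> ?\<pi> f' C"
      using RH_closed by (auto simp: group_ring_def quo.hcomponent_add)
  next
    fix f C D assume C: "C \<in> carrier (G Mod H)" and D: "D \<in> carrier (G Mod H)" and f: "f \<in> RHQ D"
    then have "f \<in> extensional H" "\<And>h. h \<in> H \<Longrightarrow> f h \<in> Q D"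
      using RHQ_eq[OF D] RH_extensional by auto
    then show "?\<pi> f C = (if C = D then f else \<zero>\<^bsub>RH\<^esub>)"
      using quo.hcomponent_homogeneous[OF D _ C]
      by (auto simp: group_ring_def extensional_def fun_eq_iff)
  qed
qed

section \<open>Augmentation and its splitting in coset degrees\<close>

lemma aug_mem:
  assumes C: "C \<in> carrier (G Mod H)" and f: "f \<in> RHQ C"
  shows "aug f \<in> Q C"
  unfolding aug_def using f RHQ_eq[OF C]
  by (intro rng.additive_subgroup_finsum_closed[OF quo.comp_additive_subgroup[OF C]]) auto

lemma single_mem:
  assumes C: "C \<in> carrier (G Mod H)" and r: "r \<in> Q C"
  shows "single r a \<in> RHQ C"
  unfolding RHQ_eq[OF C]
  using single_closed quo.comp_closed[OF C r] quo.comp_zero[OF C] r by (auto simp: single_apply)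

text \<open>\<open>single_mult\<close> wants the right coefficient homogeneous in \<open>G\<close>,
  which an element of some \<open>Q D\<close> need not be. At the identity of \<open>H\<close>
  conjugation is trivial whatever the degree, so additivity extends the rule to all
  \<open>s\<close>.\<close>

lemma single_one_mult:
  assumes r: "r \<in> carrier R" and s: "s \<in> carrier R"
  shows "single r \<one>\<^bsub>G\<^esub> \<otimes>\<^bsub>RH\<^esub> single s \<one>\<^bsub>G\<^esub> = single (r \<otimes>\<^bsub>R\<^esub> s) \<one>\<^bsub>G\<^esub>"
  using s
proof (induction rule: homogeneous_induct)
  case zero
  then show ?case using r by (simp add: single_zero single_closed)
next
  case (homogeneous g s)
  then show ?case using single_mult[OF r homogeneous] by simp
next
  case (add s t)
  then show ?case using r by (simp add: single_add single_closed RH_r_distr rng.r_distr)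
qed

text \<open>In \<^const>\<open>graded_NR_clean\<close> the two summands may lie in different components; passing to the
  components of degree \<open>C\<close> repairs this, because each summand is then kept or replaced by 0.\<close>

lemma NR_clean_same_degree:
  assumes clean: "graded_NR_clean (G Mod H) R Q" and C: "C \<in> carrier (G Mod H)" and x: "x \<in> Q C"
  obtains r n where "r \<in> Q C" "n \<in> Q C" "r \<in> graded_regular_elements (G Mod H) R Q"
    "n \<in> nilpotent_elements R" "x = r \<oplus>\<^bsub>R\<^esub> n"
proof -
  have "x \<in> homogeneous_elements (G Mod H) Q" using C x by (auto simp: homogeneous_elements_def)
  then obtain r n where r: "r \<in> graded_regular_elements (G Mod H) R Q"
    and n: "n \<in> nilpotent_elements R" "n \<in> homogeneous_elements (G Mod H) Q" and eq: "x = r \<oplus>\<^bsub>R\<^esub> n"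
    using clean unfolding graded_NR_clean_def by blast
  obtain D where D: "D \<in> carrier (G Mod H)" "r \<in> Q D"
    using r by (auto simp: graded_regular_elements_def homogeneous_elements_def)
  obtain E where E: "E \<in> carrier (G Mod H)" "n \<in> Q E"
    using n by (auto simp: homogeneous_elements_def)
  define r' where "r' = hcomponent (G Mod H) R Q r C"
  define n' where "n' = hcomponent (G Mod H) R Q n C"
  have rc: "r \<in> carrier R" "n \<in> carrier R" using D E quo.comp_closed by blast+
  have zero: "\<zero>\<^bsub>R\<^esub> \<in> homogeneous_elements (G Mod H) Q"
    using C quo.comp_zero by (auto simp: homogeneous_elements_def)
  have "r' = r \<or> r' = \<zero>\<^bsub>R\<^esub>" "n' = n \<or> n' = \<zero>\<^bsub>R\<^esub>"
    unfolding r'_def n'_def using quo.hcomponent_homogeneous D E C by auto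
  moreover have "\<zero>\<^bsub>R\<^esub> \<in> graded_regular_elements (G Mod H) R Q"
    using zero by (auto simp: graded_regular_elements_def intro!: bexI[of _ "\<zero>\<^bsub>R\<^esub>"])
  moreover have "\<zero>\<^bsub>R\<^esub> \<in> nilpotent_elements R"
    by (auto simp: nilpotent_elements_def intro!: exI[of _ "1::nat"])
  moreover have "x = r' \<oplus>\<^bsub>R\<^esub> n'"
    using quo.hcomponent_add[OF rc C] quo.hcomponent_homogeneous[OF C x C] eq
    by (simp add: r'_def n'_def)
  moreover have "r' \<in> Q C" "n' \<in> Q C"
    unfolding r'_def n'_def using rc C quo.hcomponent_mem by auto
  ultimately show ?thesis using that r n(1) by metis
qed

end

theorem theorem3p3:
  fixes G :: "('g, 'm) monoid_scheme" and R :: "('a, 'n) ring_scheme"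
    and grd :: "'g \<Rightarrow> 'a set" and H :: "'g set" and p :: nat
  assumes "graded_ring G R grd"
    and "H \<lhd> G"
    and "locally_finite_group G" and "p_group p G"
    and "Factorial_Ring.prime p"
    and "[p] \<cdot>\<^bsub>R\<^esub> \<one>\<^bsub>R\<^esub> \<in> nilpotent_elements R"
    and "graded_NR_clean (G Mod H) R (quotient_comp R grd)"
  shows "graded_NR_clean (G Mod H) (group_ring G R grd H)
    (quotient_comp (group_ring G R grd H) (group_ring_comp G R grd H))"
proof -
  interpret coset_graded_group_ring G R grd H
    using assms(1,2,7)
    by (simp add: coset_graded_group_ring_def twisted_group_ring_def graded_NR_clean_def)
  show ?thesis
    unfolding graded_NR_clean_def
  proof (intro conjI ballI)
    show "graded_ring (G Mod H) RH RHQ" by (rule RH_coset_graded)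
    fix x assume "x \<in> homogeneous_elements (G Mod H) RHQ"
    then obtain C where C: "C \<in> carrier (G Mod H)" and x: "x \<in> RHQ C"
      unfolding homogeneous_elements_def by blast
    have xc: "x \<in> carrier RH" using x RHQ_eq[OF C] by blast
    \<comment> \<open>With \<open>r\<close> of the degree \<open>C\<close> of \<open>x\<close>, the
      difference \<open>y\<close> below is again homogeneous.\<close>
    obtain r n where r: "r \<in> Q C" "r \<in> graded_regular_elements (G Mod H) R Q"
      and n: "n \<in> nilpotent_elements R" and eq: "aug x = r \<oplus>\<^bsub>R\<^esub> n"
      using NR_clean_same_degree[OF assms(7) C aug_mem[OF C x]] by metis
    have rc: "r \<in> carrier R" using quo.comp_closed[OF C r(1)] .
    have nc: "n \<in> carrier R" using n by (simp add: nilpotent_elements_def)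
    define u where "u = single r \<one>\<^bsub>G\<^esub>"
    define y where "y = x \<ominus>\<^bsub>RH\<^esub> u"
    have u: "u \<in> RHQ C" "u \<in> carrier RH"
      using single_mem[OF C r(1)] single_closed[OF rc] by (simp_all add: u_def)
    have yc: "y \<in> carrier RH" using xc u by (simp add: y_def)
    have x_eq: "x = u \<oplus>\<^bsub>RH\<^esub> y"
      unfolding y_def a_minus_def
      using RHa.a_lcomm[OF u(2) xc RHa.a_inv_closed[OF u(2)]] RHa.r_neg[OF u(2)] xc by simp
    interpret S: additive_subgroup "RHQ C" RH
      by (rule graded_ring.comp_additive_subgroup[OF RH_coset_graded C])
    have yC: "y \<in> RHQ C"
      unfolding y_def a_minus_def using x u(1) by (simp add: S.a_inv_closed)
    have "u \<in> graded_regular_elements (G Mod H) RH RHQ"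
    proof -
      obtain a where a: "a \<in> homogeneous_elements (G Mod H) Q" "r = r \<otimes>\<^bsub>R\<^esub> a \<otimes>\<^bsub>R\<^esub> r"
        using r(2) by (auto simp: graded_regular_elements_def)
      then obtain D where D: "D \<in> carrier (G Mod H)" "a \<in> Q D"
        by (auto simp: homogeneous_elements_def)
      have ac: "a \<in> carrier R" using quo.comp_closed[OF D] .
      have "u = u \<otimes>\<^bsub>RH\<^esub> single a \<one>\<^bsub>G\<^esub> \<otimes>\<^bsub>RH\<^esub> u"
        using rc ac a(2) by (simp add: u_def single_one_mult)
      then show ?thesis
        using u(1) C D single_mem[OF D]
        by (auto simp: graded_regular_elements_def homogeneous_elements_def)
    qed
    moreover have "y \<in> nilpotent_elements RH"
    proof -
      have "r \<oplus>\<^bsub>R\<^esub> aug y = r \<oplus>\<^bsub>R\<^esub> n"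
        using aug_add[OF u(2) yc] x_eq eq aug_mono[OF rc, of "\<one>\<^bsub>G\<^esub>"] by (simp add: u_def)
      then have "aug y = n" using rc nc aug_closed[OF yc] by simp
      \<comment> \<open>Nilpotency in two stages: the power \<open>i\<close> that kills
        \<open>n\<close> moves \<open>y\<close> into the augmentation ideal, and a further power
        \<open>j\<close> kills the result.\<close>
      then obtain i :: nat where i: "aug (y [^]\<^bsub>RH\<^esub> i) = \<zero>\<^bsub>R\<^esub>"
        using n aug_pow[OF yc] by (auto simp: nilpotent_elements_def)
      obtain j :: nat where "(y [^]\<^bsub>RH\<^esub> i) [^]\<^bsub>RH\<^esub> j = \<zero>\<^bsub>RH\<^esub>"
        using nilpotent_if_aug_zero[OF assms(3,4,5,6) _ i] yc by auto
      then have "y [^]\<^bsub>RH\<^esub> (i * j) = \<zero>\<^bsub>RH\<^esub>" using yc by (simp add: RHr.nat_pow_pow)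
      then show ?thesis using yc by (auto simp: nilpotent_elements_def)
    qed
    moreover have "y \<in> homogeneous_elements (G Mod H) RHQ"
      using yC C by (auto simp: homogeneous_elements_def)
    ultimately show "\<exists>r\<in>graded_regular_elements (G Mod H) RH RHQ.
        \<exists>n\<in>nilpotent_elements RH \<inter> homogeneous_elements (G Mod H) RHQ. x = r \<oplus>\<^bsub>RH\<^esub> n"
      using x_eq by blast
  qed
qed

end
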